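(* The diffusion coefficient $D$ satisfies $$D=\lim_{z\downarrow0}\Big\{\lambda+\frac12\int_0^{+\infty}dt\ e^{-zt}\sum_{x\in\mathbb{Z}}\mathbf{E}\Big[j^A_{0,1}(\mathbf m,\omega(t))\;\tau_xj^A_{0,1}(\mathbf m,\omega(0))\Big]\Big\},$$ where $\mathbf{E}$ denotes the expectation with respect to the infinite volume process $\{\omega(t)\}_{t\ge0}$ on $\mathbb{R}^{\mathbb{Z}}$ generated by $\mathcal{L}^{\mathbf m}$, with $(\mathbf m,\omega(0))$ distributed according to $\mathbb{P}\otimes\mu_1$.
   Context: Fix $\lambda>0$, $\gamma>0$ and $C>1$. The disorder $\mathbf m=\{m_x\}_{x\in\mathbb{Z}}$ is i.i.d. with values in $[C^{-1},C]$; its law on $\Omega^{\mathcal D}=[C^{-1},C]^{\mathbb{Z}}$ is $\mathbb{P}$. $\mu_\beta$ is the product measure on $\Omega=\mathbb{R}^{\mathbb{Z}}$ with centered Gaussian marginals of variance $\beta^{-1}$, $\chi(\beta)=2\beta^{-2}$, and $\mathbb{E}^\star_\beta$ is the expectation under $\mathbb{P}\otimes\mu_\beta$. For a configuration $\omega$, $\omega^x$ is obtained by changing $\omega_x$ into $-\omega_x$, and $\omega^{x,x+1}$ by exchanging $\omega_x$ and $\omega_{x+1}$. The generator is $\mathcal{L}^{\mathbf m}=\mathcal{A}^{\mathbf m}+\mathcal{S}$ with $$\mathcal{A}^{\mathbf m}=\sum_{x\in\mathbb{Z}}\Big(\frac{\omega_{x+1}}{\sqrt{m_xm_{x+1}}}-\frac{\omega_{x-1}}{\sqrt{m_{x-1}m_x}}\Big)\frac{\partial}{\partial\omega_x},$$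 $$\mathcal{S}f(\mathbf m,\omega)=\gamma\sum_{x\in\mathbb{Z}}\big(f(\mathbf m,\omega^x)-f(\mathbf m,\omega)\big)+\lambda\sum_{x\in\mathbb{Z}}\big(f(\mathbf m,\omega^{x,x+1})-f(\mathbf m,\omega)\big).$$ Translations: $(\tau_xf)(\mathbf m,\omega)=f(\tau_x\mathbf m,\tau_x\omega)$ with $(\tau_x\mathbf m)_z=m_{x+z}$, $(\tau_x\omega)_z=\omega_{x+z}$. The current is $j^A_{0,1}(\mathbf m,\omega)=-2\omega_0\omega_1/\sqrt{m_0m_1}$. $\mathcal{Q}$ is the set of functions $f(\mathbf m,\omega)=\sum_{i\in\mathbb{Z}}\psi_{i,i}(\mathbf m)(\omega_{i+1}^2-\omega_i^2)+\sum_{i\ne j}\psi_{i,j}(\mathbf m)\omega_i\omega_j$, where each $\psi_{i,j}=\psi_{j,i}$ is a continuous function on $\Omega^{\mathcal D}$ depending on finitely many $m_x$, and all but finitely many $\psi_{i,j}$ vanish. Set $\ll g,h\gg_{\beta,\star}=\sum_{x\in\mathbb{Z}}\mathbb{E}^\star_\beta[g\,\tau_xh]$. The diffusion coefficient is $$D=\lambda+\frac1{\chi(\beta)}\inf_{f\in\mathcal{Q}}\sup_{g\in\mathcal{Q}}\Big\{\ll f,-\mathcal{S}f\gg_{\beta,\star}+2\ll j^A_{0,1}-\mathcal{A}^{\mathbf m}f,g\gg_{\beta,\star}-\ll g,-\mathcal{S}g\gg_{\beta,\star}\Big\},$$ which does not depend on $\beta>0$. *)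

theory Defs
  imports "HOL-Probability.Probability"
begin

type_synonym conf = "int \<Rightarrow> real"

text \<open>An observable \<open>f m \<omega>\<close> takes the disorder \<open>m\<close> first.\<close>
type_synonym obs = "conf \<Rightarrow> conf \<Rightarrow> real"

section \<open>Disorder and Gaussian measures\<close>

definition Omega_D :: "real \<Rightarrow> conf set" where
  "Omega_D C = {m. \<forall>x. m x \<in> {1 / C .. C}}"

text \<open>The single-site law \<open>\<nu>\<close> of the disorder lives on the space \<open>{1 / C .. C}\<close> itself
  (not on all of the reals), so that the space of \<open>\<Pi>\<^sub>M x\<in>UNIV. \<nu>\<close> is exactly \<open>Omega_D C\<close>.
  Functions of the disorder then only have to be regular on \<open>Omega_D C\<close>;
  their values elsewhere never matter.\<close>
definition disorder_site_law :: "real \<Rightarrow> real measure \<Rightarrow> bool" where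
  "disorder_site_law C \<nu> \<longleftrightarrow>
     prob_space \<nu> \<and> sets \<nu> = sets (restrict_space borel {1 / C .. C})"

definition disorder_law :: "real measure \<Rightarrow> conf measure" where
  "disorder_law \<nu> = (\<Pi>\<^sub>M x\<in>(UNIV :: int set). \<nu>)"

definition conf_space :: "conf measure" where
  "conf_space = (\<Pi>\<^sub>M x\<in>(UNIV :: int set). borel)"

text \<open>Here \<open>normal_density\<close> takes the standard deviation, and the variance is \<open>1 / \<beta>\<close>.\<close>
definition gibbs :: "real \<Rightarrow> conf measure" where
  "gibbs \<beta> = (\<Pi>\<^sub>M x\<in>(UNIV :: int set). density lborel (normal_density 0 (sqrt (1 / \<beta>))))"

definition star_measure :: "real measure \<Rightarrow> real \<Rightarrow> (conf \<times> conf) measure" where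
  "star_measure \<nu> \<beta> = disorder_law \<nu> \<Otimes>\<^sub>M gibbs \<beta>"

definition E_star :: "real measure \<Rightarrow> real \<Rightarrow> obs \<Rightarrow> real" where
  "E_star \<nu> \<beta> f = (\<integral>p. f (fst p) (snd p) \<partial>star_measure \<nu> \<beta>)"

definition chi :: "real \<Rightarrow> real" where
  "chi \<beta> = 2 / \<beta>\<^sup>2"

section \<open>Generator, translations and current\<close>

text \<open>The parentheses in \<open>(\<omega>)(x := y)\<close> avoid a clash with the Landau symbol notation.\<close>
definition flip :: "int \<Rightarrow> conf \<Rightarrow> conf" where
  "flip x \<omega> = (\<omega>)(x := - \<omega> x)"

definition exchange :: "int \<Rightarrow> conf \<Rightarrow> conf" where
  "exchange x \<omega> = (\<omega>)(x := \<omega> (x + 1), x + 1 := \<omega> x)"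

definition partial_omega :: "int \<Rightarrow> obs \<Rightarrow> obs" where
  "partial_omega x f m \<omega> = deriv (\<lambda>s. f m ((\<omega>)(x := s))) (\<omega> x)"

text \<open>All sums over sites below are applied to observables depending on finitely many
  coordinates of \<open>\<omega>\<close>, so that they have finitely many non-zero terms.\<close>

definition gen_A :: "obs \<Rightarrow> obs" where
  "gen_A f m \<omega> = (\<Sum>\<^sub>\<infinity>x\<in>UNIV.
     (\<omega> (x + 1) / sqrt (m x * m (x + 1)) - \<omega> (x - 1) / sqrt (m (x - 1) * m x))
       * partial_omega x f m \<omega>)"

definition gen_S :: "real \<Rightarrow> real \<Rightarrow> obs \<Rightarrow> obs" where
  "gen_S lam \<gamma> f m \<omega> =
     \<gamma> * (\<Sum>\<^sub>\<infinity>x\<in>UNIV. f m (flip x \<omega>) - f m \<omega>)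
     + lam * (\<Sum>\<^sub>\<infinity>x\<in>UNIV. f m (exchange x \<omega>) - f m \<omega>)"

definition gen_L :: "real \<Rightarrow> real \<Rightarrow> obs \<Rightarrow> obs" where
  "gen_L lam \<gamma> f m \<omega> = gen_A f m \<omega> + gen_S lam \<gamma> f m \<omega>"

definition shift_conf :: "int \<Rightarrow> conf \<Rightarrow> conf" where
  "shift_conf x \<omega> = (\<lambda>z. \<omega> (x + z))"

definition translate :: "int \<Rightarrow> obs \<Rightarrow> obs" where
  "translate x f m \<omega> = f (shift_conf x m) (shift_conf x \<omega>)"

definition current :: obs where
  "current m \<omega> = - 2 * \<omega> 0 * \<omega> 1 / sqrt (m 0 * m 1)"

section \<open>Diffusion coefficient\<close>

definition local_cont :: "real \<Rightarrow> (conf \<Rightarrow> real) \<Rightarrow> bool" where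
  "local_cont C \<psi> \<longleftrightarrow> continuous_on (Omega_D C) \<psi> \<and>
     (\<exists>A. finite A \<and> (\<forall>m\<in>Omega_D C. \<forall>m'\<in>Omega_D C. (\<forall>x\<in>A. m x = m' x) \<longrightarrow> \<psi> m = \<psi> m'))"

definition quad_obs :: "real \<Rightarrow> obs set" where
  "quad_obs C = {f. \<exists>\<psi> :: int \<Rightarrow> int \<Rightarrow> conf \<Rightarrow> real.
     (\<forall>i j. local_cont C (\<psi> i j)) \<and>
     (\<forall>i j. \<forall>m\<in>Omega_D C. \<psi> i j m = \<psi> j i m) \<and>
     finite {(i, j). \<exists>m\<in>Omega_D C. \<psi> i j m \<noteq> 0} \<and>
     (\<forall>m\<in>Omega_D C. \<forall>\<omega>. f m \<omega> =
        (\<Sum>\<^sub>\<infinity>i\<in>UNIV. \<psi> i i m * ((\<omega> (i + 1))\<^sup>2 - (\<omega> i)\<^sup>2))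
        + (\<Sum>\<^sub>\<infinity>(i, j)\<in>{(i, j). i \<noteq> j}. \<psi> i j m * \<omega> i * \<omega> j))}"

definition star_inner :: "real measure \<Rightarrow> real \<Rightarrow> obs \<Rightarrow> obs \<Rightarrow> real" where
  "star_inner \<nu> \<beta> g h = (\<Sum>\<^sub>\<infinity>x\<in>UNIV. E_star \<nu> \<beta> (\<lambda>m \<omega>. g m \<omega> * translate x h m \<omega>))"

definition var_functional ::
    "real \<Rightarrow> real \<Rightarrow> real measure \<Rightarrow> real \<Rightarrow> obs \<Rightarrow> obs \<Rightarrow> real" where
  "var_functional lam \<gamma> \<nu> \<beta> f g =
     star_inner \<nu> \<beta> f (\<lambda>m \<omega>. - gen_S lam \<gamma> f m \<omega>)
     + 2 * star_inner \<nu> \<beta> (\<lambda>m \<omega>. current m \<omega> - gen_A f m \<omega>) g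
     - star_inner \<nu> \<beta> g (\<lambda>m \<omega>. - gen_S lam \<gamma> g m \<omega>)"

text \<open>The infimum and supremum are taken in the extended reals, since the supremum of an
  unbounded set of reals is a meaningless value in \<open>real\<close>.\<close>
definition diffusion_coeff :: "real \<Rightarrow> real \<Rightarrow> real \<Rightarrow> real measure \<Rightarrow> real \<Rightarrow> ereal" where
  "diffusion_coeff lam \<gamma> C \<nu> \<beta> = ereal lam + ereal (1 / chi \<beta>) *
     (INF f\<in>quad_obs C. SUP g\<in>quad_obs C. ereal (var_functional lam \<gamma> \<nu> \<beta> f g))"

section \<open>The infinite volume process\<close>

text \<open>The domain on which the formal expression of the generator is read: observables depending
  on finitely many coordinates, continuous in the disorder, \<open>C\<^sup>1\<close> in \<open>\<omega>\<close>, with polynomial growth.\<close>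
definition cyl_obs :: "real \<Rightarrow> obs set" where
  "cyl_obs C = {f. \<exists>A :: int set. finite A \<and>
     (\<forall>m\<in>Omega_D C. \<forall>m'\<in>Omega_D C. \<forall>\<omega> \<omega>'.
        (\<forall>x\<in>A. m x = m' x \<and> \<omega> x = \<omega>' x) \<longrightarrow> f m \<omega> = f m' \<omega>') \<and>
     continuous_on (Omega_D C \<times> UNIV) (\<lambda>(m, \<omega>). f m \<omega>) \<and>
     (\<forall>x. \<forall>m\<in>Omega_D C. \<forall>\<omega>. (\<lambda>s. f m ((\<omega>)(x := s))) differentiable (at (\<omega> x))) \<and>
     (\<forall>x. continuous_on (Omega_D C \<times> UNIV) (\<lambda>(m, \<omega>). partial_omega x f m \<omega>)) \<and>
     (\<exists>K n. \<forall>m\<in>Omega_D C. \<forall>\<omega>.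
        \<bar>f m \<omega>\<bar> \<le> K * (1 + (\<Sum>x\<in>A. \<bar>\<omega> x\<bar>)) ^ n \<and>
        (\<forall>x\<in>A. \<bar>partial_omega x f m \<omega>\<bar> \<le> K * (1 + (\<Sum>x\<in>A. \<bar>\<omega> x\<bar>)) ^ n))}"

definition L2_star :: "real measure \<Rightarrow> obs set" where
  "L2_star \<nu> = {f. (\<lambda>p. f (fst p) (snd p)) \<in> borel_measurable (star_measure \<nu> 1) \<and>
     integrable (star_measure \<nu> 1) (\<lambda>p. (f (fst p) (snd p))\<^sup>2)}"

definition norm_star :: "real measure \<Rightarrow> obs \<Rightarrow> real" where
  "norm_star \<nu> f = sqrt (E_star \<nu> 1 (\<lambda>m \<omega>. (f m \<omega>)\<^sup>2))"

text \<open>\<open>K m t \<omega>\<close> is the law at time \<open>t\<close>, in the frozen disorder \<open>m\<close>, of the dynamics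
  started from \<open>\<omega>\<close>.\<close>
type_synonym kernel = "conf \<Rightarrow> real \<Rightarrow> conf \<Rightarrow> conf measure"

definition transition_function :: "real measure \<Rightarrow> kernel \<Rightarrow> bool" where
  "transition_function \<nu> K \<longleftrightarrow>
     (\<forall>t\<ge>0. (\<lambda>p. K (fst p) t (snd p))
        \<in> disorder_law \<nu> \<Otimes>\<^sub>M conf_space \<rightarrow>\<^sub>M prob_algebra conf_space) \<and>
     (\<forall>m\<in>space (disorder_law \<nu>). \<forall>\<omega>. K m 0 \<omega> = return conf_space \<omega>) \<and>
     (\<forall>m\<in>space (disorder_law \<nu>). \<forall>\<omega>. \<forall>s\<ge>0. \<forall>t\<ge>0.
        K m (s + t) \<omega> = K m s \<omega> \<bind> K m t)"

definition trans_op :: "kernel \<Rightarrow> real \<Rightarrow> obs \<Rightarrow> obs" where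
  "trans_op K t f m \<omega> = (\<integral>\<omega>'. f m \<omega>' \<partial>K m t \<omega>)"

definition L2_contraction_semigroup :: "real measure \<Rightarrow> kernel \<Rightarrow> bool" where
  "L2_contraction_semigroup \<nu> K \<longleftrightarrow>
     (\<forall>t\<ge>0. \<forall>f\<in>L2_star \<nu>.
        trans_op K t f \<in> L2_star \<nu> \<and> norm_star \<nu> (trans_op K t f) \<le> norm_star \<nu> f) \<and>
     (\<forall>f\<in>L2_star \<nu>.
        ((\<lambda>t. norm_star \<nu> (\<lambda>m \<omega>. trans_op K t f m \<omega> - f m \<omega>)) \<longlongrightarrow> 0) (at_right 0))"

definition L2_generator :: "real measure \<Rightarrow> kernel \<Rightarrow> (obs \<times> obs) set" where
  "L2_generator \<nu> K = {(f, g). f \<in> L2_star \<nu> \<and> g \<in> L2_star \<nu> \<and>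
     ((\<lambda>t. norm_star \<nu> (\<lambda>m \<omega>. (trans_op K t f m \<omega> - f m \<omega>) / t - g m \<omega>))
        \<longlongrightarrow> 0) (at_right 0)}"

text \<open>The semigroup is generated by \<open>gen_L\<close>: its generator in \<open>L\<^sup>2\<close> of the disorder law times the
  Gibbs measure at \<open>\<beta> = 1\<close> is the closure of \<open>gen_L\<close> on \<open>cyl_obs\<close>.\<close>
definition generated_by_L ::
    "real \<Rightarrow> real \<Rightarrow> real \<Rightarrow> real measure \<Rightarrow> kernel \<Rightarrow> bool" where
  "generated_by_L lam \<gamma> C \<nu> K \<longleftrightarrow>
     transition_function \<nu> K \<and> L2_contraction_semigroup \<nu> K \<and>
     (\<forall>f\<in>cyl_obs C. (f, gen_L lam \<gamma> f) \<in> L2_generator \<nu> K) \<and>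
     (\<forall>(f, g)\<in>L2_generator \<nu> K. \<forall>\<epsilon>>0. \<exists>h\<in>cyl_obs C.
        norm_star \<nu> (\<lambda>m \<omega>. f m \<omega> - h m \<omega>) < \<epsilon> \<and>
        norm_star \<nu> (\<lambda>m \<omega>. g m \<omega> - gen_L lam \<gamma> h m \<omega>) < \<epsilon>)"

text \<open>The sigma-algebra generated by the disorder and the path up to time \<open>s\<close>.\<close>
definition past ::
    "'a measure \<Rightarrow> real measure \<Rightarrow> ('a \<Rightarrow> conf) \<Rightarrow> (real \<Rightarrow> 'a \<Rightarrow> conf) \<Rightarrow> real \<Rightarrow> 'a measure" where
  "past M \<nu> mm W s = vimage_algebra (space M) (\<lambda>\<xi>. (mm \<xi>, \<lambda>u\<in>{0..s}. W u \<xi>))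
     (disorder_law \<nu> \<Otimes>\<^sub>M (\<Pi>\<^sub>M u\<in>{0..s}. conf_space))"

text \<open>On the probability space \<open>M\<close>, \<open>mm\<close> is the random disorder and \<open>(W t)\<close>, for \<open>t \<ge> 0\<close>, is a
  Markov process generated by \<open>gen_L\<close> in that disorder; \<open>(mm, W 0)\<close> has the law
  \<open>star_measure \<nu> 1\<close>.\<close>
definition infinite_volume_process ::
    "real \<Rightarrow> real \<Rightarrow> real \<Rightarrow> real measure \<Rightarrow> 'a measure \<Rightarrow> ('a \<Rightarrow> conf) \<Rightarrow> (real \<Rightarrow> 'a \<Rightarrow> conf) \<Rightarrow> bool"
where
  "infinite_volume_process lam \<gamma> C \<nu> M mm W \<longleftrightarrow>
     prob_space M \<and>
     mm \<in> M \<rightarrow>\<^sub>M disorder_law \<nu> \<and>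
     (\<forall>t\<ge>0. W t \<in> M \<rightarrow>\<^sub>M conf_space) \<and>
     distr M (star_measure \<nu> 1) (\<lambda>\<xi>. (mm \<xi>, W 0 \<xi>)) = star_measure \<nu> 1 \<and>
     (\<exists>K. generated_by_L lam \<gamma> C \<nu> K \<and>
        (\<forall>s t B. 0 \<le> s \<longrightarrow> s \<le> t \<longrightarrow> B \<in> sets conf_space \<longrightarrow>
           (AE \<xi> in M. real_cond_exp M (past M \<nu> mm W s) (indicator {\<zeta> \<in> space M. W t \<zeta> \<in> B}) \<xi>
              = measure (K (mm \<xi>) (t - s) (W s \<xi>)) B)))"

definition current_corr ::
    "'a measure \<Rightarrow> ('a \<Rightarrow> conf) \<Rightarrow> (real \<Rightarrow> 'a \<Rightarrow> conf) \<Rightarrow> real \<Rightarrow> int \<Rightarrow> real" where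
  "current_corr M mm W t x =
     (\<integral>\<xi>. current (mm \<xi>) (W t \<xi>) * translate x current (mm \<xi>) (W 0 \<xi>) \<partial>M)"

end

theory Submission
  imports Defs "HOL-Library.Function_Algebras" "HOL-Real_Asymp.Real_Asymp"
begin

text \<open>
The current is a quadratic form in \<open>\<omega>\<close>, and the generator maps quadratic forms to quadratic forms.
On the array \<open>\<psi>\<close> of coefficients of \<open>\<Sum> \<psi> i j m * \<omega> i * \<omega> j\<close> it acts as \<open>L = A - N\<close>, where \<open>N\<close> is
symmetric and nonnegative (flips and exchanges), \<open>A\<close> is antisymmetric (the harmonic dynamics), and
both are bounded because an entry is only coupled to neighbouring ones. The trial functions of the
variational formula are exactly the finitely supported arrays of trace zero, and by Isserlis'
theorem the covariance of two such forms is \<open>2 / \<beta>\<^sup>2\<close> times the inner product of their arrays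
(\<open>quad_obs_iff\<close>, \<open>obs_of_product\<close>). So both sides of the theorem concern one bounded operator on a
pre-Hilbert space, the form being the sum over all translations of the covariance.

On one side, the summed correlation of the current \<open>j\<close> at time \<open>t\<close> is \<open>2 * \<langle>exp (t * L) j, j\<rangle>\<close>, and its
Laplace transform is \<open>2 * \<langle>(z - L)\<^sup>-\<^sup>1 j, j\<rangle>\<close>. On the other side, the functional
\<open>\<langle>f, N f\<rangle> + 2 * \<langle>j - A f, g\<rangle> - \<langle>g, N g\<rangle>\<close> has a saddle point where \<open>N g + A f = j\<close> and
\<open>N f + A g = 0\<close>; with \<open>f = (v - u) / 2\<close> and \<open>g = (u + v) / 2\<close> these equations decouple into
\<open>(N - A) u = j\<close> and \<open>(N + A) v = j\<close>, and the value is \<open>\<langle>j, u\<rangle>\<close> (\<open>saddle_value\<close>). It remains to see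
that \<open>(z - L)\<^sup>-\<^sup>1 j\<close> converges to \<open>u = (- L)\<^sup>-\<^sup>1 j\<close> in the energy norm \<open>\<langle>f, N f\<rangle>\<close> as \<open>z\<close> tends to \<open>0\<close>
(\<open>resolvent_close\<close>). As \<open>N\<close> has no spectral gap on the diagonal, this rests on two features of the
model. The flips do give a gap off the diagonal, where the current lives, so \<open>j\<close> has finite dual norm
(\<open>arr_off_dual\<close>). And since energy is conserved, \<open>A\<close> sees the diagonal through gradients only, which
the exchanges control; hence \<open>\<langle>A f, g\<rangle>\<close> is bounded by the energy norms of \<open>f\<close> and \<open>g\<close> (\<open>arr_sector\<close>).
The space is not complete, so the equations are solved up to small errors in the dual norm, first for
\<open>N\<close> by minimisation (\<open>approx_inverse_N\<close>) and then for \<open>N - A\<close> by relaxation (\<open>approx_solution\<close>).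
Inequalities are proved for arrays in a fixed environment, integrated over the disorder, and carried
over to the summed form by averaging over large boxes (\<open>sip_ineq\<close>).

About the process one only knows that its semigroup contracts \<open>L\<^sup>2\<close> and that its generator extends
\<open>gen_L\<close>. This suffices: the Markov property and the contraction show that
\<open>t \<mapsto> E [f (\<omega> t) * G (\<omega> 0)]\<close> has derivative \<open>E [(L f) (\<omega> t) * G (\<omega> 0)]\<close>, and because \<open>L\<close> is bounded on
quadratic forms, Taylor's formula gives the exponential series (\<open>corr_sums\<close>). It can be summed over
translations since \<open>L ^ n\<close> spreads the support of the current by at most \<open>n\<close> sites
(\<open>current_corr_summable\<close>).
\<close>

section \<open>Dissipative systems on a pre-Hilbert space\<close>

text \<open>The discriminant criterion. It turns an additive estimate, valid for all multiples of a vector,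
into a product of two norms.\<close>
lemma quadratic_nonneg_imp_disc:
  fixes P Q B :: real
  assumes "\<And>s. 2 * s * B \<le> s\<^sup>2 * P + Q" and "P \<ge> 0" and "Q \<ge> 0"
  shows "\<bar>B\<bar> \<le> sqrt P * sqrt Q"
proof (cases "P = 0")
  case True
  have "B = 0"
  proof (rule ccontr)
    assume "B \<noteq> 0"
    then show False
      using assms(1)[of "(Q + 1) / (2 * B)"] True by simp
  qed
  then show ?thesis using assms by simp
next
  case False
  then have "P > 0" using assms by simp
  have "2 * (B / P) * B \<le> (B / P)\<^sup>2 * P + Q" by (rule assms)
  then have "B\<^sup>2 \<le> P * Q"
    using \<open>P > 0\<close> by (simp add: field_simps power2_eq_square)
  then have "sqrt (B\<^sup>2) \<le> sqrt (P * Q)" by (rule real_sqrt_le_mono)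
  then show ?thesis by (simp add: real_sqrt_mult)
qed

lemma le_of_mult_self_le:
  fixes a b :: real
  assumes "a * a \<le> b * a" "0 \<le> a" "0 \<le> b"
  shows "a \<le> b"
  using assms by (cases "a = 0") (auto simp: mult_le_cancel_right)

text \<open>The spaces below carry semi-inner products with a nontrivial kernel, and they are not complete.
Hence equations in them are only solved approximately, with an error that is small against
every test vector.\<close>
locale semi_inner =
  fixes V :: "'v::real_vector set" and b :: "'v \<Rightarrow> 'v \<Rightarrow> real"
  assumes subspace_V: "subspace V"
    and add_left: "\<lbrakk>x \<in> V; y \<in> V; w \<in> V\<rbrakk> \<Longrightarrow> b (x + y) w = b x w + b y w"
    and scale_left: "\<lbrakk>x \<in> V; w \<in> V\<rbrakk> \<Longrightarrow> b (r *\<^sub>R x) w = r * b x w"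
    and sym: "\<lbrakk>x \<in> V; y \<in> V\<rbrakk> \<Longrightarrow> b x y = b y x"
    and nonneg: "x \<in> V \<Longrightarrow> b x x \<ge> 0"
begin

lemma V_closed [simp, intro]:
  "0 \<in> V" "\<lbrakk>x \<in> V; y \<in> V\<rbrakk> \<Longrightarrow> x + y \<in> V" "\<lbrakk>x \<in> V; y \<in> V\<rbrakk> \<Longrightarrow> x - y \<in> V"
  "x \<in> V \<Longrightarrow> r *\<^sub>R x \<in> V"
  using subspace_V by (auto simp: subspace_0 subspace_add subspace_diff subspace_scale)

lemma sum_closed [intro]: "(\<And>i. i \<in> I \<Longrightarrow> f i \<in> V) \<Longrightarrow> (\<Sum>i\<in>I. f i) \<in> V"
  by (rule subspace_sum[OF subspace_V])

lemma zero_left: "x \<in> V \<Longrightarrow> b 0 x = 0"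
  using scale_left[of 0 x 0] by simp

lemma diff_left: "\<lbrakk>x \<in> V; y \<in> V; w \<in> V\<rbrakk> \<Longrightarrow> b (x - y) w = b x w - b y w"
  using add_left[of x "(-1) *\<^sub>R y" w] scale_left[of y w "-1"] V_closed(4)[of y "-1"] by simp

lemma add_right: "\<lbrakk>x \<in> V; y \<in> V; w \<in> V\<rbrakk> \<Longrightarrow> b w (x + y) = b w x + b w y"
  by (metis V_closed(2) add_left sym)

lemma diff_right: "\<lbrakk>x \<in> V; y \<in> V; w \<in> V\<rbrakk> \<Longrightarrow> b w (x - y) = b w x - b w y"
  by (metis V_closed(3) diff_left sym)

lemma scale_right: "\<lbrakk>x \<in> V; w \<in> V\<rbrakk> \<Longrightarrow> b w (r *\<^sub>R x) = r * b w x"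
  by (metis V_closed(4) scale_left sym)

lemma sum_left: "\<lbrakk>\<And>i. i \<in> I \<Longrightarrow> f i \<in> V; w \<in> V\<rbrakk> \<Longrightarrow> b (\<Sum>i\<in>I. f i) w = (\<Sum>i\<in>I. b (f i) w)"
  by (induction I rule: infinite_finite_induct) (auto simp: zero_left add_left sum_closed)

lemma sum_right: "\<lbrakk>\<And>i. i \<in> I \<Longrightarrow> f i \<in> V; w \<in> V\<rbrakk> \<Longrightarrow> b w (\<Sum>i\<in>I. f i) = (\<Sum>i\<in>I. b w (f i))"
  using sum_left[of I f w] sym[of w "\<Sum>i\<in>I. f i"] sum_closed[of I f]
  by (simp add: sum_left) (intro sum.cong, auto simp: sym)

lemmas bilinear_simps = add_left add_right diff_left diff_right scale_left scale_right

definition nm :: "'v \<Rightarrow> real" where "nm x = sqrt (b x x)"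

lemma nm_nonneg [simp]: "x \<in> V \<Longrightarrow> nm x \<ge> 0"
  by (simp add: nm_def nonneg)

lemma nm_sq: "x \<in> V \<Longrightarrow> (nm x)\<^sup>2 = b x x"
  by (simp add: nm_def nonneg)

lemma Cauchy_Schwarz:
  assumes "x \<in> V" "y \<in> V"
  shows "\<bar>b x y\<bar> \<le> nm x * nm y"
  unfolding nm_def
proof (rule quadratic_nonneg_imp_disc)
  fix s
  have "0 \<le> b (s *\<^sub>R x - y) (s *\<^sub>R x - y)"
    using assms by (intro nonneg) auto
  also have "\<dots> = s\<^sup>2 * b x x - 2 * s * b x y + b y y"
    using assms sym[of y x] by (simp add: bilinear_simps power2_eq_square algebra_simps)
  finally show "2 * s * b x y \<le> s\<^sup>2 * b x x + b y y" by simp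
qed (use assms nonneg in auto)

lemma nm_scale: "x \<in> V \<Longrightarrow> nm (r *\<^sub>R x) = \<bar>r\<bar> * nm x"
  by (simp add: nm_def bilinear_simps real_sqrt_mult mult.assoc[symmetric])

lemma nm_triangle:
  assumes "x \<in> V" "y \<in> V"
  shows "nm (x + y) \<le> nm x + nm y"
proof (rule power2_le_imp_le)
  have "(nm (x + y))\<^sup>2 = b x x + 2 * b x y + b y y"
    using assms sym[of y x] by (simp add: nm_sq bilinear_simps)
  also have "\<dots> \<le> (nm x + nm y)\<^sup>2"
    using Cauchy_Schwarz[OF assms] assms by (simp add: power2_sum nm_sq)
  finally show "(nm (x + y))\<^sup>2 \<le> (nm x + nm y)\<^sup>2" .
qed (use assms in simp)

lemma nm_triangle_diff:
  assumes "x \<in> V" "y \<in> V"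
  shows "nm (x - y) \<le> nm x + nm y"
  using nm_triangle[of x "(-1) *\<^sub>R y"] nm_scale[of y "-1"] V_closed(4)[of y "-1"] assms by simp

end

text \<open>The abstract form of a generator \<open>A - N\<close> whose symmetric part \<open>- N\<close> need not have a spectral gap.
The sector condition says that the antisymmetric part is controlled by the energy
\<open>ip (N x) x\<close>. It is stated additively because sums over translations preserve
inequalities between quadratic forms, but not products of norms.\<close>
locale dissipative = semi_inner V ip
  for V :: "'v::real_vector set" and ip :: "'v \<Rightarrow> 'v \<Rightarrow> real" +
  fixes N A :: "'v \<Rightarrow> 'v" and M \<kappa> :: real
  assumes linear_N: "linear N" and linear_A: "linear A"
    and N_closed [simp, intro]: "x \<in> V \<Longrightarrow> N x \<in> V"
    and A_closed [simp, intro]: "x \<in> V \<Longrightarrow> A x \<in> V"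
    and N_sym: "\<lbrakk>x \<in> V; y \<in> V\<rbrakk> \<Longrightarrow> ip (N x) y = ip x (N y)"
    and A_anti: "\<lbrakk>x \<in> V; y \<in> V\<rbrakk> \<Longrightarrow> ip (A x) y = - ip x (A y)"
    and N_nonneg: "x \<in> V \<Longrightarrow> ip (N x) x \<ge> 0"
    and N_bound: "x \<in> V \<Longrightarrow> ip (N x) x \<le> M * ip x x"
    and sector: "\<lbrakk>x \<in> V; y \<in> V\<rbrakk> \<Longrightarrow> 2 * ip (A x) y \<le> \<kappa> * (ip (N x) x + ip (N y) y)"
    and M_nonneg: "M \<ge> 0" and \<kappa>_nonneg: "\<kappa> \<ge> 0"
begin

abbreviation en :: "'v \<Rightarrow> 'v \<Rightarrow> real" where "en x y \<equiv> ip (N x) y"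

sublocale e: semi_inner V en
proof
  show "subspace V" by (rule subspace_V)
  show "en x y = en y x" if "x \<in> V" "y \<in> V" for x y
    using that N_sym[of x y] sym[of x "N y"] by simp
qed (auto simp: linear_add[OF linear_N] linear_scale[OF linear_N] bilinear_simps N_nonneg)

lemmas op_simps = linear_add[OF linear_N] linear_add[OF linear_A] linear_diff[OF linear_N]
  linear_diff[OF linear_A] linear_scale[OF linear_N] linear_scale[OF linear_A]

lemma A_skew: "x \<in> V \<Longrightarrow> ip (A x) x = 0"
  using A_anti[of x x] sym[of x "A x"] by simp

lemma sector_bound:
  assumes "x \<in> V" "y \<in> V"
  shows "\<bar>ip (A x) y\<bar> \<le> \<kappa> * e.nm x * e.nm y"
proof -
  have "\<bar>ip (A x) y\<bar> \<le> sqrt (\<kappa> * en x x) * sqrt (\<kappa> * en y y)"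
  proof (rule quadratic_nonneg_imp_disc)
    fix s
    have "2 * ip (A (s *\<^sub>R x)) y \<le> \<kappa> * (en (s *\<^sub>R x) (s *\<^sub>R x) + en y y)"
      using assms by (intro sector) auto
    then show "2 * s * ip (A x) y \<le> s\<^sup>2 * (\<kappa> * en x x) + \<kappa> * en y y"
      using assms by (simp add: op_simps bilinear_simps power2_eq_square algebra_simps)
  qed (use assms \<kappa>_nonneg N_nonneg in auto)
  also have "\<dots> = (sqrt \<kappa> * sqrt \<kappa>) * e.nm x * e.nm y"
    unfolding e.nm_def by (simp only: real_sqrt_mult mult_ac)
  finally show ?thesis using \<kappa>_nonneg by simp
qed

lemma e_nm_le: "x \<in> V \<Longrightarrow> e.nm x \<le> sqrt M * nm x"
  unfolding e.nm_def nm_def by (metis N_bound real_sqrt_le_mono real_sqrt_mult)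

text \<open>The Cauchy--Schwarz inequality for the energy form bounds a nonnegative operator by its
quadratic form.\<close>
lemma nm_N_le:
  assumes "x \<in> V"
  shows "nm (N x) \<le> M * nm x"
proof -
  have "(nm (N x))\<^sup>2 = en x (N x)" using assms by (simp add: nm_sq)
  also have "\<dots> \<le> e.nm x * e.nm (N x)"
    using e.Cauchy_Schwarz[of x "N x"] assms by simp
  also have "\<dots> \<le> (sqrt M * nm x) * (sqrt M * nm (N x))"
    using assms M_nonneg by (intro mult_mono e_nm_le) auto
  also have "\<dots> = (sqrt M * sqrt M) * nm x * nm (N x)" by (simp only: mult_ac)
  also have "\<dots> = M * nm x * nm (N x)" using M_nonneg by simp
  finally have "nm (N x) * nm (N x) \<le> (M * nm x) * nm (N x)" by (simp add: power2_eq_square)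
  then show ?thesis
    by (rule le_of_mult_self_le) (use assms M_nonneg in auto)
qed

lemma nm_A_le:
  assumes "x \<in> V"
  shows "nm (A x) \<le> \<kappa> * M * nm x"
proof -
  have "(nm (A x))\<^sup>2 = ip (A x) (A x)" using assms by (simp add: nm_sq)
  also have "\<dots> \<le> \<kappa> * e.nm x * e.nm (A x)"
    using sector_bound[of x "A x"] assms by simp
  also have "\<dots> \<le> \<kappa> * (sqrt M * nm x) * (sqrt M * nm (A x))"
    using assms M_nonneg \<kappa>_nonneg by (intro mult_mono e_nm_le mult_nonneg_nonneg) auto
  also have "\<dots> = \<kappa> * (sqrt M * sqrt M) * nm x * nm (A x)" by (simp only: mult_ac)
  also have "\<dots> = \<kappa> * M * nm x * nm (A x)" using M_nonneg by simp
  finally have "nm (A x) * nm (A x) \<le> (\<kappa> * M * nm x) * nm (A x)" by (simp add: power2_eq_square)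
  then show ?thesis
    by (rule le_of_mult_self_le) (use assms M_nonneg \<kappa>_nonneg in auto)
qed

definition L :: "'v \<Rightarrow> 'v" where "L x = A x - N x"

definition Lbd :: real where "Lbd = (\<kappa> + 1) * M"

lemma Lbd_nonneg: "Lbd \<ge> 0" using M_nonneg \<kappa>_nonneg by (simp add: Lbd_def)

lemma linear_L: "linear L"
  unfolding L_def by (intro linear_compose_sub linear_A linear_N)

lemma L_closed [simp, intro]: "x \<in> V \<Longrightarrow> L x \<in> V"
  by (simp add: L_def)

lemma L_pow_closed [simp, intro]: "x \<in> V \<Longrightarrow> (L ^^ n) x \<in> V"
  by (induction n) auto

lemma nm_L_le: "x \<in> V \<Longrightarrow> nm (L x) \<le> Lbd * nm x"
  using nm_triangle_diff[of "A x" "N x"] nm_A_le[of x] nm_N_le[of x]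
  by (simp add: L_def Lbd_def algebra_simps)

lemma nm_L_pow_le:
  assumes "x \<in> V" shows "nm ((L ^^ n) x) \<le> Lbd ^ n * nm x"
proof (induction n)
  case (Suc n)
  have "nm ((L ^^ Suc n) x) \<le> Lbd * nm ((L ^^ n) x)" using assms nm_L_le by simp
  also have "\<dots> \<le> Lbd * (Lbd ^ n * nm x)" using Suc Lbd_nonneg by (intro mult_left_mono) auto
  finally show ?case by simp
qed simp

lemma L_dissipative: "x \<in> V \<Longrightarrow> ip (L x) x = - en x x"
  by (simp add: L_def bilinear_simps A_skew)

text \<open>The minimiser of \<open>en y y - 2 * ip r y\<close> would solve \<open>N y = r\<close>. It need not exist in \<open>V\<close>,
  but perturbing an almost minimiser in an arbitrary direction shows that it solves the equation
  up to a small error in the norm dual to the energy.\<close>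
lemma approx_inverse_N:
  assumes r: "r \<in> V" and c: "\<And>g. g \<in> V \<Longrightarrow> \<bar>ip r g\<bar> \<le> c * e.nm g" and \<delta>: "\<delta> > 0"
  obtains y where "y \<in> V" "\<And>g. g \<in> V \<Longrightarrow> \<bar>ip (r - N y) g\<bar> \<le> \<delta> * e.nm g"
proof -
  define F where "F y = en y y - 2 * ip r y" for y
  have bd: "F y \<ge> - c\<^sup>2" if "y \<in> V" for y
  proof -
    have "0 \<le> (e.nm y - c)\<^sup>2" by simp
    then have "(e.nm y)\<^sup>2 - 2 * (c * e.nm y) \<ge> - c\<^sup>2" by (simp add: power2_diff algebra_simps)
    then show ?thesis using c[OF that] that by (simp add: F_def e.nm_sq abs_le_iff)
  qed
  have bdd: "bdd_below (F ` V)" by (rule bdd_belowI2[of _ "- c\<^sup>2"]) (rule bd)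
  have "(INF y\<in>V. F y) < (INF y\<in>V. F y) + \<delta>\<^sup>2" using \<delta> by simp
  then obtain y where y: "y \<in> V" "F y < (INF y\<in>V. F y) + \<delta>\<^sup>2"
    by (subst (asm) cINF_less_iff[OF _ bdd]) auto
  have "\<bar>ip (r - N y) g\<bar> \<le> \<delta> * e.nm g" if g: "g \<in> V" for g
  proof -
    have "\<bar>ip (r - N y) g\<bar> \<le> sqrt (en g g) * sqrt (\<delta>\<^sup>2)"
    proof (rule quadratic_nonneg_imp_disc)
      fix s
      have "(INF y\<in>V. F y) \<le> F (y + s *\<^sub>R g)"
        using y g by (intro cINF_lower bdd) auto
      then have "F y < F (y + s *\<^sub>R g) + \<delta>\<^sup>2" using y by simp
      moreover have "F (y + s *\<^sub>R g) = F y - 2 * s * ip (r - N y) g + s\<^sup>2 * en g g"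
        using y g r e.sym[of g y]
        by (simp add: F_def op_simps bilinear_simps power2_eq_square algebra_simps)
      ultimately show "2 * s * ip (r - N y) g \<le> s\<^sup>2 * en g g + \<delta>\<^sup>2" by simp
    qed (use g N_nonneg in auto)
    then show ?thesis using \<delta> by (simp add: e.nm_def mult.commute)
  qed
  then show ?thesis using y that by blast
qed

end

text \<open>The source \<open>j\<close> is a bounded functional for the energy norm, so the equation
\<open>N w - A w = j\<close> makes sense in the energy space.\<close>
locale dissipative_source = dissipative +
  fixes j :: 'a and c :: real
  assumes j_closed [simp, intro]: "j \<in> V"
    and j_dual: "g \<in> V \<Longrightarrow> 2 * ip j g \<le> c\<^sup>2 + ip (N g) g"
    and c_nonneg: "c \<ge> 0"
begin

lemma j_bound:
  assumes "g \<in> V" shows "\<bar>ip j g\<bar> \<le> c * e.nm g"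
proof -
  have "\<bar>ip j g\<bar> \<le> sqrt (en g g) * sqrt (c\<^sup>2)"
  proof (rule quadratic_nonneg_imp_disc)
    fix s
    have "2 * ip j (s *\<^sub>R g) \<le> c\<^sup>2 + en (s *\<^sub>R g) (s *\<^sub>R g)"
      using assms by (intro j_dual) auto
    then show "2 * s * ip j g \<le> s\<^sup>2 * en g g + c\<^sup>2"
      using assms by (simp add: op_simps bilinear_simps power2_eq_square algebra_simps)
  qed (use assms N_nonneg in auto)
  then show ?thesis using c_nonneg by (simp add: e.nm_def mult.commute)
qed

text \<open>One relaxation step \<open>w + t *\<^sub>R y\<close>, where \<open>y\<close> approximates \<open>N\<^sup>-\<^sup>1\<close> of the residual of \<open>w\<close>.
  In the energy norm the new residual is represented by \<open>(1 - t) *\<^sub>R y + t *\<^sub>R k\<close> with \<open>k\<close> close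
  to \<open>N\<^sup>-\<^sup>1 (A y)\<close>. The two vectors are almost orthogonal because \<open>A\<close> is skew, and the sector bound
  controls \<open>k\<close> by \<open>y\<close>; so the residual shrinks by a fixed factor.\<close>
lemma relaxation_step:
  assumes w: "w \<in> V" and \<eta>: "\<eta> > 0"
    and res: "\<And>g. g \<in> V \<Longrightarrow> \<bar>ip (j - (N w - A w)) g\<bar> \<le> \<eta> * e.nm g"
    and q: "\<kappa>\<^sup>2 / (1 + \<kappa>\<^sup>2) < q\<^sup>2" "q > 0"
  shows "\<exists>w'\<in>V. \<forall>g\<in>V. \<bar>ip (j - (N w' - A w')) g\<bar> \<le> q * \<eta> * e.nm g"
proof -
  \<comment> \<open>This \<open>t\<close> minimises \<open>(1 - t)\<^sup>2 + t\<^sup>2 * \<kappa>\<^sup>2\<close>, the square of the contraction factor for \<open>\<delta> = 0\<close>.\<close>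
  define t where "t = 1 / (1 + \<kappa>\<^sup>2)"
  have k1: "1 + \<kappa>\<^sup>2 > 0" by (simp add: add_pos_nonneg)
  have t01: "0 < t" "t \<le> 1" using k1 by (auto simp: t_def divide_simps)
  have t2: "(1 - t)\<^sup>2 + t\<^sup>2 * \<kappa>\<^sup>2 = \<kappa>\<^sup>2 / (1 + \<kappa>\<^sup>2)"
  proof -
    have "(1 - t)\<^sup>2 + t\<^sup>2 * \<kappa>\<^sup>2 = 1 - 2 * t + t * (t * (1 + \<kappa>\<^sup>2))"
      by (simp add: power2_eq_square algebra_simps)
    also have "t * (1 + \<kappa>\<^sup>2) = 1" using k1 by (simp add: t_def)
    also have "1 - 2 * t + t * 1 = \<kappa>\<^sup>2 / (1 + \<kappa>\<^sup>2)" using k1 by (simp add: t_def field_simps)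
    finally show ?thesis .
  qed
  define G where "G \<delta> = 2 * \<delta> + sqrt ((1 - t)\<^sup>2 * (\<eta> + \<delta>)\<^sup>2 + 2 * \<delta> * (\<eta> + \<delta>)
     + t\<^sup>2 * (\<kappa> * (\<eta> + \<delta>) + \<delta>)\<^sup>2)" for \<delta>
  have lim: "(G \<longlongrightarrow> G 0) (at_right 0)"
    unfolding G_def by (intro tendsto_intros)
  have "G 0 = sqrt (((1 - t)\<^sup>2 + t\<^sup>2 * \<kappa>\<^sup>2) * \<eta>\<^sup>2)"
    by (simp add: G_def algebra_simps power_mult_distrib)
  also have "\<dots> < sqrt (q\<^sup>2 * \<eta>\<^sup>2)"
    unfolding t2 real_sqrt_less_iff using q \<eta> by (intro mult_strict_right_mono) auto
  also have "\<dots> = q * \<eta>" using q \<eta> by (simp add: real_sqrt_mult)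
  finally have "\<forall>\<^sub>F \<delta> in at_right 0. G \<delta> < q * \<eta>"
    using lim by (intro order_tendstoD)
  moreover have "\<forall>\<^sub>F \<delta> in at_right (0::real). \<delta> > 0"
    by (simp add: eventually_at_right_less)
  ultimately have "\<forall>\<^sub>F \<delta> in at_right 0. G \<delta> < q * \<eta> \<and> \<delta> > 0"
    by (rule eventually_conj)
  then obtain \<delta> where \<delta>: "G \<delta> < q * \<eta>" "\<delta> > 0"
    using eventually_happens[of _ "at_right (0::real)"] trivial_limit_at_right_real by blast
  let ?r = "j - (N w - A w)"
  have r: "?r \<in> V" using w by auto
  obtain y where y: "y \<in> V" "\<And>g. g \<in> V \<Longrightarrow> \<bar>ip (?r - N y) g\<bar> \<le> \<delta> * e.nm g"
    using approx_inverse_N[OF r res \<delta>(2)] by blast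
  have ny: "e.nm y \<le> \<eta> + \<delta>"
  proof -
    have "(e.nm y)\<^sup>2 = ip ?r y - ip (?r - N y) y"
      using y r by (simp add: e.nm_sq bilinear_simps)
    also have "\<dots> \<le> (\<eta> + \<delta>) * e.nm y"
      using res[OF y(1)] y(2)[OF y(1)] by (simp add: algebra_simps abs_le_iff)
    finally have "e.nm y * e.nm y \<le> (\<eta> + \<delta>) * e.nm y" by (simp add: power2_eq_square)
    then show ?thesis
      by (rule le_of_mult_self_le) (use \<eta> \<delta> y(1) in auto)
  qed
  obtain k where k: "k \<in> V" "\<And>g. g \<in> V \<Longrightarrow> \<bar>ip (A y - N k) g\<bar> \<le> \<delta> * e.nm g"
    using approx_inverse_N[OF _ sector_bound[OF y(1)] \<delta>(2)] y(1) by blast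
  have nk: "e.nm k \<le> \<kappa> * e.nm y + \<delta>"
  proof -
    have "(e.nm k)\<^sup>2 = ip (A y) k - ip (A y - N k) k"
      using y(1) k(1) by (simp add: e.nm_sq bilinear_simps)
    also have "\<dots> \<le> (\<kappa> * e.nm y + \<delta>) * e.nm k"
      using sector_bound[OF y(1) k(1)] k(2)[OF k(1)] by (simp add: algebra_simps abs_le_iff)
    finally have "e.nm k * e.nm k \<le> (\<kappa> * e.nm y + \<delta>) * e.nm k" by (simp add: power2_eq_square)
    then show ?thesis
      by (rule le_of_mult_self_le) (use \<kappa>_nonneg \<delta> k(1) y(1) in auto)
  qed
  have yk: "en y k \<le> \<delta> * e.nm y"
    using k(2)[OF y(1)] y(1) k(1) e.sym[of y k] A_skew[OF y(1)] by (simp add: bilinear_simps abs_le_iff)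
  define p where "p = (1 - t) *\<^sub>R y + t *\<^sub>R k"
  have p: "p \<in> V" using y k by (auto simp: p_def)
  have np: "e.nm p \<le> G \<delta> - 2 * \<delta>"
  proof -
    have "en p p = (1 - t)\<^sup>2 * (e.nm y)\<^sup>2 + 2 * (t * (1 - t)) * en y k + t\<^sup>2 * (e.nm k)\<^sup>2"
      unfolding e.nm_sq[OF y(1)] e.nm_sq[OF k(1)] p_def using y(1) k(1) e.sym[of y k]
      by (simp add: e.bilinear_simps power2_eq_square algebra_simps)
    also have "\<dots> \<le> (1 - t)\<^sup>2 * (\<eta> + \<delta>)\<^sup>2 + 2 * \<delta> * (\<eta> + \<delta>) + t\<^sup>2 * (\<kappa> * (\<eta> + \<delta>) + \<delta>)\<^sup>2"
    proof (intro add_mono mult_left_mono power_mono)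
      have "en y k \<le> \<delta> * (\<eta> + \<delta>)"
        using yk ny \<delta> by (meson mult_left_mono order.trans less_imp_le)
      then have "(t * (1 - t)) * en y k \<le> (t * (1 - t)) * (\<delta> * (\<eta> + \<delta>))"
        using t01 by (intro mult_left_mono) auto
      also have "\<dots> \<le> 1 * (\<delta> * (\<eta> + \<delta>))"
        using t01 \<delta> \<eta> by (intro mult_right_mono mult_le_one) auto
      finally show "2 * (t * (1 - t)) * en y k \<le> 2 * \<delta> * (\<eta> + \<delta>)" by simp
      show "e.nm k \<le> \<kappa> * (\<eta> + \<delta>) + \<delta>"
        using nk ny \<kappa>_nonneg by (meson mult_left_mono order.trans add_right_mono)
    qed (use ny y(1) k(1) in auto)
    finally show ?thesis by (simp add: e.nm_def G_def)
  qed
  have "\<bar>ip (j - (N (w + t *\<^sub>R y) - A (w + t *\<^sub>R y))) g\<bar> \<le> q * \<eta> * e.nm g" if g: "g \<in> V" for g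
  proof -
    have "ip (j - (N (w + t *\<^sub>R y) - A (w + t *\<^sub>R y))) g
        = ip (?r - N y) g + t * ip (A y - N k) g + en p g"
      using w y(1) k(1) g by (simp add: p_def op_simps bilinear_simps algebra_simps)
    moreover have "t * \<bar>ip (A y - N k) g\<bar> \<le> 1 * (\<delta> * e.nm g)"
      using t01 \<delta> g by (intro mult_mono k(2)) auto
    moreover have "\<bar>t * ip (A y - N k) g\<bar> = t * \<bar>ip (A y - N k) g\<bar>"
      using t01 by (simp add: abs_mult)
    ultimately have "\<bar>ip (j - (N (w + t *\<^sub>R y) - A (w + t *\<^sub>R y))) g\<bar>
        \<le> \<delta> * e.nm g + \<delta> * e.nm g + e.nm p * e.nm g"
      using y(2)[OF g] e.Cauchy_Schwarz[OF p g] by linarith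
    also have "\<dots> = (2 * \<delta> + e.nm p) * e.nm g" by (simp add: algebra_simps)
    also have "\<dots> \<le> (q * \<eta>) * e.nm g"
      using np \<delta> g by (intro mult_right_mono) auto
    finally show ?thesis .
  qed
  then show ?thesis using w y(1) by (intro bexI[of _ "w + t *\<^sub>R y"]) auto
qed

text \<open>The relaxation steps form a geometric iteration that starts from \<open>w = 0\<close>, whose residual is \<open>j\<close>.\<close>
lemma approx_solution:
  assumes "\<epsilon> > 0"
  obtains w where "w \<in> V" "\<And>g. g \<in> V \<Longrightarrow> \<bar>ip (j - (N w - A w)) g\<bar> \<le> \<epsilon> * e.nm g"
proof -
  define q where "q = sqrt ((\<kappa>\<^sup>2 / (1 + \<kappa>\<^sup>2) + 1) / 2)"
  have k1: "1 + \<kappa>\<^sup>2 > 0" by (simp add: add_pos_nonneg)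
  have lt1: "\<kappa>\<^sup>2 / (1 + \<kappa>\<^sup>2) < 1" and ge0: "\<kappa>\<^sup>2 / (1 + \<kappa>\<^sup>2) \<ge> 0" using k1 by (auto simp: divide_simps)
  have q2: "q\<^sup>2 = (\<kappa>\<^sup>2 / (1 + \<kappa>\<^sup>2) + 1) / 2" unfolding q_def using ge0 by simp
  have half: "a < 1 \<Longrightarrow> a < (a + 1) / 2" for a :: real by simp
  have q: "\<kappa>\<^sup>2 / (1 + \<kappa>\<^sup>2) < q\<^sup>2" unfolding q2
    using lt1 by (rule half)
  have qpos: "q > 0" unfolding q_def
    using add_nonneg_pos[OF ge0 zero_less_one] by (intro real_sqrt_gt_zero) (simp only: half_gt_zero)
  have q1: "q < 1"
    unfolding q_def using lt1 by (simp add: real_sqrt_lt_1_iff)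
  have step: "\<exists>w\<in>V. \<forall>g\<in>V. \<bar>ip (j - (N w - A w)) g\<bar> \<le> q ^ n * (c + 1) * e.nm g" for n
  proof (induction n)
    case 0
    have "\<bar>ip j g\<bar> \<le> (c + 1) * e.nm g" if "g \<in> V" for g
      using j_bound[OF that] e.nm_nonneg[OF that] by (simp add: algebra_simps)
    then show ?case
      by (intro bexI[of _ 0]) (auto simp: linear_0[OF linear_N] linear_0[OF linear_A])
  next
    case (Suc n)
    then obtain w where w: "w \<in> V" "\<And>g. g \<in> V \<Longrightarrow> \<bar>ip (j - (N w - A w)) g\<bar> \<le> q ^ n * (c + 1) * e.nm g"
      by blast
    have "q ^ n * (c + 1) > 0" using qpos c_nonneg by simp
    from relaxation_step[OF w(1) this w(2) q qpos] show ?case by (simp add: mult.assoc)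
  qed
  have "(\<lambda>n. q ^ n * (c + 1)) \<longlonglongrightarrow> 0 * (c + 1)"
    using qpos q1 by (intro tendsto_intros LIMSEQ_power_zero) auto
  then have "\<forall>\<^sub>F n in sequentially. q ^ n * (c + 1) < \<epsilon>"
    using assms by (intro order_tendstoD) auto
  then obtain n where n: "q ^ n * (c + 1) < \<epsilon>" using eventually_happens sequentially_bot by blast
  obtain w where w: "w \<in> V" "\<And>g. g \<in> V \<Longrightarrow> \<bar>ip (j - (N w - A w)) g\<bar> \<le> q ^ n * (c + 1) * e.nm g"
    using step by blast
  have "\<bar>ip (j - (N w - A w)) g\<bar> \<le> \<epsilon> * e.nm g" if "g \<in> V" for g
    using w(2)[OF that] mult_right_mono[OF less_imp_le[OF n] e.nm_nonneg[OF that]] by linarith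
  then show ?thesis using w(1) that by blast
qed

end

context dissipative
begin

text \<open>The iteration \<open>x \<mapsto> x + \<tau> *\<^sub>R (b - (z *\<^sub>R x - L x))\<close> contracts the residual for small \<open>\<tau>\<close>: to first
order in \<open>\<tau>\<close> dissipativity gains \<open>\<tau> * z\<close>, and boundedness of \<open>L\<close> makes the loss quadratic in \<open>\<tau>\<close>.\<close>
lemma approx_resolvent:
  assumes z: "z > 0" and b: "b \<in> V" and \<delta>: "\<delta> > 0"
  obtains x where "x \<in> V" "nm (z *\<^sub>R x - L x - b) \<le> \<delta>"
proof -
  define K where "K = z + Lbd"
  have K: "K > 0" "z \<le> K" using z Lbd_nonneg by (auto simp: K_def)
  define q where "q = sqrt (1 - z\<^sup>2 / K\<^sup>2)"
  have "z\<^sup>2 / K\<^sup>2 \<le> 1" "0 < z\<^sup>2 / K\<^sup>2" using K z by (auto simp: divide_simps power_mono)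
  then have q: "0 \<le> q" "q < 1" "q\<^sup>2 = 1 - z\<^sup>2 / K\<^sup>2" by (auto simp: q_def)
  \<comment> \<open>This \<open>\<tau>\<close> minimises the bound \<open>1 - 2 * \<tau> * z + \<tau>\<^sup>2 * K\<^sup>2\<close> for the squared contraction factor.\<close>
  define \<tau> where "\<tau> = z / K\<^sup>2"
  let ?R = "\<lambda>x. z *\<^sub>R x - L x"
  have step: "nm (y - ?R (\<tau> *\<^sub>R y)) \<le> q * nm y" if y: "y \<in> V" for y
  proof (rule power2_le_imp_le)
    have "nm (?R y) \<le> K * nm y"
      using nm_triangle_diff[of "z *\<^sub>R y" "L y"] nm_L_le[OF y] nm_scale[OF y, of z] y z
      by (simp add: K_def algebra_simps)
    then have "(nm (?R y))\<^sup>2 \<le> (K * nm y)\<^sup>2" using y by (intro power_mono) auto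
    then have 1: "\<tau>\<^sup>2 * ip (?R y) (?R y) \<le> \<tau>\<^sup>2 * (K\<^sup>2 * ip y y)"
      using y by (intro mult_left_mono) (auto simp: nm_sq power_mult_distrib)
    have 2: "\<tau> * ip (?R y) y \<ge> \<tau> * (z * ip y y)"
      using y K z N_nonneg[OF y] by (intro mult_left_mono) (auto simp: bilinear_simps L_dissipative \<tau>_def)
    have "(nm (y - ?R (\<tau> *\<^sub>R y)))\<^sup>2 = (nm (y - \<tau> *\<^sub>R ?R y))\<^sup>2"
      by (simp add: linear_scale[OF linear_L] scaleR_diff_right mult.commute)
    also have "\<dots> = ip (y - \<tau> *\<^sub>R ?R y) (y - \<tau> *\<^sub>R ?R y)"
      using y by (intro nm_sq V_closed L_closed)
    also have "\<dots> = ip y y - 2 * (\<tau> * ip (?R y) y) + \<tau>\<^sup>2 * ip (?R y) (?R y)"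
    proof -
      define r where "r = ?R y"
      have "r \<in> V" using y by (auto simp: r_def)
      then show ?thesis
        unfolding r_def[symmetric] using y sym[of y r]
        by (simp add: bilinear_simps power2_eq_square algebra_simps)
    qed
    also have "\<dots> \<le> ip y y - 2 * (\<tau> * (z * ip y y)) + \<tau>\<^sup>2 * (K\<^sup>2 * ip y y)"
      using 1 2 by linarith
    also have "\<dots> = q\<^sup>2 * ip y y"
      unfolding q(3) using K by (simp add: \<tau>_def power2_eq_square field_simps)
    finally show "(nm (y - ?R (\<tau> *\<^sub>R y)))\<^sup>2 \<le> (q * nm y)\<^sup>2"
      using y by (simp add: power_mult_distrib nm_sq)
  qed (use y q in auto)
  have it: "\<exists>x\<in>V. nm (b - ?R x) \<le> q ^ n * nm b" for n
  proof (induction n)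
    case 0
    show ?case using b by (intro bexI[of _ 0]) (auto simp: linear_0[OF linear_L])
  next
    case (Suc n)
    then obtain x where x: "x \<in> V" "nm (b - ?R x) \<le> q ^ n * nm b" by blast
    let ?y = "b - ?R x"
    have y: "?y \<in> V" using x b by auto
    have "b - ?R (x + t) = ?y - ?R t" for t
      by (simp add: linear_add[OF linear_L] scaleR_add_right)
    from this[of "\<tau> *\<^sub>R ?y"] have "nm (b - ?R (x + \<tau> *\<^sub>R ?y)) \<le> q * nm ?y"
      using step[OF y] by (simp only:)
    also have "\<dots> \<le> q * (q ^ n * nm b)" using x q by (intro mult_left_mono) auto
    finally show ?case using x y by (intro bexI[of _ "x + \<tau> *\<^sub>R ?y"]) (auto simp: mult.assoc)
  qed
  have "(\<lambda>n. q ^ n * nm b) \<longlonglongrightarrow> 0 * nm b"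
    using q by (intro tendsto_intros LIMSEQ_power_zero) auto
  then have "\<forall>\<^sub>F n in sequentially. q ^ n * nm b < \<delta>"
    using \<delta> by (intro order_tendstoD) auto
  then obtain n where n: "q ^ n * nm b < \<delta>" using eventually_happens sequentially_bot by blast
  obtain x where x: "x \<in> V" "nm (b - ?R x) \<le> q ^ n * nm b" using it by blast
  have "nm (?R x - b) = nm (b - ?R x)"
    using nm_scale[of "b - ?R x" "-1"] x b by (simp add: V_closed)
  then show ?thesis using x n that[of x] by simp
qed

end

context dissipative_source
begin

text \<open>The functional whose minimax value is, up to the additive constant \<open>lam\<close>, the diffusion coefficient.\<close>
definition \<Phi> :: "'a \<Rightarrow> 'a \<Rightarrow> real" where
  "\<Phi> f g = en f f + 2 * ip (j - A f) g - en g g"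

text \<open>The adjoint of \<open>A - N\<close> is \<open>- A - N\<close>, so the second of the two equations behind the saddle point is of
the same type as the first.\<close>
lemma adjoint: "dissipative_source V ip N (\<lambda>x. - A x) M \<kappa> j c"
proof (intro dissipative_source.intro dissipative.intro dissipative_axioms.intro
    dissipative_source_axioms.intro semi_inner_axioms)
  show "linear (\<lambda>x. - A x)" by (intro linear_compose_neg linear_A)
  show "- A x \<in> V" if "x \<in> V" for x
    using V_closed(4)[OF A_closed[OF that], of "-1"] by simp
  have neg: "ip (- A x) y = - ip (A x) y" "ip y (- A x) = - ip y (A x)" if "x \<in> V" "y \<in> V" for x y
    using that scale_left[of "A x" y "-1"] scale_right[of "A x" y "-1"] by auto
  show "ip (- A x) y = - ip x (- A y)" if "x \<in> V" "y \<in> V" for x y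
    using that by (simp add: neg A_anti)
  show "2 * ip (- A x) y \<le> \<kappa> * (ip (N x) x + ip (N y) y)" if "x \<in> V" "y \<in> V" for x y
    using sector[of "(-1) *\<^sub>R x" y] V_closed(4)[OF that(1), of "-1"] that
      scale_left[of "A x" y "-1"] scale_left[of "N x" x "-1"] scale_right[of x "N x" "-1"]
    using linear_scale[OF linear_A, of "-1" x] linear_scale[OF linear_N, of "-1" x]
    by (simp add: neg) (metis (no_types, opaque_lifting) N_closed V_closed(4) minus_minus mult_minus1 scaleR_minus1_left scale_left scale_right)
qed (auto intro: N_sym N_nonneg N_bound M_nonneg \<kappa>_nonneg j_dual c_nonneg linear_N)

text \<open>Testing the equation with \<open>w\<close> itself removes \<open>A\<close> and leaves the energy of \<open>w\<close>.\<close>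
lemma approx_solution_energy:
  assumes w: "w \<in> V" and res: "\<And>g. g \<in> V \<Longrightarrow> \<bar>ip (j - (N w - A w)) g\<bar> \<le> \<epsilon> * e.nm g"
    and "\<epsilon> \<ge> 0"
  shows "e.nm w \<le> c + \<epsilon>"
proof -
  have "(e.nm w)\<^sup>2 = ip j w - ip (j - (N w - A w)) w"
    using w by (simp add: e.nm_sq bilinear_simps A_skew)
  also have "\<dots> \<le> (c + \<epsilon>) * e.nm w"
    using res[OF w] j_bound[OF w] by (simp add: algebra_simps abs_le_iff)
  finally have "e.nm w * e.nm w \<le> (c + \<epsilon>) * e.nm w" by (simp add: power2_eq_square)
  then show ?thesis
    by (rule le_of_mult_self_le) (use w c_nonneg assms(3) in auto)
qed

lemma complete_square_le:
  fixes a x :: real shows "2 * (a * x) - x\<^sup>2 \<le> a\<^sup>2"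
  using zero_le_power2[of "a - x"] by (simp add: power2_diff)

text \<open>With \<open>u\<close> and \<open>v\<close> approximate solutions of \<open>(N - A) u = j\<close> and \<open>(N + A) v = j\<close>, the pair
  \<open>f = (v - u) / 2\<close>, \<open>g = (u + v) / 2\<close> is an approximate saddle point of \<open>\<Phi>\<close>:
  \<open>N g + A f = j\<close> and \<open>N f + A g = 0\<close>. The value of \<open>\<Phi>\<close> there is \<open>ip j u\<close>.\<close>
lemma saddle_value:
  assumes "0 < \<epsilon>" "\<epsilon> \<le> 1"
    and u: "u \<in> V" and ru: "\<And>x. x \<in> V \<Longrightarrow> \<bar>ip (j - (N u - A u)) x\<bar> \<le> \<epsilon> * e.nm x"
    and v: "v \<in> V" and rv: "\<And>x. x \<in> V \<Longrightarrow> \<bar>ip (j - (N v + A v)) x\<bar> \<le> \<epsilon> * e.nm x"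
  defines "K \<equiv> 10 * (c + 1) + 1"
  shows "(INF f\<in>V. SUP g\<in>V. ereal (\<Phi> f g)) \<le> ereal (ip j u + K * \<epsilon>)"
    and "ereal (ip j u - K * \<epsilon>) \<le> (INF f\<in>V. SUP g\<in>V. ereal (\<Phi> f g))"
proof -
  define R where "R = c + 1"
  interpret adj: dissipative_source V ip N "\<lambda>x. - A x" M \<kappa> j c by (rule adjoint)
  have nu: "e.nm u \<le> R" and nv: "e.nm v \<le> R"
    using approx_solution_energy[OF u ru] adj.approx_solution_energy[OF v, of \<epsilon>] rv assms(1,2)
    by (auto simp: R_def)
  define f where "f = (1/2) *\<^sub>R (v - u)"
  define g where "g = (1/2) *\<^sub>R (u + v)"
  have fV: "f \<in> V" and gV: "g \<in> V" using u v by (auto simp: f_def g_def)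
  have nf: "e.nm f \<le> R" and ng: "e.nm g \<le> R"
    using e.nm_triangle[OF u v] e.nm_triangle_diff[OF v u] nu nv u v
    by (auto simp: f_def g_def e.nm_scale)
  define r1 where "r1 = j - N g - A f"
  define r2 where "r2 = N f + A g"
  have rV: "r1 \<in> V" "r2 \<in> V" using fV gV by (auto simp: r1_def r2_def)
  have r1: "\<bar>ip r1 x\<bar> \<le> \<epsilon> * e.nm x" and r2: "\<bar>ip r2 x\<bar> \<le> \<epsilon> * e.nm x" if x: "x \<in> V" for x
  proof -
    have "2 * ip r1 x = ip (j - (N u - A u)) x + ip (j - (N v + A v)) x"
      using x u v by (simp add: r1_def f_def g_def op_simps bilinear_simps field_simps)
    then show "\<bar>ip r1 x\<bar> \<le> \<epsilon> * e.nm x" using ru[OF x] rv[OF x] by linarith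
    have "2 * ip r2 x = ip (j - (N u - A u)) x - ip (j - (N v + A v)) x"
      using x u v by (simp add: r2_def f_def g_def op_simps bilinear_simps field_simps)
    then show "\<bar>ip r2 x\<bar> \<le> \<epsilon> * e.nm x" using ru[OF x] rv[OF x] by linarith
  qed
  have \<epsilon>R: "\<epsilon> * e.nm f \<le> \<epsilon> * R" "\<epsilon> * e.nm g \<le> \<epsilon> * R"
    using nf ng assms(1) by (auto intro: mult_left_mono)
  have eps: "\<bar>ip r1 f\<bar> \<le> \<epsilon> * R" "\<bar>ip r1 g\<bar> \<le> \<epsilon> * R" "\<bar>ip r2 f\<bar> \<le> \<epsilon> * R" "\<bar>ip r2 g\<bar> \<le> \<epsilon> * R"
    using r1[OF fV] r1[OF gV] r2[OF fV] r2[OF gV] \<epsilon>R by linarith+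
  have anti: "ip (A f) g = - ip (A g) f" using A_anti[OF fV gV] sym[of f "A g"] fV gV by simp
  have energies: "en f f + en g g = ip j g - ip r1 g + ip r2 f"
    using fV gV anti by (simp add: r1_def r2_def bilinear_simps)
  have jf: "ip j f = ip r2 g + ip r1 f"
    using fV gV by (simp add: r1_def r2_def bilinear_simps A_skew e.sym[of f g])
  have jg: "ip j g = ip j u + ip j f"
    using u v by (simp add: f_def g_def bilinear_simps field_simps)
  have sum_le: "\<bar>en f f + en g g - ip j u\<bar> \<le> 4 * (\<epsilon> * R)" and jg_le: "\<bar>ip j g - ip j u\<bar> \<le> 2 * (\<epsilon> * R)"
    using energies jf jg eps by linarith+
  have e2: "\<epsilon>\<^sup>2 \<le> \<epsilon>" using assms(1,2) by (simp add: power2_eq_square)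
  have K\<epsilon>: "K * \<epsilon> = 10 * (\<epsilon> * R) + \<epsilon>" by (simp add: K_def R_def algebra_simps)
  have "\<Phi> f x \<le> ip j u + K * \<epsilon>" if x: "x \<in> V" for x
  proof -
    have "\<Phi> f x = en f f + 2 * (ip (N g) x + ip r1 x) - (e.nm x)\<^sup>2"
      using x fV gV by (simp add: \<Phi>_def r1_def bilinear_simps e.nm_sq)
    also have "\<dots> \<le> en f f + 2 * ((e.nm g + \<epsilon>) * e.nm x) - (e.nm x)\<^sup>2"
      using e.Cauchy_Schwarz[OF gV x] r1[OF x] by (simp add: algebra_simps abs_le_iff)
    also have "\<dots> \<le> en f f + (e.nm g + \<epsilon>)\<^sup>2"
      using complete_square_le[of "e.nm g + \<epsilon>" "e.nm x"] by simp
    also have "\<dots> = en f f + en g g + 2 * (\<epsilon> * e.nm g) + \<epsilon>\<^sup>2"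
      using gV by (simp add: power2_sum e.nm_sq algebra_simps)
    also have "\<dots> \<le> ip j u + K * \<epsilon>" using \<epsilon>R sum_le e2 eps K\<epsilon> by linarith
    finally show ?thesis .
  qed
  then have "(SUP x\<in>V. ereal (\<Phi> f x)) \<le> ereal (ip j u + K * \<epsilon>)"
    by (intro SUP_least) simp
  then show "(INF f\<in>V. SUP g\<in>V. ereal (\<Phi> f g)) \<le> ereal (ip j u + K * \<epsilon>)"
    using fV by (rule INF_lower2[rotated])
  have "ip j u - K * \<epsilon> \<le> \<Phi> x g" if x: "x \<in> V" for x
  proof -
    have "\<Phi> x g = (e.nm x)\<^sup>2 + 2 * ip j g + 2 * (ip r2 x - ip (N f) x) - en g g"
      using x fV gV A_anti[OF x gV] sym[of x "A g"] by (simp add: \<Phi>_def r2_def bilinear_simps e.nm_sq)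
    also have "\<dots> \<ge> (e.nm x)\<^sup>2 + 2 * ip j g - 2 * ((e.nm f + \<epsilon>) * e.nm x) - en g g"
      using e.Cauchy_Schwarz[OF fV x] r2[OF x] by (simp add: algebra_simps abs_le_iff)
    finally have "\<Phi> x g \<ge> 2 * ip j g - en g g - (e.nm f + \<epsilon>)\<^sup>2"
      using complete_square_le[of "e.nm f + \<epsilon>" "e.nm x"] by linarith
    also have "(e.nm f + \<epsilon>)\<^sup>2 = en f f + 2 * (\<epsilon> * e.nm f) + \<epsilon>\<^sup>2"
      using fV by (simp add: power2_sum e.nm_sq algebra_simps)
    finally show ?thesis using \<epsilon>R sum_le jg_le e2 eps K\<epsilon> by linarith
  qed
  then have "ereal (ip j u - K * \<epsilon>) \<le> (SUP x\<in>V. ereal (\<Phi> f' x))" if "f' \<in> V" for f'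
    using gV that by (intro SUP_upper2[of g]) auto
  then show "ereal (ip j u - K * \<epsilon>) \<le> (INF f\<in>V. SUP g\<in>V. ereal (\<Phi> f g))"
    by (intro INF_greatest)
qed

text \<open>An approximate solution \<open>x\<close> of \<open>(z - L) x = j\<close> stays close, in the energy norm, to an approximate
solution \<open>w\<close> of the limiting equation \<open>- L w = j\<close>: up to the error of \<open>x\<close>, the difference \<open>d\<close> solves
\<open>(z - L) d = r - z *\<^sub>R w\<close> with \<open>r\<close> small in the dual norm, and the term \<open>z *\<^sub>R w\<close> costs only
\<open>O (z)\<close> when the equation is tested with \<open>d\<close>.\<close>
lemma resolvent_close:
  assumes z: "z > 0" and "\<epsilon> > 0"
    and w: "w \<in> V" and res: "\<And>g. g \<in> V \<Longrightarrow> \<bar>ip (j - (N w - A w)) g\<bar> \<le> \<epsilon> * e.nm g"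
    and x: "x \<in> V" and rho: "nm (z *\<^sub>R x - L x - j) \<le> \<delta>"
  shows "(e.nm (x - w))\<^sup>2 \<le> \<epsilon>\<^sup>2 + (z * nm w + \<delta>)\<^sup>2 / (2 * z)"
proof -
  define d where "d = x - w"
  define \<rho> where "\<rho> = z *\<^sub>R x - L x - j"
  have V: "d \<in> V" "\<rho> \<in> V" using x w by (auto simp: d_def \<rho>_def)
  have id: "z * ip d d + en d d = ip (j - (N w - A w)) d - z * ip w d + ip \<rho> d"
  proof -
    have "z *\<^sub>R d - L d = (j - (N w - A w)) - z *\<^sub>R w + \<rho>"
      by (simp add: d_def \<rho>_def L_def op_simps algebra_simps)
    then have "ip (z *\<^sub>R d - L d) d = ip ((j - (N w - A w)) - z *\<^sub>R w + \<rho>) d" by simp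
    then show ?thesis using V w by (simp add: bilinear_simps L_dissipative)
  qed
  have "z * (nm d)\<^sup>2 + (e.nm d)\<^sup>2 \<le> \<epsilon> * e.nm d + (z * nm w + \<delta>) * nm d"
  proof -
    have "\<bar>z * ip w d\<bar> \<le> z * (nm w * nm d)"
      using z Cauchy_Schwarz[OF w V(1)] by (simp add: abs_mult mult_left_mono)
    moreover have "\<bar>ip \<rho> d\<bar> \<le> \<delta> * nm d"
      using Cauchy_Schwarz[OF V(2,1)] rho V by (smt (verit) \<rho>_def mult_right_mono nm_nonneg)
    ultimately show ?thesis
      using id res[OF V(1)] V by (simp add: nm_sq e.nm_sq algebra_simps)
  qed
  moreover have "2 * (\<epsilon> * e.nm d) \<le> \<epsilon>\<^sup>2 + (e.nm d)\<^sup>2"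
    using complete_square_le[of \<epsilon> "e.nm d"] by simp
  moreover have "2 * ((z * nm w + \<delta>) * nm d) \<le> (z * nm w + \<delta>)\<^sup>2 / (2 * z) + 2 * z * (nm d)\<^sup>2"
  proof -
    define p where "p = z * nm w + \<delta>"
    have "0 \<le> (p - 2 * z * nm d)\<^sup>2 / (2 * z)" using z by simp
    also have "\<dots> = p\<^sup>2 / (2 * z) + 2 * z * (nm d)\<^sup>2 - 2 * (p * nm d)"
      using z by (simp add: power2_eq_square field_simps)
    finally show ?thesis by (simp add: p_def)
  qed
  ultimately show ?thesis unfolding d_def[symmetric] by linarith
qed

text \<open>The hypothesis says that \<open>Lap z\<close> equals \<open>ip ((z - L)\<^sup>-\<^sup>1 j) j\<close>, in a form that
  makes sense although \<open>V\<close> need not contain the resolvent.\<close>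
theorem resolvent_tendsto_INF_SUP:
  assumes Lap: "\<And>z x. \<lbrakk>z > 0; x \<in> V\<rbrakk> \<Longrightarrow> \<bar>Lap z - ip x j\<bar> \<le> nm (z *\<^sub>R x - L x - j) * nm j / z"
  shows "((\<lambda>z. ereal (Lap z)) \<longlongrightarrow> (INF f\<in>V. SUP g\<in>V. ereal (\<Phi> f g))) (at_right 0)"
proof -
  interpret adj: dissipative_source V ip N "\<lambda>x. - A x" M \<kappa> j c by (rule adjoint)
  let ?D = "INF f\<in>V. SUP g\<in>V. ereal (\<Phi> f g)"
  define K where "K = 10 * (c + 1) + 1"
  have K: "K > 0" using c_nonneg by (simp add: K_def)
  have key: "\<exists>w\<in>V. ?D \<le> ereal (ip j w + K * \<epsilon>) \<and> ereal (ip j w - K * \<epsilon>) \<le> ?D \<and>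
      (\<forall>g\<in>V. \<bar>ip (j - (N w - A w)) g\<bar> \<le> \<epsilon> * e.nm g)" if "0 < \<epsilon>" "\<epsilon> \<le> 1" for \<epsilon>
  proof -
    obtain u where u: "u \<in> V" "\<And>g. g \<in> V \<Longrightarrow> \<bar>ip (j - (N u - A u)) g\<bar> \<le> \<epsilon> * e.nm g"
      using approx_solution[OF \<open>0 < \<epsilon>\<close>] by blast
    obtain v where v: "v \<in> V" "\<And>g. g \<in> V \<Longrightarrow> \<bar>ip (j - (N v - - A v)) g\<bar> \<le> \<epsilon> * e.nm g"
      using adj.approx_solution[OF \<open>0 < \<epsilon>\<close>] by blast
    show ?thesis
      using saddle_value[OF that u v(1)] v(2) u unfolding K_def by (intro bexI[of _ u]) auto
  qed
  have fin: "\<bar>?D\<bar> \<noteq> \<infinity>"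
    using key[of 1] by auto
  then obtain D where D: "?D = ereal D" by (cases ?D) auto
  have "(Lap \<longlongrightarrow> D) (at_right 0)"
  proof (rule tendstoI)
    fix e' :: real assume e': "e' > 0"
    define \<epsilon> where "\<epsilon> = min 1 (e' / (4 * (K + c + 1)))"
    have K4: "4 * (K + c + 1) > 0" using K c_nonneg by simp
    have \<epsilon>: "0 < \<epsilon>" "\<epsilon> \<le> 1" using K4 e' by (auto simp: \<epsilon>_def)
    have "\<epsilon> * (4 * (K + c + 1)) \<le> e' / (4 * (K + c + 1)) * (4 * (K + c + 1))"
      using K4 by (intro mult_right_mono) (auto simp: \<epsilon>_def)
    then have \<epsilon>2: "\<epsilon> * (4 * (K + c + 1)) \<le> e'" using K4 by simp
    obtain w where w: "w \<in> V" "?D \<le> ereal (ip j w + K * \<epsilon>)" "ereal (ip j w - K * \<epsilon>) \<le> ?D"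
      "\<And>g. g \<in> V \<Longrightarrow> \<bar>ip (j - (N w - A w)) g\<bar> \<le> \<epsilon> * e.nm g"
      using key[OF \<epsilon>] by blast
    have Dw: "\<bar>ip j w - D\<bar> \<le> K * \<epsilon>" using w(2,3) unfolding D by auto
    have "((\<lambda>z. 2 * z * (nm w + 1)\<^sup>2) \<longlongrightarrow> 2 * 0 * (nm w + 1)\<^sup>2) (at_right 0)"
      by (intro tendsto_intros)
    then have "\<forall>\<^sub>F z in at_right 0. 2 * z * (nm w + 1)\<^sup>2 < \<epsilon>\<^sup>2"
      using \<epsilon> by (intro order_tendstoD) auto
    moreover have "\<forall>\<^sub>F z in at_right (0::real). z > 0" by (simp add: eventually_at_right_less)
    ultimately show "\<forall>\<^sub>F z in at_right 0. dist (Lap z) D < e'"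
    proof eventually_elim
      case (elim z)
      define \<delta> where "\<delta> = z * min 1 (\<epsilon> / (nm j + 1))"
      have nj: "nm j + 1 > 0" by (simp add: add_nonneg_pos)
      have \<delta>: "\<delta> > 0" "\<delta> \<le> z" "\<delta> * (nm j + 1) \<le> z * \<epsilon>"
      proof -
        show "\<delta> > 0" using elim \<epsilon> nj by (auto simp: \<delta>_def)
        show "\<delta> \<le> z" using mult_left_mono[of "min 1 (\<epsilon> / (nm j + 1))" 1 z] elim by (simp add: \<delta>_def)
        have "min 1 (\<epsilon> / (nm j + 1)) * (nm j + 1) \<le> \<epsilon> / (nm j + 1) * (nm j + 1)"
          using nj by (intro mult_right_mono) auto
        also have "\<dots> = \<epsilon>" using nj by simp
        finally show "\<delta> * (nm j + 1) \<le> z * \<epsilon>" using elim by (simp add: \<delta>_def mult.assoc mult_left_mono)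
      qed
      obtain x where x: "x \<in> V" "nm (z *\<^sub>R x - L x - j) \<le> \<delta>"
        using approx_resolvent[OF elim(2) j_closed \<delta>(1)] by blast
      have "(e.nm (x - w))\<^sup>2 \<le> \<epsilon>\<^sup>2 + (z * nm w + \<delta>)\<^sup>2 / (2 * z)"
        using resolvent_close[OF elim(2) \<epsilon>(1) w(1,4) x] .
      also have "(z * nm w + \<delta>)\<^sup>2 / (2 * z) \<le> (z * (nm w + 1))\<^sup>2 / (2 * z)"
        using \<delta> elim w(1) by (intro divide_right_mono power_mono) (auto simp: algebra_simps)
      also have "\<dots> = (2 * z * (nm w + 1)\<^sup>2) / 4" using elim(2) by (simp add: power2_eq_square)
      also have "\<epsilon>\<^sup>2 + \<dots> \<le> (2 * \<epsilon>)\<^sup>2" using elim(1)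
        by (simp add: power_mult_distrib, use zero_le_power2[of \<epsilon>] in linarith)
      finally have xw: "e.nm (x - w) \<le> 2 * \<epsilon>" using \<epsilon> by (intro power2_le_imp_le[of "e.nm (x - w)"]) auto
      have "\<bar>ip x j - ip j w\<bar> = \<bar>ip j (x - w)\<bar>"
        using x w by (simp add: bilinear_simps sym[of x j])
      also have "\<dots> \<le> c * (2 * \<epsilon>)"
        using j_bound[of "x - w"] x w xw c_nonneg by (meson V_closed(3) mult_left_mono order.trans)
      finally have 1: "\<bar>ip x j - ip j w\<bar> \<le> 2 * (c * \<epsilon>)" by simp
      have "\<bar>Lap z - ip x j\<bar> \<le> nm (z *\<^sub>R x - L x - j) * nm j / z" using elim x by (intro Lap)
      also have "\<dots> \<le> (\<delta> * (nm j + 1)) / z"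
        using x elim \<delta> by (intro divide_right_mono mult_mono) auto
      also have "\<dots> \<le> (z * \<epsilon>) / z" using \<delta> elim by (intro divide_right_mono) auto
      also have "\<dots> = \<epsilon>" using elim by simp
      finally have 2: "\<bar>Lap z - ip x j\<bar> \<le> \<epsilon>" .
      have "\<bar>Lap z - D\<bar> \<le> \<epsilon> + 2 * (c * \<epsilon>) + K * \<epsilon>" using 1 2 Dw by linarith
      also have "\<dots> < \<epsilon> * (4 * (K + c + 1))"
      proof -
        have "\<epsilon> * (4 * (K + c + 1)) = 4 * (K * \<epsilon>) + 4 * (c * \<epsilon>) + 4 * \<epsilon>" by (simp add: algebra_simps)
        moreover have "0 < K * \<epsilon>" "0 \<le> c * \<epsilon>" using \<epsilon> K c_nonneg by auto
        ultimately show ?thesis using \<epsilon> by linarith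
      qed
      finally show ?case using \<epsilon>2 by (simp add: dist_real_def)
    qed
  qed
  then show ?thesis unfolding D by (intro tendsto_intros)
qed

end

text \<open>The coefficients of \<open>(1 + t / n * x) ^ n\<close> converge to those of the exponential series.\<close>
lemma binomial_div_power_tendsto:
  "(\<lambda>n. real (n choose k) * (t / real n) ^ k) \<longlonglongrightarrow> t ^ k / fact k"
proof -
  have "(\<lambda>n. (\<Prod>i = 0..<k. 1 - real i / real n) * t ^ k / fact k) \<longlonglongrightarrow>
      (\<Prod>i = 0..<k. 1 - 0) * t ^ k / fact k"
    by (intro tendsto_intros lim_const_over_n) simp
  moreover have "\<forall>\<^sub>F n in sequentially.
      (\<Prod>i = 0..<k. 1 - real i / real n) * t ^ k / fact k = real (n choose k) * (t / real n) ^ k"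
    using eventually_gt_at_top[of 0]
  proof eventually_elim
    case (elim n)
    have "(\<Prod>i = 0..<k. 1 - real i / real n) = (\<Prod>i = 0..<k. (real n - real i) / real n)"
      using elim by (intro prod.cong) (auto simp: field_simps)
    also have "\<dots> = (\<Prod>i = 0..<k. real n - real i) / real n ^ k"
      by (simp add: prod_dividef)
    finally show ?case
      by (simp add: binomial_gbinomial gbinomial_prod_rev power_divide)
  qed
  ultimately show ?thesis by (auto intro: Lim_transform_eventually)
qed

lemma exp_neg_set_integrable:
  assumes "z > (0::real)"
  shows "set_integrable lborel {0..} (\<lambda>t. exp (- z * t))"
    and "(LBINT t:{0..}. exp (- z * t)) = 1 / z"
proof -
  have "(\<integral>\<^sup>+ t. ennreal (exp (- z * t)) * indicator {0..} t \<partial>lborel) = ennreal (0 - (- exp (- z * 0) / z))"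
  proof (rule nn_integral_FTC_atLeast)
    show "DERIV (\<lambda>t. - exp (- z * t) / z) t :> exp (- z * t)" for t
      using assms by (auto intro!: derivative_eq_intros)
    show "((\<lambda>t. - exp (- z * t) / z) \<longlongrightarrow> 0) at_top"
      using assms by real_asymp
  qed auto
  also have "(\<integral>\<^sup>+ t. ennreal (exp (- z * t)) * indicator {0..} t \<partial>lborel)
      = (\<integral>\<^sup>+ t. ennreal (indicator {0..} t * exp (- z * t)) \<partial>lborel)"
    by (intro nn_integral_cong) (auto simp: indicator_def)
  finally have "has_bochner_integral lborel (\<lambda>t. indicator {0..} t * exp (- z * t)) (1 / z)"
    using assms by (intro has_bochner_integral_nn_integral) auto
  then show "set_integrable lborel {0..} (\<lambda>t. exp (- z * t))"
    and "(LBINT t:{0..}. exp (- z * t)) = 1 / z"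
    by (auto simp: set_integrable_def set_lebesgue_integral_def has_bochner_integral_iff)
qed

context dissipative
begin

text \<open>This is \<open>ip (exp (t * L) x) y\<close>. It is defined by its power series because \<open>exp (t * L) x\<close> itself may
lie outside \<open>V\<close>.\<close>
definition evol :: "'v \<Rightarrow> 'v \<Rightarrow> real \<Rightarrow> real" where
  "evol x y t = (\<Sum>n. ip ((L ^^ n) x) y / fact n * t ^ n)"

lemma ip_L_pow_le:
  assumes "x \<in> V" "y \<in> V"
  shows "\<bar>ip ((L ^^ n) x) y\<bar> \<le> Lbd ^ n * (nm x * nm y)"
proof -
  have "\<bar>ip ((L ^^ n) x) y\<bar> \<le> nm ((L ^^ n) x) * nm y" using assms by (intro Cauchy_Schwarz) auto
  also have "\<dots> \<le> (Lbd ^ n * nm x) * nm y"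
    using assms by (intro mult_right_mono nm_L_pow_le) auto
  finally show ?thesis by (simp add: mult.assoc)
qed

lemma evol_term_le:
  assumes "x \<in> V" "y \<in> V"
  shows "\<bar>ip ((L ^^ n) x) y / fact n * t ^ n\<bar> \<le> (\<bar>t\<bar> * Lbd) ^ n / fact n * (nm x * nm y)"
proof -
  have "\<bar>ip ((L ^^ n) x) y\<bar> * (\<bar>t\<bar> ^ n / fact n) \<le> Lbd ^ n * (nm x * nm y) * (\<bar>t\<bar> ^ n / fact n)"
    using ip_L_pow_le[OF assms] by (intro mult_right_mono) auto
  then show ?thesis by (simp add: abs_mult power_abs power_mult_distrib field_simps)
qed

lemma exp_series_summable: "summable (\<lambda>n. s ^ n / fact n * (r::real))" for s :: real
  using summable_mult2[OF summable_exp[of s], of r] by (simp add: field_simps)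

lemma evol_summable:
  assumes "x \<in> V" "y \<in> V"
  shows "summable (\<lambda>n. ip ((L ^^ n) x) y / fact n * t ^ n)"
  by (rule summable_comparison_test'[OF exp_series_summable[of "\<bar>t\<bar> * Lbd" "nm x * nm y"], of 0])
     (use evol_term_le[OF assms] in auto)

lemma evol_0: "evol x y 0 = ip x y"
  unfolding evol_def by (subst powser_zero) simp

lemma evol_deriv:
  assumes "x \<in> V" "y \<in> V"
  shows "(evol x y has_real_derivative evol (L x) y t) (at t)"
proof -
  have "((\<lambda>t. \<Sum>n. ip ((L ^^ n) x) y / fact n * t ^ n) has_real_derivative
      (\<Sum>n. diffs (\<lambda>n. ip ((L ^^ n) x) y / fact n) n * t ^ n)) (at t)"
    by (rule termdiffs_strong_converges_everywhere) (rule evol_summable[OF assms])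
  moreover have "diffs (\<lambda>n. ip ((L ^^ n) x) y / fact n) n = ip ((L ^^ n) (L x)) y / fact n" for n
    by (simp add: diffs_def funpow_swap1 fact_Suc del: of_nat_Suc)
  ultimately show ?thesis by (simp add: evol_def[abs_def])
qed

lemma evol_diff:
  assumes "x \<in> V" "x' \<in> V" "y \<in> V"
  shows "evol (x - x') y t = evol x y t - evol x' y t"
proof -
  have eq: "(L ^^ n) (x - x') = (L ^^ n) x - (L ^^ n) x'" for n
    by (induction n) (auto simp: linear_diff[OF linear_L])
  show ?thesis
    unfolding evol_def eq using assms
    by (subst suminf_diff[OF evol_summable evol_summable])
       (auto simp: bilinear_simps left_diff_distrib diff_divide_distrib)
qed

lemma evol_scale:
  assumes "x \<in> V" "y \<in> V"
  shows "evol (r *\<^sub>R x) y t = r * evol x y t"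
proof -
  have "(L ^^ n) (r *\<^sub>R x) = r *\<^sub>R (L ^^ n) x" for n
    by (induction n) (auto simp: linear_scale[OF linear_L])
  then show ?thesis
    unfolding evol_def using assms
    by (subst suminf_mult[OF evol_summable, symmetric]) (auto simp: bilinear_simps mult.assoc)
qed

lemma Euler_step_expansion:
  assumes "x \<in> V" "y \<in> V"
  shows "ip (((\<lambda>x. x + \<tau> *\<^sub>R L x) ^^ n) x) y = (\<Sum>k\<le>n. real (n choose k) * \<tau> ^ k * ip ((L ^^ k) x) y)"
  using assms(1)
proof (induction n arbitrary: x)
  case (Suc n)
  let ?E = "\<lambda>x. x + \<tau> *\<^sub>R L x"
  have linE: "linear ?E"
    by (intro linear_compose_add linear_id[unfolded id_def] linear_compose_scale_right linear_L)
  have lin: "(?E ^^ n) (a + r *\<^sub>R b') = (?E ^^ n) a + r *\<^sub>R (?E ^^ n) b'" for a b' r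
  proof (induction n)
    case (Suc n)
    then show ?case
      using linear_add[OF linE, of "(?E ^^ n) a" "r *\<^sub>R (?E ^^ n) b'"]
        linear_scale[OF linE, of r "(?E ^^ n) b'"] by simp
  qed simp
  have cl: "(?E ^^ n) a \<in> V" if "a \<in> V" for a using that by (induction n) auto
  have "ip ((?E ^^ Suc n) x) y = ip ((?E ^^ n) x) y + \<tau> * ip ((?E ^^ n) (L x)) y"
    using Suc.prems assms(2) cl[of x] cl[of "L x"]
    by (simp add: funpow_Suc_right o_apply lin bilinear_simps del: funpow.simps)
  also have "\<dots> = (\<Sum>k\<le>n. real (n choose k) * \<tau> ^ k * ip ((L ^^ k) x) y)
      + \<tau> * (\<Sum>k\<le>n. real (n choose k) * \<tau> ^ k * ip ((L ^^ k) (L x)) y)"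
    using Suc by simp
  also have "(\<Sum>k\<le>n. real (n choose k) * \<tau> ^ k * ip ((L ^^ k) x) y)
      = (\<Sum>k\<le>Suc n. real (n choose k) * \<tau> ^ k * ip ((L ^^ k) x) y)" by simp
  also have "\<dots> = ip x y + (\<Sum>k\<le>n. real (n choose Suc k) * \<tau> ^ Suc k * ip ((L ^^ Suc k) x) y)"
    by (subst sum.atMost_Suc_shift) simp
  also have "\<tau> * (\<Sum>k\<le>n. real (n choose k) * \<tau> ^ k * ip ((L ^^ k) (L x)) y)
      = (\<Sum>k\<le>n. real (n choose k) * \<tau> ^ Suc k * ip ((L ^^ Suc k) x) y)"
    by (simp add: sum_distrib_left funpow_swap1 mult_ac)
  also have "ip x y + (\<Sum>k\<le>n. real (n choose Suc k) * \<tau> ^ Suc k * ip ((L ^^ Suc k) x) y) + \<dots>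
      = ip x y + (\<Sum>k\<le>n. real (Suc n choose Suc k) * \<tau> ^ Suc k * ip ((L ^^ Suc k) x) y)"
    by (simp add: sum.distrib[symmetric] algebra_simps)
  also have "\<dots> = (\<Sum>k\<le>Suc n. real (Suc n choose k) * \<tau> ^ k * ip ((L ^^ k) x) y)"
    by (subst sum.atMost_Suc_shift) simp
  finally show ?case .
qed simp

text \<open>The semigroup \<open>exp (t * L)\<close> is a contraction because \<open>L\<close> is dissipative. It is approached
  by the Euler scheme \<open>(1 + (t / n) * L) ^ n\<close>, whose norm exceeds \<open>1\<close> only by \<open>O (1 / n)\<close>.\<close>
lemma evol_contraction:
  assumes x: "x \<in> V" and y: "y \<in> V" and t: "t \<ge> 0"
  shows "\<bar>evol x y t\<bar> \<le> nm x * nm y"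
proof -
  let ?E = "\<lambda>n x. x + (t / real n) *\<^sub>R L x"
  define a where "a k n = real (n choose k) * (t / real n) ^ k * ip ((L ^^ k) x) y" for k n :: nat
  have a_sum: "(\<Sum>k. a k n) = ip ((?E n ^^ n) x) y" for n
  proof -
    have "(\<Sum>k. a k n) = (\<Sum>k\<le>n. a k n)"
      by (rule suminf_finite) (auto simp: a_def)
    then show ?thesis using Euler_step_expansion[OF x y] by (simp add: a_def)
  qed
  have lim: "(\<lambda>n. \<Sum>k. a k n) \<longlonglongrightarrow> (\<Sum>k. ip ((L ^^ k) x) y / fact k * t ^ k)"
  proof (rule conjunct2[OF conjunct2[OF tannerys_theorem]])
    show "(\<lambda>n. a k n) \<longlonglongrightarrow> ip ((L ^^ k) x) y / fact k * t ^ k" for k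
    proof -
      have "(\<lambda>n. a k n) \<longlonglongrightarrow> t ^ k / fact k * ip ((L ^^ k) x) y"
        unfolding a_def by (intro tendsto_intros binomial_div_power_tendsto)
      then show ?thesis by (simp add: field_simps)
    qed
    show "\<forall>\<^sub>F (k, n) in sequentially \<times>\<^sub>F sequentially.
        norm (a k n) \<le> (t * Lbd) ^ k / fact k * (nm x * nm y)"
    proof (rule always_eventually, clarify)
      fix k n :: nat
      have b: "real (n choose k) * (t / real n) ^ k \<le> t ^ k / fact k"
      proof (cases "n = 0")
        case False
        have "real ((n choose k) * fact k) \<le> real (n ^ k)"
          using binomial_fact_pow[of n k] by (simp only: of_nat_le_iff)
        then have "real (n choose k) * fact k * t ^ k \<le> real n ^ k * t ^ k"
          using t by (intro mult_right_mono) auto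
        then show ?thesis using False by (simp add: field_simps power_divide)
      next
        case True
        then show ?thesis using t by (cases k) auto
      qed
      have "norm (a k n) = (real (n choose k) * (t / real n) ^ k) * \<bar>ip ((L ^^ k) x) y\<bar>"
        using t by (simp add: a_def abs_mult)
      also have "\<dots> \<le> (t ^ k / fact k) * (Lbd ^ k * (nm x * nm y))"
        using t by (intro mult_mono b ip_L_pow_le x y) auto
      finally show "norm (a k n) \<le> (t * Lbd) ^ k / fact k * (nm x * nm y)"
        by (simp add: power_mult_distrib mult_ac)
    qed
    show "summable (\<lambda>k. (t * Lbd) ^ k / fact k * (nm x * nm y))" by (rule exp_series_summable)
  qed simp
  have E_cl: "?E n v \<in> V" if "v \<in> V" for n v using that by auto
  have E_nm: "nm (?E n v) \<le> exp ((t * Lbd / real n)\<^sup>2 / 2) * nm v" if v: "v \<in> V" for n v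
  proof (rule power2_le_imp_le)
    let ?s = "t / real n"
    have "(nm (L v))\<^sup>2 \<le> (Lbd * nm v)\<^sup>2" using v nm_L_le by (intro power_mono) auto
    then have Lv: "?s\<^sup>2 * ip (L v) (L v) \<le> ?s\<^sup>2 * (Lbd * nm v)\<^sup>2"
      using v by (intro mult_left_mono) (auto simp: nm_sq)
    have "ip (L v) v \<le> 0" using N_nonneg[OF v] by (simp add: L_dissipative v)
    then have neg: "?s * ip (L v) v \<le> 0" using t by (intro mult_nonneg_nonpos) auto
    have "(nm (?E n v))\<^sup>2 = ip v v + 2 * (?s * ip (L v) v) + ?s\<^sup>2 * ip (L v) (L v)"
    proof -
      define s where "s = t / real n"
      show ?thesis unfolding s_def[symmetric]
        using v sym[of v "L v"] nm_sq[of "v + s *\<^sub>R L v"]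
        by (simp add: bilinear_simps power2_eq_square algebra_simps)
    qed
    also have "\<dots> \<le> (nm v)\<^sup>2 + ?s\<^sup>2 * (Lbd * nm v)\<^sup>2" using Lv neg v by (simp add: nm_sq)
    also have "\<dots> = (1 + (t * Lbd / real n)\<^sup>2) * (nm v)\<^sup>2"
      by (simp add: power2_eq_square algebra_simps)
    also have "\<dots> \<le> exp ((t * Lbd / real n)\<^sup>2) * (nm v)\<^sup>2"
      by (intro mult_right_mono exp_ge_add_one_self) auto
    also have "\<dots> = (exp ((t * Lbd / real n)\<^sup>2 / 2) * nm v)\<^sup>2"
      by (simp add: power_mult_distrib exp_double[symmetric])
    finally show "(nm (?E n v))\<^sup>2 \<le> (exp ((t * Lbd / real n)\<^sup>2 / 2) * nm v)\<^sup>2" .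
  qed (use v in auto)
  have E_pow: "(?E n ^^ m) x \<in> V \<and> nm ((?E n ^^ m) x) \<le> exp (real m * ((t * Lbd / real n)\<^sup>2 / 2)) * nm x" for n m
  proof (induction m)
    case (Suc m)
    have "nm ((?E n ^^ Suc m) x) \<le> exp ((t * Lbd / real n)\<^sup>2 / 2) * nm ((?E n ^^ m) x)"
      using E_nm Suc by simp
    also have "\<dots> \<le> exp ((t * Lbd / real n)\<^sup>2 / 2) * (exp (real m * ((t * Lbd / real n)\<^sup>2 / 2)) * nm x)"
      using Suc by (intro mult_left_mono) auto
    also have "\<dots> = exp (real (Suc m) * ((t * Lbd / real n)\<^sup>2 / 2)) * nm x"
      by (simp add: exp_add[symmetric] mult.assoc[symmetric] ring_distribs)
    finally show ?case using Suc E_cl by auto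
  qed (use x in auto)
  have le: "\<bar>\<Sum>k. a k n\<bar> \<le> exp ((t * Lbd)\<^sup>2 / 2 / real n) * nm x * nm y" if "n > 0" for n
  proof -
    have "\<bar>\<Sum>k. a k n\<bar> \<le> nm ((?E n ^^ n) x) * nm y"
      unfolding a_sum using E_pow y by (intro Cauchy_Schwarz) auto
    also have "\<dots> \<le> (exp (real n * ((t * Lbd / real n)\<^sup>2 / 2)) * nm x) * nm y"
      using E_pow y by (intro mult_right_mono) auto
    also have "real n * ((t * Lbd / real n)\<^sup>2 / 2) = (t * Lbd)\<^sup>2 / 2 / real n"
      using that by (simp add: power2_eq_square field_simps)
    finally show ?thesis .
  qed
  have "(\<lambda>n. exp ((t * Lbd)\<^sup>2 / 2 / real n) * nm x * nm y) \<longlonglongrightarrow> exp 0 * nm x * nm y"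
    by (intro tendsto_intros lim_const_over_n)
  moreover have "(\<lambda>n. \<bar>\<Sum>k. a k n\<bar>) \<longlonglongrightarrow> \<bar>evol x y t\<bar>"
    unfolding evol_def by (intro tendsto_intros lim)
  ultimately show ?thesis
    using le by (intro LIMSEQ_le[where X = "\<lambda>n. \<bar>\<Sum>k. a k n\<bar>"]) (auto intro!: exI[of _ 1])
qed

lemma evol_measurable:
  assumes "x \<in> V" "y \<in> V" shows "evol x y \<in> borel_measurable borel"
  using evol_deriv[OF assms]
  by (intro borel_measurable_continuous_onI continuous_at_imp_continuous_on) (blast intro: DERIV_isCont)

lemma Laplace_evol_integrable:
  assumes "x \<in> V" "y \<in> V" "z > 0"
  shows "set_integrable lborel {0..} (\<lambda>t. exp (- z * t) * evol x y t)"
proof -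
  have "set_integrable lborel {0..} (\<lambda>t. exp (- z * t) * (nm x * nm y))"
    using exp_neg_set_integrable(1)[OF assms(3)] by simp
  then show ?thesis
  proof (rule set_integrable_bound)
    show "set_borel_measurable lborel {0..} (\<lambda>t. exp (- z * t) * evol x y t)"
      unfolding set_borel_measurable_def using evol_measurable[OF assms(1,2)] by measurable
    show "AE t in lborel. t \<in> {0..} \<longrightarrow>
        norm (exp (- z * t) * evol x y t) \<le> norm (exp (- z * t) * (nm x * nm y))"
      using evol_contraction[OF assms(1,2)] assms by (auto simp: abs_mult)
  qed
qed

lemma Laplace_evol_le:
  assumes "x \<in> V" "y \<in> V" "z > 0"
  shows "\<bar>LBINT t:{0..}. exp (- z * t) * evol x y t\<bar> \<le> nm x * nm y / z"
proof -
  have "norm (LBINT t:{0..}. exp (- z * t) * evol x y t) \<le> (LBINT t:{0..}. norm (exp (- z * t) * evol x y t))"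
    by (intro set_integral_norm_bound Laplace_evol_integrable assms)
  also have "\<dots> \<le> (LBINT t:{0..}. exp (- z * t) * (nm x * nm y))"
    using exp_neg_set_integrable(1)[OF assms(3)] evol_contraction[OF assms(1,2)]
      Laplace_evol_integrable[OF assms]
    by (intro set_integral_mono set_integrable_norm) (auto simp: abs_mult)
  also have "\<dots> = nm x * nm y / z"
    using exp_neg_set_integrable[OF assms(3)] by (simp add: set_integral_mult_left)
  finally show ?thesis by simp
qed

text \<open>An antiderivative of the integrand is \<open>- exp (- z * t) * evol x y t\<close>, which vanishes at infinity by
contractivity.\<close>
lemma Laplace_evol_resolvent:
  assumes x: "x \<in> V" and y: "y \<in> V" and z: "z > 0"
  shows "(LBINT t:{0..}. exp (- z * t) * evol (z *\<^sub>R x - L x) y t) = ip x y"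
proof -
  let ?f = "\<lambda>t. exp (- z * t) * evol (z *\<^sub>R x - L x) y t"
  let ?F = "\<lambda>t. - exp (- z * t) * evol x y t"
  have V: "z *\<^sub>R x - L x \<in> V" using x by auto
  have der: "(?F has_real_derivative ?f t) (at t)" for t
    using x y by (auto intro!: derivative_eq_intros evol_deriv
        simp: evol_diff evol_scale algebra_simps)
  have fin: "(LBINT t:{0..T}. ?f t) = ip x y + ?F T" if "T \<ge> 0" for T
  proof -
    have "(LBINT t. ?f t * indicator {0..T} t) = ?F T - ?F 0"
    proof (rule integral_FTC_Icc_real[OF that der])
      show "isCont ?f t" for t
        using evol_deriv[OF V y, of t] by (intro continuous_intros) (rule DERIV_isCont)
    qed
    then show ?thesis by (simp add: set_lebesgue_integral_def evol_0 mult.commute)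
  qed
  have "((\<lambda>T. LBINT t:{0..T}. ?f t) \<longlongrightarrow> (LBINT t:{0..}. ?f t)) at_top"
    by (intro tendsto_set_lebesgue_integral_at_top Laplace_evol_integrable V y z) auto
  moreover have "((\<lambda>T. LBINT t:{0..T}. ?f t) \<longlongrightarrow> ip x y) at_top"
  proof -
    have "((\<lambda>T. exp (- z * T)) \<longlongrightarrow> 0) at_top"
      using z by real_asymp
    then have "((\<lambda>T. exp (- z * T) * (nm x * nm y)) \<longlongrightarrow> 0) at_top"
      by (rule tendsto_mult_left_zero)
    then have "(?F \<longlongrightarrow> 0) at_top"
    proof (rule Lim_null_comparison[rotated])
      show "\<forall>\<^sub>F T in at_top. norm (?F T) \<le> exp (- z * T) * (nm x * nm y)"
        using eventually_ge_at_top[of 0]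
        by eventually_elim (use evol_contraction[OF x y] in \<open>simp add: abs_mult\<close>)
    qed
    then have "((\<lambda>T. ip x y + ?F T) \<longlongrightarrow> ip x y + 0) at_top" by (intro tendsto_intros)
    moreover have "\<forall>\<^sub>F T in at_top. ip x y + ?F T = (LBINT t:{0..T}. ?f t)"
      using eventually_ge_at_top[of 0] by eventually_elim (use fin in simp)
    ultimately have "((\<lambda>T. LBINT t:{0..T}. ?f t) \<longlongrightarrow> ip x y + 0) at_top"
      by (rule Lim_transform_eventually)
    then show ?thesis by simp
  qed
  ultimately show ?thesis using tendsto_unique[OF trivial_limit_at_top_linorder] by blast
qed

end

context dissipative_source
begin

theorem Laplace_tendsto_INF_SUP:
  "((\<lambda>z. ereal (LBINT t:{0..}. exp (- z * t) * evol j j t)) \<longlongrightarrow>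
     (INF f\<in>V. SUP g\<in>V. ereal (\<Phi> f g))) (at_right 0)"
proof (rule resolvent_tendsto_INF_SUP)
  fix z :: real and x
  assume z: "z > 0" and x: "x \<in> V"
  let ?r = "z *\<^sub>R x - L x - j"
  have V: "?r \<in> V" "z *\<^sub>R x - L x \<in> V" using x by auto
  have r: "exp (- z * t) * evol ?r j t
      = exp (- z * t) * evol (z *\<^sub>R x - L x) j t - exp (- z * t) * evol j j t" for t
    unfolding evol_diff[OF V(2) j_closed j_closed] by (rule right_diff_distrib)
  have "(LBINT t:{0..}. exp (- z * t) * evol ?r j t)
      = (LBINT t:{0..}. exp (- z * t) * evol (z *\<^sub>R x - L x) j t - exp (- z * t) * evol j j t)"
    by (simp only: r)
  also have "\<dots> = ip x j - (LBINT t:{0..}. exp (- z * t) * evol j j t)"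
    using Laplace_evol_resolvent[OF x j_closed z]
    by (simp only: set_integral_diff(2)[OF Laplace_evol_integrable[OF V(2) j_closed z]
          Laplace_evol_integrable[OF j_closed j_closed z]])
  finally show "\<bar>(LBINT t:{0..}. exp (- z * t) * evol j j t) - ip x j\<bar> \<le> nm ?r * nm j / z"
    using Laplace_evol_le[OF V(1) j_closed z] by simp
qed

end

section \<open>Summing over translations\<close>

text \<open>In the double sum over a box of side \<open>n\<close> all but a bounded number of rows contribute the full
sum of \<open>\<beta>\<close>. If the full sum were negative, the double sum would be negative for large \<open>n\<close>.\<close>
lemma nonneg_of_box_sums:
  fixes \<beta> :: "int \<Rightarrow> real"
  assumes fin: "finite {z. \<beta> z \<noteq> 0}"
    and box: "\<And>n::nat. (\<Sum>x<n. \<Sum>y<n. \<beta> (int y - int x)) \<ge> 0"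
  shows "(\<Sum>\<^sub>\<infinity>z. \<beta> z) \<ge> 0"
proof (rule ccontr)
  define F where "F = {z. \<beta> z \<noteq> 0}"
  define S where "S = sum \<beta> F"
  define B where "B = (\<Sum>z\<in>F. \<bar>\<beta> z\<bar>)"
  have finF: "finite F" using fin by (simp add: F_def)
  have S: "(\<Sum>\<^sub>\<infinity>z. \<beta> z) = S"
    unfolding S_def infsum_finite[OF finF, symmetric] by (rule infsum_cong_neutral) (auto simp: F_def)
  assume "\<not> (\<Sum>\<^sub>\<infinity>z. \<beta> z) \<ge> 0"
  then have Sneg: "S < 0" using S by simp
  obtain R :: nat where R: "\<And>z. z \<in> F \<Longrightarrow> \<bar>z\<bar> \<le> int R"
  proof
    fix z assume "z \<in> F"
    then have "\<bar>z\<bar> \<le> (\<Sum>z\<in>F. \<bar>z\<bar>)" using finF by (intro member_le_sum) auto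
    then show "\<bar>z\<bar> \<le> int (nat (\<Sum>z\<in>F. \<bar>z\<bar>))" by simp
  qed
  have row: "(\<Sum>y<n. \<beta> (int y - int x)) = sum \<beta> (F \<inter> {- int x..<int n - int x})" for n x
  proof -
    have "(\<Sum>y<n. \<beta> (int y - int x)) = (\<Sum>z\<in>{- int x..<int n - int x}. \<beta> z)"
      by (rule sum.reindex_bij_witness[of _ "\<lambda>z. nat (z + int x)" "\<lambda>y. int y - int x"]) auto
    also have "\<dots> = sum \<beta> (F \<inter> {- int x..<int n - int x})"
      by (rule sum.mono_neutral_right) (auto simp: F_def)
    finally show ?thesis .
  qed
  have B0: "B \<ge> 0" by (simp add: B_def sum_nonneg)
  have row_le: "(\<Sum>y<n. \<beta> (int y - int x)) \<le> B" for n x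
    unfolding row B_def using finF
    by (intro order.trans[OF sum_mono sum_mono2[of F "F \<inter> {- int x..<int n - int x}" "\<lambda>z. \<bar>\<beta> z\<bar>"]]) auto
  have row_eq: "(\<Sum>y<n. \<beta> (int y - int x)) = S" if "R \<le> x" "x + R < n" for n x
  proof -
    have "F \<inter> {- int x..<int n - int x} = F" using R that by force
    then show ?thesis by (simp add: row S_def)
  qed
  have "real (2 * R) * B + real m * S \<ge> 0" for m
  proof -
    let ?n = "2 * R + m"
    have "(\<Sum>x<?n. \<Sum>y<?n. \<beta> (int y - int x)) \<le> (\<Sum>x<?n. if R \<le> x \<and> x < R + m then S else B)"
      by (intro sum_mono) (auto simp: row_eq row_le)
    also have "\<dots> = (\<Sum>x\<in>{R..<R+m}. S) + (\<Sum>x\<in>{..<?n} - {R..<R+m}. B)"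
    proof -
      have "{..<?n} \<inter> {x. R \<le> x \<and> x < R + m} = {R..<R+m}"
        "{..<?n} \<inter> - {x. R \<le> x \<and> x < R + m} = {..<?n} - {R..<R+m}" by auto
      then show ?thesis by (simp add: sum.If_cases)
    qed
    also have "\<dots> = real m * S + real (2 * R) * B"
    proof -
      have "card ({..<?n} - {R..<R+m}) = 2 * R" by (subst card_Diff_subset) auto
      then show ?thesis by simp
    qed
    finally show ?thesis using box[of ?n] by linarith
  qed
  moreover obtain m :: nat where "real m * (- S) > real (2 * R) * B"
    using ex_less_of_nat_mult[of "- S" "real (2 * R) * B"] Sneg by auto
  ultimately show False by (smt (verit, ccfv_SIG) mult_minus_right)
qed

text \<open>\<open>T\<close> is an action of the integers by isometries that commutes with the dynamics. The form that
matters for transport pairs a vector with all translates of another one; it is again of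
dissipative type, with the same constants.\<close>
locale translation_system = dissipative V ip N A M \<kappa>
  for V :: "'v::real_vector set" and ip N A M \<kappa> +
  fixes T :: "int \<Rightarrow> 'v \<Rightarrow> 'v"
  assumes linear_T: "linear (T z)"
    and T_closed [simp, intro]: "x \<in> V \<Longrightarrow> T z x \<in> V"
    and T_add: "T u (T z x) = T (u + z) x"
    and T_zero: "T 0 x = x"
    and T_isometry: "\<lbrakk>x \<in> V; y \<in> V\<rbrakk> \<Longrightarrow> ip (T z x) (T z y) = ip x y"
    and T_local: "\<lbrakk>x \<in> V; y \<in> V\<rbrakk> \<Longrightarrow> finite {z. ip x (T z y) \<noteq> 0}"
    and N_T: "N (T z x) = T z (N x)" and A_T: "A (T z x) = T z (A x)"
begin

definition sip :: "'v \<Rightarrow> 'v \<Rightarrow> real" where "sip x y = (\<Sum>\<^sub>\<infinity>z. ip x (T z y))"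

lemma T_summable: "\<lbrakk>x \<in> V; y \<in> V\<rbrakk> \<Longrightarrow> (\<lambda>z. ip x (T z y)) summable_on UNIV"
  by (rule finite_nonzero_values_imp_summable_on) (use T_local in auto)

lemma T_moved: "\<lbrakk>x \<in> V; y \<in> V\<rbrakk> \<Longrightarrow> ip x (T (w - z) y) = ip (T z x) (T w y)"
  using T_isometry[of x "T (w - z) y" z] by (simp add: T_add)

definition box_sum :: "nat \<Rightarrow> 'v \<Rightarrow> 'v" where "box_sum n x = (\<Sum>k<n. T (int k) x)"

lemma box_sum_closed [simp, intro]: "x \<in> V \<Longrightarrow> box_sum n x \<in> V"
  by (auto simp: box_sum_def intro!: sum_closed)

lemma box_sum_ip:
  assumes "x \<in> V" "y \<in> V"
  shows "(\<Sum>k<n. \<Sum>l<n. ip x (T (int l - int k) y)) = ip (box_sum n x) (box_sum n y)"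
  using assms by (simp add: box_sum_def sum_left sum_right T_moved sum_closed) (rule sum.swap)

lemma N_box_sum: "N (box_sum n x) = box_sum n (N x)"
  by (simp add: box_sum_def linear_sum[OF linear_N] N_T)

lemma A_box_sum: "A (box_sum n x) = box_sum n (A x)"
  by (simp add: box_sum_def linear_sum[OF linear_A] A_T)

lemma fin_supp_add: "\<lbrakk>finite {z. f z \<noteq> 0}; finite {z. g z \<noteq> 0}\<rbrakk> \<Longrightarrow> finite {z. f z + g z \<noteq> (0::real)}"
  by (rule finite_subset[of _ "{z. f z \<noteq> 0} \<union> {z. g z \<noteq> 0}"]) auto

lemma fin_supp_mult: "finite {z. f z \<noteq> 0} \<Longrightarrow> finite {z. c * f z \<noteq> (0::real)}"
  by (rule finite_subset[of _ "{z. f z \<noteq> 0}"]) auto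

text \<open>An inequality between quadratic expressions that holds for all box sums passes to the
  summed form.\<close>
lemma sip_ineq:
  assumes V: "x1 \<in> V" "y1 \<in> V" "x2 \<in> V" "y2 \<in> V" "x3 \<in> V" "y3 \<in> V"
    and le: "\<And>n. c3 * ip (box_sum n x3) (box_sum n y3)
      \<le> c1 * ip (box_sum n x1) (box_sum n y1) + c2 * ip (box_sum n x2) (box_sum n y2)"
  shows "c3 * sip x3 y3 \<le> c1 * sip x1 y1 + c2 * sip x2 y2"
proof -
  let ?b = "\<lambda>z. c1 * ip x1 (T z y1) + c2 * ip x2 (T z y2) + (- c3) * ip x3 (T z y3)"
  have "(\<Sum>\<^sub>\<infinity>z. ?b z) \<ge> 0"
  proof (rule nonneg_of_box_sums)
    show "finite {z. ?b z \<noteq> 0}" by (intro fin_supp_add fin_supp_mult T_local V)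
    show "(\<Sum>x<n. \<Sum>y<n. ?b (int y - int x)) \<ge> 0" for n
    proof -
      have "(\<Sum>x<n. \<Sum>y<n. ?b (int y - int x)) = c1 * ip (box_sum n x1) (box_sum n y1)
          + c2 * ip (box_sum n x2) (box_sum n y2) + (- c3) * ip (box_sum n x3) (box_sum n y3)"
        unfolding sum.distrib sum_distrib_left[symmetric] using V by (simp only: box_sum_ip)
      then show ?thesis using le[of n] by simp
    qed
  qed
  moreover have "(\<Sum>\<^sub>\<infinity>z. ?b z) = c1 * sip x1 y1 + c2 * sip x2 y2 + (- c3) * sip x3 y3"
    unfolding sip_def using V
    by (simp only: infsum_add infsum_cmult_right' T_summable summable_on_add summable_on_cmult_right)
  ultimately show ?thesis by simp
qed

sublocale star: dissipative V sip N A M \<kappa>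
proof (intro dissipative.intro semi_inner.intro dissipative_axioms.intro)
  show "subspace V" by (rule subspace_V)
  show "sip (x + y) w = sip x w + sip y w" if "x \<in> V" "y \<in> V" "w \<in> V" for x y w
    unfolding sip_def using that by (simp add: add_left infsum_add T_summable)
  show "sip (r *\<^sub>R x) w = r * sip x w" if "x \<in> V" "w \<in> V" for x w r
    unfolding sip_def using that by (simp add: scale_left infsum_cmult_right')
  show "sip x y = sip y x" if "x \<in> V" "y \<in> V" for x y
  proof -
    have "sip x y = (\<Sum>\<^sub>\<infinity>z. ip y (T (- z) x))"
      unfolding sip_def
    proof (rule infsum_cong)
      fix z show "ip x (T z y) = ip y (T (- z) x)"
        using that T_moved[of y x 0 z] sym[of x "T z y"] by (simp add: T_zero)
    qed
    also have "\<dots> = sip y x"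
      unfolding sip_def by (rule infsum_reindex_bij_witness[of _ uminus uminus]) auto
    finally show ?thesis .
  qed
  show "sip x x \<ge> 0" if "x \<in> V" for x
    using sip_ineq[of x x x x x x 0 1 0] that by (simp add: nonneg)
  show "sip (N x) y = sip x (N y)" if "x \<in> V" "y \<in> V" for x y
    unfolding sip_def using that by (simp add: N_sym N_T)
  show "sip (A x) y = - sip x (A y)" if "x \<in> V" "y \<in> V" for x y
    unfolding sip_def using that by (simp add: A_anti A_T infsum_uminus)
  show "sip (N x) x \<ge> 0" if "x \<in> V" for x
    using sip_ineq[of "N x" x x x x x 0 1 0] that by (simp add: N_nonneg N_box_sum[symmetric])
  show "sip (N x) x \<le> M * sip x x" if "x \<in> V" for x
    using sip_ineq[of x x x x "N x" x 1 M 0] that by (simp add: N_bound N_box_sum[symmetric])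
  show "2 * sip (A x) y \<le> \<kappa> * (sip (N x) x + sip (N y) y)" if "x \<in> V" "y \<in> V" for x y
  proof -
    have "2 * sip (A x) y \<le> \<kappa> * sip (N x) x + \<kappa> * sip (N y) y"
    proof (rule sip_ineq)
      fix n
      show "2 * ip (box_sum n (A x)) (box_sum n y)
          \<le> \<kappa> * ip (box_sum n (N x)) (box_sum n x) + \<kappa> * ip (box_sum n (N y)) (box_sum n y)"
        using sector[of "box_sum n x" "box_sum n y"] that
        by (simp add: N_box_sum A_box_sum distrib_left)
    qed (use that in auto)
    then show ?thesis by (simp add: distrib_left)
  qed
qed (auto intro: linear_N linear_A M_nonneg \<kappa>_nonneg)

end

instantiation "fun" :: (type, real_vector) real_vector
begin

definition scaleR_fun :: "real \<Rightarrow> ('a \<Rightarrow> 'b) \<Rightarrow> 'a \<Rightarrow> 'b" where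
  "scaleR_fun r f = (\<lambda>x. r *\<^sub>R f x)"

instance
  by standard (auto simp: scaleR_fun_def fun_eq_iff scaleR_add_right scaleR_add_left)

end

lemma scaleR_fun_apply [simp]: "(r *\<^sub>R f) x = r *\<^sub>R f x"
  by (simp add: scaleR_fun_def)

section \<open>Finitely supported arrays in a fixed environment\<close>

type_synonym arr = "int \<times> int \<Rightarrow> real"

definition bounded_supp :: "int \<Rightarrow> arr \<Rightarrow> bool" where
  "bounded_supp R a \<longleftrightarrow> (\<forall>i j. a (i, j) \<noteq> 0 \<longrightarrow> \<bar>i\<bar> \<le> R \<and> \<bar>j\<bar> \<le> R)"

definition fin_arrays :: "arr set" where
  "fin_arrays = {a. \<exists>R. bounded_supp R a}"

definition index_box :: "int \<Rightarrow> (int \<times> int) set" where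
  "index_box R = {- R..R} \<times> {- R..R}"

definition arr_ip :: "arr \<Rightarrow> arr \<Rightarrow> real" where
  "arr_ip a b = (\<Sum>\<^sub>\<infinity>p. a p * b p)"

definition sw :: "int \<Rightarrow> int \<Rightarrow> int" where
  "sw x i = (if i = x then x + 1 else if i = x + 1 then x else i)"

definition swp :: "int \<Rightarrow> int \<times> int \<Rightarrow> int \<times> int" where
  "swp x p = (sw x (fst p), sw x (snd p))"

definition bonds :: "int \<times> int \<Rightarrow> int set" where
  "bonds p = {fst p - 1, fst p, snd p - 1, snd p}"

text \<open>The coefficients of \<open>- S\<close> on quadratic forms. A monomial \<open>\<omega> i * \<omega> j\<close> with \<open>i \<noteq> j\<close> changes sign under
the flips at \<open>i\<close> and at \<open>j\<close>, whence the factor \<open>4 = 2 * 2\<close>; an exchange acts on both indices, and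
only the bonds in \<open>bonds p\<close> move the pair \<open>p\<close>.\<close>
definition arr_N :: "real \<Rightarrow> real \<Rightarrow> arr \<Rightarrow> arr" where
  "arr_N lam \<gamma> a p = 4 * \<gamma> * (if fst p = snd p then 0 else a p)
     + lam * (\<Sum>x\<in>bonds p. a p - a (swp x p))"

text \<open>The derivation of quadratic forms with \<open>\<omega> i \<mapsto> c i * \<omega> (i + 1) - c (i - 1) * \<omega> (i - 1)\<close>, in terms of
coefficients.\<close>
definition arr_A :: "(int \<Rightarrow> real) \<Rightarrow> arr \<Rightarrow> arr" where
  "arr_A c a p = (case p of (i, j) \<Rightarrow>
     c (i - 1) * a (i - 1, j) - c i * a (i + 1, j) + c (j - 1) * a (i, j - 1) - c j * a (i, j + 1))"

lemma index_box_iff [simp]: "p \<in> index_box R \<longleftrightarrow> \<bar>fst p\<bar> \<le> R \<and> \<bar>snd p\<bar> \<le> R"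
  by (cases p) (auto simp: index_box_def)

lemma finite_box [simp]: "finite (index_box R)"
  by (simp add: index_box_def)

lemma bounded_supp_iff: "bounded_supp R a \<longleftrightarrow> (\<forall>p. p \<notin> index_box R \<longrightarrow> a p = 0)"
  by (auto simp: bounded_supp_def)

lemma bounded_suppD: "\<lbrakk>bounded_supp R a; p \<notin> index_box R\<rbrakk> \<Longrightarrow> a p = 0"
  by (metis bounded_supp_iff)

lemma bounded_supp_mono: "\<lbrakk>bounded_supp R a; R \<le> R'\<rbrakk> \<Longrightarrow> bounded_supp R' a"
  by (force simp: bounded_supp_def)

lemma common_supp:
  assumes "a \<in> fin_arrays" "b \<in> fin_arrays"
  obtains R where "bounded_supp R a" "bounded_supp R b"
  using assms bounded_supp_mono unfolding fin_arrays_def mem_Collect_eq by (metis linear)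

lemma arr_ip_sum: "bounded_supp R b \<Longrightarrow> arr_ip a b = (\<Sum>p\<in>index_box R. a p * b p)"
  unfolding arr_ip_def infsum_finite[OF finite_box, symmetric]
  by (rule infsum_cong_neutral) (auto simp: bounded_supp_iff)

lemma arr_ip_sym: "arr_ip a b = arr_ip b a"
  by (simp add: arr_ip_def mult.commute)

interpretation fin_arrays: semi_inner fin_arrays arr_ip
proof
  show "subspace fin_arrays"
    unfolding subspace_def
  proof (intro conjI ballI allI)
    show "0 \<in> fin_arrays" by (auto simp: fin_arrays_def bounded_supp_def)
    show "a + b \<in> fin_arrays" if ab: "a \<in> fin_arrays" "b \<in> fin_arrays" for a b
    proof -
      obtain R where "bounded_supp R a" "bounded_supp R b" using common_supp[OF ab] by blast
      then have "bounded_supp R (a + b)" by (simp add: bounded_supp_iff)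
      then show ?thesis by (auto simp: fin_arrays_def)
    qed
    show "r *\<^sub>R a \<in> fin_arrays" if "a \<in> fin_arrays" for a and r :: real
      using that by (fastforce simp: fin_arrays_def bounded_supp_iff)
  qed
  fix a b w :: arr and r :: real
  show "arr_ip a b = arr_ip b a" by (rule arr_ip_sym)
  assume w: "w \<in> fin_arrays"
  then obtain R where R: "bounded_supp R w" by (auto simp: fin_arrays_def)
  show "arr_ip (a + b) w = arr_ip a w + arr_ip b w" "arr_ip (r *\<^sub>R a) w = r * arr_ip a w"
    by (simp_all add: arr_ip_sum[OF R] distrib_right sum.distrib sum_distrib_left mult.assoc)
  show "0 \<le> arr_ip w w" by (simp add: arr_ip_sum[OF R] sum_nonneg)
qed

lemma sw_near: "\<bar>sw x i - i\<bar> \<le> 1" by (simp add: sw_def)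

lemma sw_sw [simp]: "sw x (sw x i) = i" by (simp add: sw_def)

lemma swp_swp [simp]: "swp x (swp x p) = p" by (simp add: swp_def)

lemma swp_id: "x \<notin> bonds p \<Longrightarrow> swp x p = p"
  by (cases p) (auto simp: swp_def sw_def bonds_def)

lemma bonds_swp: "x \<in> bonds (swp x p) \<longleftrightarrow> x \<in> bonds p"
  by (cases p) (auto simp: swp_def sw_def bonds_def)

lemma linear_arr_N: "linear (arr_N lam \<gamma>)"
  by (rule linearI)
     (auto simp: arr_N_def fun_eq_iff sum.distrib sum_subtractf sum_distrib_left algebra_simps)

lemma linear_arr_A: "linear (arr_A c)"
  by (rule linearI) (auto simp: arr_A_def fun_eq_iff algebra_simps)

lemma arr_N_supp:
  assumes "bounded_supp R a" shows "bounded_supp (R + 1) (arr_N lam \<gamma> a)"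
  unfolding bounded_supp_iff
proof (intro allI impI)
  fix p assume p: "p \<notin> index_box (R + 1)"
  have "a (swp x p) = 0" for x
    by (rule bounded_suppD[OF assms])
       (use p sw_near[of x "fst p"] sw_near[of x "snd p"] in \<open>auto simp: swp_def\<close>)
  moreover have "a p = 0" by (rule bounded_suppD[OF assms]) (use p in auto)
  ultimately show "arr_N lam \<gamma> a p = 0" by (simp add: arr_N_def)
qed

lemma arr_A_supp:
  assumes "bounded_supp R a" shows "bounded_supp (R + 1) (arr_A c a)"
  unfolding bounded_supp_iff
proof (intro allI impI)
  fix p assume p: "p \<notin> index_box (R + 1)"
  have "a (fst p - 1, snd p) = 0" "a (fst p + 1, snd p) = 0" "a (fst p, snd p - 1) = 0" "a (fst p, snd p + 1) = 0"
    by (rule bounded_suppD[OF assms]; use p in auto)+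
  then show "arr_A c a p = 0" by (cases p) (simp add: arr_A_def)
qed

lemma sum_swp_box:
  assumes "x \<in> {- R - 1..R}"
  shows "(\<Sum>p\<in>index_box (R + 1). h (swp x p)) = (\<Sum>p\<in>index_box (R + 1). (h p :: real))"
proof (rule sum.reindex_bij_witness[of _ "swp x" "swp x"])
  show "swp x p \<in> index_box (R + 1)" if "p \<in> index_box (R + 1)" for p
    using that assms by (auto simp: swp_def sw_def)
  then show "swp x p \<in> index_box (R + 1)" if "p \<in> index_box (R + 1)" for p using that .
qed auto

definition offd :: "arr \<Rightarrow> arr" where "offd a p = (if fst p = snd p then 0 else a p)"

definition grad_sq :: "int \<Rightarrow> arr \<Rightarrow> real" where
  "grad_sq R a = (\<Sum>i\<in>{- R - 1..R}. (a (i, i) - a (i + 1, i + 1))\<^sup>2)"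

definition bond_form :: "int \<Rightarrow> arr \<Rightarrow> arr \<Rightarrow> real" where
  "bond_form R a b =
     (\<Sum>x\<in>{- R - 1..R}. \<Sum>p\<in>index_box (R + 1). (a p - a (swp x p)) * (b p - b (swp x p)))"

lemma bond_form_sym: "bond_form R a b = bond_form R b a"
  by (simp add: bond_form_def mult.commute)

lemma offd_supp: "bounded_supp R a \<Longrightarrow> bounded_supp R (offd a)"
  by (auto simp: bounded_supp_iff offd_def)

lemma offd_in [simp, intro]: "a \<in> fin_arrays \<Longrightarrow> offd a \<in> fin_arrays"
  using offd_supp by (auto simp: fin_arrays_def)

text \<open>Each bond exchange is an involution, so its contribution to the form is a sum of
  products of discrete gradients.\<close>
lemma arr_N_form:
  assumes a: "bounded_supp R a" and b: "bounded_supp R b"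
  shows "arr_ip (arr_N lam \<gamma> a) b = 4 * \<gamma> * arr_ip (offd a) (offd b) + lam / 2 * bond_form R a b"
proof -
  let ?B = "index_box (R + 1)" and ?I = "{- R - 1..R}"
  have b1: "bounded_supp (R + 1) b" using bounded_supp_mono[OF b] by simp
  have summand: "arr_N lam \<gamma> a p * b p
      = 4 * \<gamma> * (offd a p * offd b p) + lam * (\<Sum>x\<in>?I. (a p - a (swp x p)) * b p)" for p
  proof -
    have "(\<Sum>x\<in>bonds p. a p - a (swp x p)) * b p = (\<Sum>x\<in>?I. a p - a (swp x p)) * b p"
    proof (cases "b p = 0")
      case False
      then have "p \<in> index_box R" using bounded_suppD[OF b] by blast
      then have "bonds p \<subseteq> ?I" by (auto simp: bonds_def)
      then have "(\<Sum>x\<in>bonds p. a p - a (swp x p)) = (\<Sum>x\<in>?I. a p - a (swp x p))"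
        by (intro sum.mono_neutral_left) (auto simp: swp_id)
      then show ?thesis by simp
    qed simp
    then show ?thesis
      by (simp add: arr_N_def offd_def distrib_right mult.assoc sum_distrib_right)
  qed
  have half: "(\<Sum>p\<in>?B. (a p - a (swp x p)) * b p)
      = (\<Sum>p\<in>?B. (a p - a (swp x p)) * (b p - b (swp x p))) / 2" if "x \<in> ?I" for x
  proof -
    have "(\<Sum>p\<in>?B. (a p - a (swp x p)) * b (swp x p)) = (\<Sum>p\<in>?B. (a (swp x p) - a p) * b p)"
      using sum_swp_box[OF that, of "\<lambda>p. (a (swp x p) - a p) * b p"] by simp
    also have "\<dots> = - (\<Sum>p\<in>?B. (a p - a (swp x p)) * b p)"
      by (simp add: sum_negf[symmetric] algebra_simps)
    finally show ?thesis by (simp add: right_diff_distrib sum_subtractf)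
  qed
  have "arr_ip (arr_N lam \<gamma> a) b
      = 4 * \<gamma> * (\<Sum>p\<in>?B. offd a p * offd b p) + lam * (\<Sum>p\<in>?B. \<Sum>x\<in>?I. (a p - a (swp x p)) * b p)"
    unfolding arr_ip_sum[OF b1] summand by (simp add: sum.distrib sum_distrib_left)
  also have "(\<Sum>p\<in>?B. \<Sum>x\<in>?I. (a p - a (swp x p)) * b p) = (\<Sum>x\<in>?I. \<Sum>p\<in>?B. (a p - a (swp x p)) * b p)"
    by (rule sum.swap)
  also have "\<dots> = bond_form R a b / 2"
    unfolding bond_form_def by (subst sum_divide_distrib) (rule sum.cong[OF refl half])
  also have "(\<Sum>p\<in>?B. offd a p * offd b p) = arr_ip (offd a) (offd b)"
    using arr_ip_sum[OF offd_supp[OF b1]] by simp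
  finally show ?thesis by simp
qed

text \<open>On each bond only the two diagonal entries at its end points are kept; both give the same square.\<close>
lemma bond_form_ge: "bond_form R a a \<ge> 2 * grad_sq R a"
  unfolding bond_form_def grad_sq_def sum_distrib_left
proof (rule sum_mono)
  fix x assume x: "x \<in> {- R - 1..R}"
  have "2 * (a (x, x) - a (x + 1, x + 1))\<^sup>2
      = (\<Sum>p\<in>{(x, x), (x + 1, x + 1)}. (a p - a (swp x p)) * (a p - a (swp x p)))"
    by (simp add: swp_def sw_def power2_eq_square algebra_simps)
  also have "\<dots> \<le> (\<Sum>p\<in>index_box (R + 1). (a p - a (swp x p)) * (a p - a (swp x p)))"
    using x by (intro sum_mono2) auto
  finally show "2 * (a (x, x) - a (x + 1, x + 1))\<^sup>2 \<le> \<dots>" .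
qed

text \<open>A pair of indices is moved by at most four bonds.\<close>
lemma bond_form_le:
  assumes "bounded_supp R a" shows "bond_form R a a \<le> 16 * arr_ip a a"
proof -
  let ?B = "index_box (R + 1)" and ?I = "{- R - 1..R}"
  define h where "h x p = (if x \<in> bonds p then (a p)\<^sup>2 else 0)" for x p
  have "(a p - a (swp x p)) * (a p - a (swp x p)) \<le> 2 * h x p + 2 * h x (swp x p)" for x p
  proof (cases "x \<in> bonds p")
    case True
    have "0 \<le> (a p + a (swp x p))\<^sup>2" by simp
    then show ?thesis using True by (simp add: h_def bonds_swp power2_eq_square algebra_simps)
  qed (simp add: swp_id h_def)
  then have "bond_form R a a \<le> (\<Sum>x\<in>?I. \<Sum>p\<in>?B. 2 * h x p + 2 * h x (swp x p))"
    unfolding bond_form_def by (intro sum_mono)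
  also have "\<dots> = (\<Sum>x\<in>?I. 4 * (\<Sum>p\<in>?B. h x p))"
    using sum_swp_box[where h = "h _"] by (intro sum.cong) (simp_all add: sum.distrib sum_distrib_left[symmetric])
  also have "\<dots> = 4 * (\<Sum>p\<in>?B. \<Sum>x\<in>?I. h x p)"
    by (simp only: sum_distrib_left[symmetric] sum.swap[of _ ?B])
  also have "\<dots> \<le> 4 * (\<Sum>p\<in>?B. 4 * (a p)\<^sup>2)"
  proof (intro mult_left_mono sum_mono)
    fix p
    have "(\<Sum>x\<in>?I. h x p) = (\<Sum>x\<in>?I \<inter> bonds p. (a p)\<^sup>2)"
      by (subst sum.inter_restrict) (auto simp: h_def)
    also have "\<dots> \<le> (\<Sum>x\<in>bonds p. (a p)\<^sup>2)"
      by (intro sum_mono2) (auto simp: bonds_def)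
    also have "\<dots> = real (card (bonds p)) * (a p)\<^sup>2" by simp
    also have "\<dots> \<le> 4 * (a p)\<^sup>2"
      by (intro mult_right_mono) (auto simp: bonds_def card_insert_if)
    finally show "(\<Sum>x\<in>?I. h x p) \<le> 4 * (a p)\<^sup>2" .
  qed simp
  also have "\<dots> = 16 * arr_ip a a"
    using arr_ip_sum[OF bounded_supp_mono[OF assms, of "R + 1"]]
    by (simp add: sum_distrib_left[symmetric] power2_eq_square)
  finally show ?thesis .
qed

subsection \<open>The antisymmetric part\<close>

definition shift1 :: "(int \<Rightarrow> real) \<Rightarrow> arr \<Rightarrow> arr \<Rightarrow> real" where
  "shift1 c a b = (\<Sum>\<^sub>\<infinity>p. c (fst p) * a p * b (fst p + 1, snd p))"

definition shift2 :: "(int \<Rightarrow> real) \<Rightarrow> arr \<Rightarrow> arr \<Rightarrow> real" where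
  "shift2 c a b = (\<Sum>\<^sub>\<infinity>p. c (snd p) * a p * b (fst p, snd p + 1))"

lemma summable_on_supp: "bounded_supp R b \<Longrightarrow> (\<And>p. b p = 0 \<Longrightarrow> h p = 0) \<Longrightarrow> (h :: arr) summable_on UNIV"
  by (rule finite_nonzero_values_imp_summable_on, rule finite_subset[OF _ finite_box[of R]])
     (use bounded_suppD in blast)

lemma arr_A_form:
  assumes "b \<in> fin_arrays"
  shows "arr_ip (arr_A c a) b = shift1 c a b - shift1 c b a + shift2 c a b - shift2 c b a"
proof -
  obtain R where R: "bounded_supp R b" using assms by (auto simp: fin_arrays_def)
  let ?t1 = "\<lambda>p. c (fst p - 1) * a (fst p - 1, snd p) * b p"
  let ?t2 = "\<lambda>p. c (fst p) * b p * a (fst p + 1, snd p)"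
  let ?t3 = "\<lambda>p. c (snd p - 1) * a (fst p, snd p - 1) * b p"
  let ?t4 = "\<lambda>p. c (snd p) * b p * a (fst p, snd p + 1)"
  have s: "?t1 summable_on UNIV" "?t2 summable_on UNIV" "?t3 summable_on UNIV" "?t4 summable_on UNIV"
    by (rule summable_on_supp[OF R]; simp)+
  have 1: "infsum ?t1 UNIV = shift1 c a b"
    unfolding shift1_def
    by (rule infsum_reindex_bij_witness[of _ "\<lambda>p. (fst p + 1, snd p)" "\<lambda>p. (fst p - 1, snd p)"]) auto
  have 3: "infsum ?t3 UNIV = shift2 c a b"
    unfolding shift2_def
    by (rule infsum_reindex_bij_witness[of _ "\<lambda>p. (fst p, snd p + 1)" "\<lambda>p. (fst p, snd p - 1)"]) auto
  have "arr_ip (arr_A c a) b = (\<Sum>\<^sub>\<infinity>p. ?t1 p + ?t3 p + (- 1) * (?t2 p + ?t4 p))"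
    unfolding arr_ip_def by (intro infsum_cong) (auto simp: arr_A_def algebra_simps)
  also have "\<dots> = infsum ?t1 UNIV + infsum ?t3 UNIV + (- 1) * (infsum ?t2 UNIV + infsum ?t4 UNIV)"
    using s by (simp only: infsum_add infsum_cmult_right' summable_on_add summable_on_cmult_right)
  finally show ?thesis using 1 3 by (simp add: shift1_def shift2_def)
qed

lemma arr_A_anti:
  assumes "a \<in> fin_arrays" "b \<in> fin_arrays"
  shows "arr_ip (arr_A c a) b = - arr_ip a (arr_A c b)"
  using arr_A_form[OF assms(2), of c a] arr_A_form[OF assms(1), of c b] by (simp add: arr_ip_sym)

lemma arr_ip_shift:
  "arr_ip (\<lambda>p. a (fst p + 1, snd p)) (\<lambda>p. b (fst p + 1, snd p)) = arr_ip a b"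
  "arr_ip (\<lambda>p. a (fst p, snd p + 1)) (\<lambda>p. b (fst p, snd p + 1)) = arr_ip a b"
  unfolding arr_ip_def
  by (rule infsum_reindex_bij_witness[of _ "\<lambda>p. (fst p - 1, snd p)" "\<lambda>p. (fst p + 1, snd p)"]; simp)
     (rule infsum_reindex_bij_witness[of _ "\<lambda>p. (fst p, snd p - 1)" "\<lambda>p. (fst p, snd p + 1)"]; simp)

lemma shift_in:
  assumes "a \<in> fin_arrays"
  shows "(\<lambda>p. a (fst p + 1, snd p)) \<in> fin_arrays" "(\<lambda>p. a (fst p, snd p + 1)) \<in> fin_arrays"
    "(\<lambda>p. c p * a p) \<in> fin_arrays"
proof -
  obtain R where R: "bounded_supp R a" using assms by (auto simp: fin_arrays_def)
  have "bounded_supp (R + 1) (\<lambda>p. a (fst p + 1, snd p))"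
    "bounded_supp (R + 1) (\<lambda>p. a (fst p, snd p + 1))"
    unfolding bounded_supp_iff by (intro allI impI bounded_suppD[OF R]; auto)+
  moreover have "bounded_supp R (\<lambda>p. c p * a p)"
    unfolding bounded_supp_iff using bounded_suppD[OF R] by auto
  ultimately
  show "(\<lambda>p. a (fst p + 1, snd p)) \<in> fin_arrays" "(\<lambda>p. a (fst p, snd p + 1)) \<in> fin_arrays"
    "(\<lambda>p. c p * a p) \<in> fin_arrays" by (auto simp: fin_arrays_def)
qed

lemma arr_ip_weight_le:
  assumes "a \<in> fin_arrays" "b \<in> fin_arrays" and c: "\<And>p. \<bar>c p\<bar> \<le> K"
  shows "2 * arr_ip (\<lambda>p. c p * a p) b \<le> K * (arr_ip a a + arr_ip b b)"
proof -
  obtain R where R: "bounded_supp R a" "bounded_supp R b" by (rule common_supp[OF assms(1,2)])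
  have "2 * (c p * a p * b p) \<le> K * (a p * a p + b p * b p)" for p
  proof -
    have "2 * \<bar>a p * b p\<bar> \<le> a p * a p + b p * b p"
      using zero_le_power2[of "a p - b p"] zero_le_power2[of "a p + b p"]
      by (simp add: power2_eq_square algebra_simps abs_le_iff)
    then have "\<bar>c p\<bar> * (2 * \<bar>a p * b p\<bar>) \<le> K * (a p * a p + b p * b p)"
      using c[of p] by (intro mult_mono) auto
    moreover have "c p * a p * b p \<le> \<bar>c p\<bar> * \<bar>a p * b p\<bar>"
      by (metis abs_ge_self abs_mult mult.assoc)
    ultimately show ?thesis by linarith
  qed
  then show ?thesis
    by (simp add: arr_ip_sum[OF R(1)] arr_ip_sum[OF R(2)] sum.distrib[symmetric] sum_distrib_left sum_mono)
qed

lemma shift_le: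
  assumes "a \<in> fin_arrays" "b \<in> fin_arrays" and "\<And>i. \<bar>c i\<bar> \<le> K"
  shows "2 * shift1 c a b \<le> K * (arr_ip a a + arr_ip b b)"
    and "2 * shift2 c a b \<le> K * (arr_ip a a + arr_ip b b)"
  using arr_ip_weight_le[OF assms(1) shift_in(1)[OF assms(2)], of "\<lambda>p. c (fst p)" K]
    arr_ip_weight_le[OF assms(1) shift_in(2)[OF assms(2)], of "\<lambda>p. c (snd p)" K] assms(3)
  unfolding arr_ip_shift by (simp_all add: shift1_def shift2_def arr_ip_def)

lemma shift_neg: "shift1 (\<lambda>i. - c i) a b = - shift1 c a b" "shift2 (\<lambda>i. - c i) a b = - shift2 c a b"
  by (simp_all add: shift1_def shift2_def infsum_uminus)

lemma arr_A_le:
  assumes "a \<in> fin_arrays" "b \<in> fin_arrays" and c: "\<And>i. \<bar>c i\<bar> \<le> K"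
  shows "2 * arr_ip (arr_A c a) b \<le> 4 * K * (arr_ip a a + arr_ip b b)"
  using shift_le[OF assms(1,2), of c K] shift_le[OF assms(2,1), of "\<lambda>i. - c i" K] c
  by (simp add: arr_A_form[OF assms(2)] shift_neg algebra_simps)

text \<open>Between the diagonal and the rest, \<open>arr_A\<close> only sees gradients along the diagonal;
  this is conservation of energy.\<close>
lemma arr_A_diag_le:
  assumes a: "bounded_supp R a" and b: "bounded_supp R b" and c: "\<And>i. \<bar>c i\<bar> \<le> K"
  shows "2 * arr_ip (arr_A c (a - offd a)) (offd b) \<le> K * (2 * grad_sq R a + arr_ip (offd b) (offd b))"
proof -
  let ?B = "index_box (R + 1)" and ?I = "{- R - 1..R}"
  let ?up = "\<lambda>i. (i, i + 1)" and ?lo = "\<lambda>i. (i + 1, i)"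
  let ?g = "\<lambda>i. a (i, i) - a (i + 1, i + 1)"
  have b1: "bounded_supp (R + 1) (offd b)" using bounded_supp_mono[OF offd_supp[OF b]] by simp
  have up: "arr_A c (a - offd a) (?up i) = c i * ?g i" for i
    by (simp add: arr_A_def offd_def algebra_simps)
  have lo: "arr_A c (a - offd a) (?lo i) = c i * ?g i" for i
    by (simp add: arr_A_def offd_def algebra_simps)
  have zero: "arr_A c (a - offd a) p * offd b p = 0" if "p \<in> ?B - (?up ` ?I \<union> ?lo ` ?I)" for p
  proof (cases "fst p = snd p")
    case False
    have "snd p \<noteq> fst p + 1"
    proof
      assume "snd p = fst p + 1"
      then have "p = ?up (fst p)" "fst p \<in> ?I" using that by (auto simp: prod_eq_iff)
      then show False using that by blast
    qed
    moreover have "fst p \<noteq> snd p + 1"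
    proof
      assume "fst p = snd p + 1"
      then have "p = ?lo (snd p)" "snd p \<in> ?I" using that by (auto simp: prod_eq_iff)
      then show False using that by blast
    qed
    ultimately show ?thesis using False
      by (cases p) (auto simp: arr_A_def offd_def)
  qed (simp add: offd_def)
  have split: "(\<Sum>p\<in>?up ` ?I \<union> ?lo ` ?I. h p) = (\<Sum>i\<in>?I. h (?up i) + h (?lo i))" for h :: arr
    by (subst sum.union_disjoint) (auto simp: sum.reindex inj_on_def sum.distrib)
  have sub: "?up ` ?I \<union> ?lo ` ?I \<subseteq> ?B" by auto
  have "arr_ip (arr_A c (a - offd a)) (offd b)
      = (\<Sum>p\<in>?up ` ?I \<union> ?lo ` ?I. arr_A c (a - offd a) p * offd b p)"
    unfolding arr_ip_sum[OF b1] by (rule sum.mono_neutral_right) (use zero sub in auto)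
  also have "\<dots> = (\<Sum>i\<in>?I. c i * ?g i * offd b (?up i) + c i * ?g i * offd b (?lo i))"
    by (simp only: split up lo)
  finally have "2 * arr_ip (arr_A c (a - offd a)) (offd b)
      = (\<Sum>i\<in>?I. 2 * (c i * ?g i * offd b (?up i) + c i * ?g i * offd b (?lo i)))"
    by (simp add: sum_distrib_left)
  also have "\<dots> \<le> (\<Sum>i\<in>?I. K * (2 * (?g i)\<^sup>2 + ((offd b (?up i))\<^sup>2 + (offd b (?lo i))\<^sup>2)))"
  proof (rule sum_mono)
    fix i
    have "2 * (c i * x * y) \<le> K * (x\<^sup>2 + y\<^sup>2)" for x y
    proof -
      have "2 * \<bar>x * y\<bar> \<le> x\<^sup>2 + y\<^sup>2"
        using zero_le_power2[of "x - y"] zero_le_power2[of "x + y"]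
        by (simp add: power2_eq_square algebra_simps abs_le_iff)
      then have "\<bar>c i\<bar> * (2 * \<bar>x * y\<bar>) \<le> K * (x\<^sup>2 + y\<^sup>2)"
        using c[of i] by (intro mult_mono) auto
      moreover have "c i * x * y \<le> \<bar>c i\<bar> * \<bar>x * y\<bar>"
        by (metis abs_ge_self abs_mult mult.assoc)
      ultimately show ?thesis by linarith
    qed
    from this[of "?g i" "offd b (?up i)"] this[of "?g i" "offd b (?lo i)"]
    show "2 * (c i * ?g i * offd b (?up i) + c i * ?g i * offd b (?lo i))
        \<le> K * (2 * (?g i)\<^sup>2 + ((offd b (?up i))\<^sup>2 + (offd b (?lo i))\<^sup>2))"
      by (simp add: algebra_simps)
  qed
  also have "\<dots> = K * (2 * grad_sq R a + (\<Sum>p\<in>?up ` ?I \<union> ?lo ` ?I. (offd b p)\<^sup>2))"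
    unfolding split grad_sq_def by (simp only: sum_distrib_left[symmetric] sum.distrib)
  also have "\<dots> \<le> K * (2 * grad_sq R a + (\<Sum>p\<in>?B. (offd b p)\<^sup>2))"
    using sub c[of 0] by (intro mult_left_mono add_left_mono sum_mono2) auto
  also have "(\<Sum>p\<in>?B. (offd b p)\<^sup>2) = arr_ip (offd b) (offd b)"
    by (simp add: arr_ip_sum[OF b1] power2_eq_square)
  finally show ?thesis .
qed

lemma arr_A_diag_diag: "arr_ip (arr_A c (a - offd a)) (b - offd b) = 0"
proof -
  have "arr_A c (a - offd a) p * (b - offd b) p = 0" for p
    by (cases p) (auto simp: arr_A_def offd_def)
  then show ?thesis unfolding arr_ip_def by (intro infsum_0)
qed

definition sector_const :: "real \<Rightarrow> real \<Rightarrow> real \<Rightarrow> real" where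
  "sector_const lam \<gamma> K = 5 * K / (4 * \<gamma>) + 2 * K / lam"

lemma arr_energy_ge:
  assumes "bounded_supp R a" "lam > 0"
  shows "arr_ip (arr_N lam \<gamma> a) a \<ge> 4 * \<gamma> * arr_ip (offd a) (offd a) + lam * grad_sq R a"
proof -
  have "lam / 2 * bond_form R a a \<ge> lam / 2 * (2 * grad_sq R a)"
    using assms(2) bond_form_ge by (intro mult_left_mono) auto
  then show ?thesis using arr_N_form[OF assms(1,1)] by simp
qed

text \<open>Split both arrays into the diagonal and the rest. Off the diagonal the flips make the energy
equivalent to the norm. The two mixed terms only involve gradients along the diagonal, which
the exchanges control. The diagonal does not interact with itself.\<close>
lemma arr_sector:
  assumes pos: "lam > 0" "\<gamma> > 0" and a: "a \<in> fin_arrays" and b: "b \<in> fin_arrays"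
    and c: "\<And>i. \<bar>c i\<bar> \<le> K"
  shows "2 * arr_ip (arr_A c a) b
    \<le> sector_const lam \<gamma> K * (arr_ip (arr_N lam \<gamma> a) a + arr_ip (arr_N lam \<gamma> b) b)"
proof -
  obtain R where R: "bounded_supp R a" "bounded_supp R b" by (rule common_supp[OF a b])
  let ?ao = "offd a" and ?bo = "offd b"
  have mem: "?ao \<in> fin_arrays" "?bo \<in> fin_arrays" "a - ?ao \<in> fin_arrays" "b - ?bo \<in> fin_arrays"
    using a b by auto
  have K: "K \<ge> 0" using c[of 0] by simp
  have c': "\<bar>- c i\<bar> \<le> K" for i using c by simp
  have Amem: "arr_A c x \<in> fin_arrays" if "x \<in> fin_arrays" for x
    using that arr_A_supp by (auto simp: fin_arrays_def)
  have "arr_ip (arr_A c a) b = arr_ip (arr_A c (?ao + (a - ?ao))) (?bo + (b - ?bo))" by simp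
  also have "\<dots> = arr_ip (arr_A c ?ao) ?bo + arr_ip (arr_A c (a - ?ao)) ?bo
      + arr_ip (arr_A c ?ao) (b - ?bo) + arr_ip (arr_A c (a - ?ao)) (b - ?bo)"
    using mem Amem unfolding linear_add[OF linear_arr_A]
    by (simp only: fin_arrays.add_left fin_arrays.add_right fin_arrays.V_closed)
  also have "arr_ip (arr_A c ?ao) (b - ?bo) = arr_ip (arr_A (\<lambda>i. - c i) (b - ?bo)) ?ao"
    using arr_A_anti[OF mem(1,4), of c] arr_A_form[OF mem(1), of c "b - ?bo"]
      arr_A_form[OF mem(1), of "\<lambda>i. - c i" "b - ?bo"] arr_ip_sym[of ?ao "arr_A c (b - ?bo)"]
    by (simp add: shift_neg)
  finally have "2 * arr_ip (arr_A c a) b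
      \<le> 4 * K * (arr_ip ?ao ?ao + arr_ip ?bo ?bo) + K * (2 * grad_sq R a + arr_ip ?bo ?bo)
        + K * (2 * grad_sq R b + arr_ip ?ao ?ao)"
    using arr_A_le[OF mem(1,2), of c K, OF c] arr_A_diag_le[OF R(1,2), of c K, OF c]
      arr_A_diag_le[OF R(2,1), of "\<lambda>i. - c i" K, OF c']
    unfolding arr_A_diag_diag by linarith
  also have "\<dots> = 5 * K * (arr_ip ?ao ?ao + arr_ip ?bo ?bo) + 2 * K * (grad_sq R a + grad_sq R b)"
    by (simp add: algebra_simps)
  also have "\<dots> \<le> sector_const lam \<gamma> K * (arr_ip (arr_N lam \<gamma> a) a + arr_ip (arr_N lam \<gamma> b) b)"
  proof -
    have one: "5 * K * arr_ip (offd x) (offd x) + 2 * K * grad_sq R x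
        \<le> sector_const lam \<gamma> K * arr_ip (arr_N lam \<gamma> x) x" if x: "bounded_supp R x" for x
    proof -
      let ?g = "grad_sq R x" and ?o = "arr_ip (offd x) (offd x)"
      have g0: "?g \<ge> 0" "?o \<ge> 0"
        using offd_supp[OF x] by (auto simp: grad_sq_def sum_nonneg arr_ip_sum)
      have "5 * K * ?o + 2 * K * ?g = 5 * K / (4 * \<gamma>) * (4 * \<gamma> * ?o) + 2 * K / lam * (lam * ?g)"
        using pos by simp
      also have "\<dots> \<le> sector_const lam \<gamma> K * (4 * \<gamma> * ?o) + sector_const lam \<gamma> K * (lam * ?g)"
        using pos K g0 by (intro add_mono mult_right_mono) (auto simp: sector_const_def)
      also have "\<dots> = sector_const lam \<gamma> K * (4 * \<gamma> * ?o + lam * ?g)" by (simp add: distrib_left)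
      also have "\<dots> \<le> sector_const lam \<gamma> K * arr_ip (arr_N lam \<gamma> x) x"
        using arr_energy_ge[OF x pos(1)] pos K by (intro mult_left_mono) (auto simp: sector_const_def)
      finally show ?thesis .
    qed
    from one[OF R(1)] one[OF R(2)] show ?thesis by (simp add: algebra_simps)
  qed
  finally show ?thesis .
qed

lemma arr_dissipative:
  assumes pos: "lam > 0" "\<gamma> > 0" and c: "\<And>i. \<bar>c i\<bar> \<le> K"
  shows "dissipative fin_arrays arr_ip (arr_N lam \<gamma>) (arr_A c) (4 * \<gamma> + 8 * lam) (sector_const lam \<gamma> K)"
proof (intro dissipative.intro dissipative_axioms.intro fin_arrays.semi_inner_axioms)
  fix a b assume a: "a \<in> fin_arrays"
  then obtain Ra where Ra: "bounded_supp Ra a" by (auto simp: fin_arrays_def)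
  show "arr_N lam \<gamma> a \<in> fin_arrays" "arr_A c a \<in> fin_arrays"
    using arr_N_supp[OF Ra] arr_A_supp[OF Ra] by (auto simp: fin_arrays_def)
  have o: "arr_ip (offd a) (offd a) \<ge> 0" using a by (intro fin_arrays.nonneg) auto
  have bf: "bond_form Ra a a \<ge> 0" by (auto simp: bond_form_def intro!: sum_nonneg)
  show "0 \<le> arr_ip (arr_N lam \<gamma> a) a"
    using pos o bf by (simp add: arr_N_form[OF Ra Ra])
  have "arr_ip (offd a) (offd a) \<le> arr_ip a a"
    unfolding arr_ip_sum[OF Ra] arr_ip_sum[OF offd_supp[OF Ra]]
    by (intro sum_mono) (auto simp: offd_def)
  then have "4 * \<gamma> * arr_ip (offd a) (offd a) \<le> 4 * \<gamma> * arr_ip a a"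
    using pos by (intro mult_left_mono) auto
  moreover have "lam / 2 * bond_form Ra a a \<le> lam / 2 * (16 * arr_ip a a)"
    using pos bond_form_le[OF Ra] by (intro mult_left_mono) auto
  ultimately show "arr_ip (arr_N lam \<gamma> a) a \<le> (4 * \<gamma> + 8 * lam) * arr_ip a a"
    by (simp add: arr_N_form[OF Ra Ra] distrib_right)
  assume b: "b \<in> fin_arrays"
  obtain R where R: "bounded_supp R a" "bounded_supp R b" by (rule common_supp[OF a b])
  show "arr_ip (arr_N lam \<gamma> a) b = arr_ip a (arr_N lam \<gamma> b)"
    unfolding arr_ip_sym[of a "arr_N lam \<gamma> b"] arr_N_form[OF R] arr_N_form[OF R(2,1)]
    by (simp add: bond_form_sym[of R b a] arr_ip_sym[of "offd b"])
  show "arr_ip (arr_A c a) b = - arr_ip a (arr_A c b)" by (rule arr_A_anti[OF a b])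
  show "2 * arr_ip (arr_A c a) b
    \<le> sector_const lam \<gamma> K * (arr_ip (arr_N lam \<gamma> a) a + arr_ip (arr_N lam \<gamma> b) b)"
    by (rule arr_sector[OF pos a b c])
next
  show "0 \<le> sector_const lam \<gamma> K" using pos c[of 0] by (simp add: sector_const_def)
qed (use pos in \<open>auto intro: linear_arr_N linear_arr_A\<close>)

text \<open>The flips give a spectral gap \<open>4 * \<gamma>\<close> off the diagonal.\<close>
lemma arr_off_dual:
  assumes pos: "lam > 0" "\<gamma> > 0" and w: "w \<in> fin_arrays" "offd w = w" and g: "g \<in> fin_arrays"
  shows "2 * arr_ip w g \<le> 1 / (4 * \<gamma>) * arr_ip w w + arr_ip (arr_N lam \<gamma> g) g"
proof -
  obtain R where R: "bounded_supp R w" "bounded_supp R g" by (rule common_supp[OF w(1) g])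
  have "2 * (w p * g p) \<le> 1 / (4 * \<gamma>) * (w p * w p) + 4 * \<gamma> * (offd g p * offd g p)" for p
  proof (cases "fst p = snd p")
    case True
    then have "w p = 0" using w(2) by (metis offd_def)
    then show ?thesis using True by (simp add: offd_def)
  next
    case False
    have "0 \<le> (w p - 4 * \<gamma> * g p)\<^sup>2 / (4 * \<gamma>)" using pos by simp
    also have "\<dots> = 1 / (4 * \<gamma>) * (w p * w p) + 4 * \<gamma> * (g p * g p) - 2 * (w p * g p)"
      using pos by (simp add: power2_eq_square field_simps)
    finally show ?thesis using False by (simp add: offd_def)
  qed
  then have "2 * arr_ip w g \<le> 1 / (4 * \<gamma>) * arr_ip w w + 4 * \<gamma> * arr_ip (offd g) (offd g)"
    unfolding arr_ip_sum[OF R(1)] arr_ip_sum[OF R(2)] arr_ip_sum[OF offd_supp[OF R(2)]]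
      sum_distrib_left sum.distrib[symmetric] by (intro sum_mono)
  also have "4 * \<gamma> * arr_ip (offd g) (offd g) \<le> arr_ip (arr_N lam \<gamma> g) g"
  proof -
    have "grad_sq R g \<ge> 0" by (simp add: grad_sq_def sum_nonneg)
    then have "lam * grad_sq R g \<ge> 0" using pos by simp
    then show ?thesis using arr_energy_ge[OF R(2) pos(1), of \<gamma>] by linarith
  qed
  finally show ?thesis by simp
qed

section \<open>Local continuous functions of the disorder\<close>

lemma Omega_D_eq_PiE: "Omega_D C = PiE UNIV (\<lambda>_. {1 / C..C})"
  by (auto simp: Omega_D_def PiE_def extensional_def Pi_def)

lemma compact_Omega_D: "compact (Omega_D C)"
proof -
  have "compactin (product_topology (\<lambda>i::int. euclidean :: real topology) UNIV) (PiE UNIV (\<lambda>_. {1 / C..C}))"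
    unfolding compactin_PiE by auto
  then show ?thesis by (simp add: euclidean_product_topology Omega_D_eq_PiE)
qed

lemma shift_conf_Omega_D [simp]: "m \<in> Omega_D C \<Longrightarrow> shift_conf z m \<in> Omega_D C"
  by (auto simp: Omega_D_def shift_conf_def)

lemma local_cont_const [simp, intro]: "local_cont C (\<lambda>m. r)"
  by (auto simp: local_cont_def)

lemma local_cont_coord [intro]: "local_cont C (\<lambda>m. m x)"
  unfolding local_cont_def
  by (intro conjI exI[of _ "{x}"] continuous_on_subset[OF continuous_on_product_coordinates]) auto

lemma local_cont_comp2:
  assumes "local_cont C \<psi>" "local_cont C \<phi>" and g: "continuous_on S (\<lambda>(x, y). g x y)"
    and S: "\<And>m. m \<in> Omega_D C \<Longrightarrow> (\<psi> m, \<phi> m) \<in> S"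
  shows "local_cont C (\<lambda>m. g (\<psi> m) (\<phi> m :: real) :: real)"
proof -
  obtain A where A: "finite A" "\<forall>m\<in>Omega_D C. \<forall>m'\<in>Omega_D C. (\<forall>x\<in>A. m x = m' x) \<longrightarrow> \<psi> m = \<psi> m'"
    using assms(1) unfolding local_cont_def by blast
  obtain B where B: "finite B" "\<forall>m\<in>Omega_D C. \<forall>m'\<in>Omega_D C. (\<forall>x\<in>B. m x = m' x) \<longrightarrow> \<phi> m = \<phi> m'"
    using assms(2) unfolding local_cont_def by blast
  have c: "continuous_on (Omega_D C) \<psi>" "continuous_on (Omega_D C) \<phi>"
    using assms(1,2) unfolding local_cont_def by blast+
  have "continuous_on (Omega_D C) (\<lambda>m. (\<lambda>(x, y). g x y) (\<psi> m, \<phi> m))"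
    by (rule continuous_on_compose2[OF g continuous_on_Pair[OF c]]) (use S in auto)
  moreover have "g (\<psi> m) (\<phi> m) = g (\<psi> m') (\<phi> m')"
    if "m \<in> Omega_D C" "m' \<in> Omega_D C" "\<forall>x\<in>A \<union> B. m x = m' x" for m m'
  proof -
    have "\<psi> m = \<psi> m'" using A(2) that by blast
    moreover have "\<phi> m = \<phi> m'" using B(2) that by blast
    ultimately show ?thesis by simp
  qed
  moreover have "finite (A \<union> B)" using A(1) B(1) by simp
  ultimately show ?thesis unfolding local_cont_def prod.case by blast
qed

lemma local_cont_add [intro]: "\<lbrakk>local_cont C \<psi>; local_cont C \<phi>\<rbrakk> \<Longrightarrow> local_cont C (\<lambda>m. \<psi> m + \<phi> m)"
  using local_cont_comp2[of C \<psi> \<phi> UNIV "\<lambda>x y. x + y"]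
    continuous_on_add[OF continuous_on_fst[OF continuous_on_id] continuous_on_snd[OF continuous_on_id], of UNIV]
  by (simp add: case_prod_unfold)

lemma local_cont_diff [intro]: "\<lbrakk>local_cont C \<psi>; local_cont C \<phi>\<rbrakk> \<Longrightarrow> local_cont C (\<lambda>m. \<psi> m - \<phi> m)"
  using local_cont_comp2[of C \<psi> \<phi> UNIV "\<lambda>x y. x - y"]
    continuous_on_diff[OF continuous_on_fst[OF continuous_on_id] continuous_on_snd[OF continuous_on_id], of UNIV]
  by (simp add: case_prod_unfold)

lemma local_cont_mult [intro]: "\<lbrakk>local_cont C \<psi>; local_cont C \<phi>\<rbrakk> \<Longrightarrow> local_cont C (\<lambda>m. \<psi> m * \<phi> m)"
  using local_cont_comp2[of C \<psi> \<phi> UNIV "\<lambda>x y. x * y"]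
    continuous_on_mult[OF continuous_on_fst[OF continuous_on_id] continuous_on_snd[OF continuous_on_id], of UNIV]
  by (simp add: case_prod_unfold)

lemma local_cont_sum [intro]:
  "(\<And>i. i \<in> I \<Longrightarrow> local_cont C (\<psi> i)) \<Longrightarrow> local_cont C (\<lambda>m. \<Sum>i\<in>I. \<psi> i m)"
  by (induction I rule: infinite_finite_induct) auto

lemma local_cont_cong: "\<lbrakk>local_cont C \<psi>; \<And>m. m \<in> Omega_D C \<Longrightarrow> \<psi> m = \<phi> m\<rbrakk> \<Longrightarrow> local_cont C \<phi>"
  unfolding local_cont_def by (metis (mono_tags, lifting) continuous_on_cong)

lemma local_cont_shift:
  assumes "local_cont C \<psi>" shows "local_cont C (\<lambda>m. \<psi> (shift_conf z m))"
proof -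
  obtain A where A: "finite A" "\<forall>m\<in>Omega_D C. \<forall>m'\<in>Omega_D C. (\<forall>x\<in>A. m x = m' x) \<longrightarrow> \<psi> m = \<psi> m'"
    using assms unfolding local_cont_def by blast
  have c: "continuous_on (Omega_D C) \<psi>" using assms unfolding local_cont_def by blast
  have "continuous_on (Omega_D C) (shift_conf z)"
    unfolding shift_conf_def
    by (intro continuous_on_coordinatewise_then_product continuous_on_subset[OF continuous_on_product_coordinates]) auto
  then have "continuous_on (Omega_D C) (\<lambda>m. \<psi> (shift_conf z m))"
    by (intro continuous_on_compose2[OF c]) auto
  moreover have "\<psi> (shift_conf z m) = \<psi> (shift_conf z m')"
    if "m \<in> Omega_D C" "m' \<in> Omega_D C" "\<forall>x\<in>(\<lambda>x. z + x) ` A. m x = m' x" for m m'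
  proof -
    have "\<forall>x\<in>A. shift_conf z m x = shift_conf z m' x" using that(3) by (simp add: shift_conf_def)
    then show ?thesis using A(2) shift_conf_Omega_D that(1,2) by blast
  qed
  moreover have "finite ((\<lambda>x. z + x) ` A)" using A(1) by simp
  ultimately show ?thesis unfolding local_cont_def by blast
qed

lemma local_cont_bounded:
  assumes "local_cont C \<psi>"
  obtains B where "\<And>m. m \<in> Omega_D C \<Longrightarrow> \<bar>\<psi> m\<bar> \<le> B"
proof -
  have "bounded (\<psi> ` Omega_D C)"
    using assms compact_Omega_D
    by (intro compact_imp_bounded compact_continuous_image) (auto simp: local_cont_def)
  then show ?thesis using that by (auto simp: bounded_iff)
qed

text \<open>The conductance of the bond between \<open>x\<close> and \<open>x + 1\<close>.\<close>
definition cond :: "conf \<Rightarrow> int \<Rightarrow> real" where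
  "cond m x = 1 / sqrt (m x * m (x + 1))"

lemma cond_shift: "cond (shift_conf z m) x = cond m (x + z)"
  by (simp add: cond_def shift_conf_def add_ac)

section \<open>Quadratic observables as arrays\<close>

type_synonym darr = "conf \<Rightarrow> arr"

definition op_N :: "real \<Rightarrow> real \<Rightarrow> darr \<Rightarrow> darr" where "op_N lam \<gamma> f m = arr_N lam \<gamma> (f m)"

definition op_A :: "darr \<Rightarrow> darr" where "op_A f m = arr_A (cond m) (f m)"

text \<open>The array of the translated observable: the disorder and both indices are shifted.\<close>
definition op_T :: "int \<Rightarrow> darr \<Rightarrow> darr" where
  "op_T z f m p = f (shift_conf z m) (fst p - z, snd p - z)"

definition arr_trace :: "arr \<Rightarrow> real" where "arr_trace a = (\<Sum>\<^sub>\<infinity>i. a (i, i))"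

text \<open>The vanishing trace says that the squares \<open>(\<omega> i)\<^sup>2\<close> enter through gradients only.\<close>
definition arrays :: "real \<Rightarrow> darr set" where
  "arrays C = {f. (\<forall>p. local_cont C (\<lambda>m. f m p)) \<and> (\<exists>R. \<forall>m\<in>Omega_D C. bounded_supp R (f m)) \<and>
     (\<forall>m\<in>Omega_D C. \<forall>i j. f m (i, j) = f m (j, i)) \<and> (\<forall>m\<in>Omega_D C. arr_trace (f m) = 0)}"

definition arr_ip_mean :: "real measure \<Rightarrow> darr \<Rightarrow> darr \<Rightarrow> real" where
  "arr_ip_mean \<nu> f g = (\<integral>m. arr_ip (f m) (g m) \<partial>disorder_law \<nu>)"

lemma bounded_supp_offdiag: "\<lbrakk>bounded_supp R a; i < - R \<or> R < i\<rbrakk> \<Longrightarrow> a (i, j) = 0"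
  by (rule bounded_suppD) auto

lemma arr_trace_sum:
  assumes "bounded_supp R a" shows "arr_trace a = (\<Sum>i\<in>{-R..R}. a (i, i))"
  unfolding arr_trace_def infsum_finite[OF finite_atLeastAtMost_int, symmetric]
  by (rule infsum_cong_neutral) (auto intro!: bounded_supp_offdiag[OF assms])

lemma summable_on_interval:
  fixes h :: "int \<Rightarrow> real"
  assumes "\<And>i. i < l \<or> u < i \<Longrightarrow> h i = 0" shows "h summable_on UNIV"
  by (rule finite_nonzero_values_imp_summable_on, rule finite_subset[of _ "{l..u}"])
     (auto, (metis assms not_le)+)

lemma diag_summable: "bounded_supp R a \<Longrightarrow> (\<lambda>i. a (i + k, i + k)) summable_on UNIV"
  by (rule summable_on_interval[of "- R - k" "R - k"], rule bounded_supp_offdiag) auto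

lemma telescope_infsum:
  fixes h :: "int \<Rightarrow> real"
  assumes "h summable_on UNIV" shows "(\<Sum>\<^sub>\<infinity>i. h (i - 1) - h i) = 0"
proof -
  have sh: "(\<lambda>i. h (i - 1)) summable_on UNIV"
    using assms by (subst summable_on_reindex_bij_witness[of UNIV "\<lambda>i. i + 1" "\<lambda>i. i - 1" UNIV h "\<lambda>i. h (i - 1)"]) auto
  have "(\<Sum>\<^sub>\<infinity>i. h (i - 1) + (- 1) * h i) = (\<Sum>\<^sub>\<infinity>i. h (i - 1)) + (- 1) * (\<Sum>\<^sub>\<infinity>i. h i)"
    using sh assms by (simp only: infsum_add infsum_cmult_right' summable_on_cmult_right)
  also have "(\<Sum>\<^sub>\<infinity>i. h (i - 1)) = (\<Sum>\<^sub>\<infinity>i. h i)"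
    by (rule infsum_reindex_bij_witness[of _ "\<lambda>i. i + 1" "\<lambda>i. i - 1"]) auto
  finally show ?thesis by simp
qed

text \<open>The diagonal of the image is a discrete divergence, and so it sums to zero; likewise for \<open>arr_A\<close>.\<close>
lemma arr_trace_N: 
  assumes R: "bounded_supp R a" shows "arr_trace (arr_N lam \<gamma> a) = 0"
proof -
  define h where "h i = lam * (a (i + 1, i + 1) - a (i, i))" for i
  have "arr_N lam \<gamma> a (i, i) = h (i - 1) - h i" for i
  proof -
    have "bonds (i, i) = {i - 1, i}" by (auto simp: bonds_def)
    then show ?thesis by (simp add: arr_N_def h_def swp_def sw_def algebra_simps)
  qed
  moreover have "h summable_on UNIV"
  proof -
    have "(\<lambda>i. lam * (a (i + 1, i + 1) + (- 1) * a (i + 0, i + 0))) summable_on UNIV"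
      by (intro summable_on_cmult_right summable_on_add diag_summable[OF R])
    then show ?thesis by (simp add: h_def[abs_def])
  qed
  ultimately show ?thesis by (simp add: arr_trace_def telescope_infsum)
qed

lemma arr_trace_A: 
  assumes R: "bounded_supp R a" and sym: "\<And>i j. a (i, j) = a (j, i)"
  shows "arr_trace (arr_A c a) = 0"
proof -
  define h where "h i = 2 * c i * a (i, i + 1)" for i
  have "arr_A c a (i, i) = h (i - 1) - h i" for i
    using sym[of "i - 1" i] sym[of "i + 1" i] by (simp add: arr_A_def h_def)
  moreover have "h summable_on UNIV"
    by (rule summable_on_interval[of "- R" R]) (auto simp: h_def bounded_supp_offdiag[OF R])
  ultimately show ?thesis by (simp add: arr_trace_def telescope_infsum)
qed

lemma arr_trace_shift: "arr_trace (\<lambda>p. a (fst p - z, snd p - z)) = arr_trace a"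
  unfolding arr_trace_def by (rule infsum_reindex_bij_witness[of _ "\<lambda>i. i + z" "\<lambda>i. i - z"]) auto

lemma arr_ip_translate:
  "arr_ip (\<lambda>p. a (fst p - z, snd p - z)) (\<lambda>p. b (fst p - z, snd p - z)) = arr_ip a b"
  unfolding arr_ip_def
  by (rule infsum_reindex_bij_witness[of _ "\<lambda>p. (fst p + z, snd p + z)" "\<lambda>p. (fst p - z, snd p - z)"]) auto

lemma arr_N_sym:
  assumes "\<And>i j. a (i, j) = a (j, i)" shows "arr_N lam \<gamma> a (i, j) = arr_N lam \<gamma> a (j, i)"
proof -
  have "bonds (j, i) = bonds (i, j)" by (auto simp: bonds_def)
  moreover have "a (swp x (i, j)) = a (swp x (j, i))" for x using assms by (simp add: swp_def)
  ultimately show ?thesis using assms[of i j] by (auto simp: arr_N_def)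
qed

lemma arr_A_sym:
  assumes "\<And>i j. a (i, j) = a (j, i)" shows "arr_A c a (i, j) = arr_A c a (j, i)"
  using assms[of "i - 1" j] assms[of "i + 1" j] assms[of i "j - 1"] assms[of i "j + 1"]
  by (simp add: arr_A_def)

lemma op_N_T: "op_N lam \<gamma> (op_T z f) = op_T z (op_N lam \<gamma> f)"
proof (rule ext)+
  fix m and p :: "int \<times> int"
  obtain i j where p: "p = (i, j)" by (cases p)
  let ?b = "f (shift_conf z m)"
  have "bonds (i, j) = (\<lambda>x. x + z) ` bonds (i - z, j - z)" by (auto simp: bonds_def)
  then have "(\<Sum>x\<in>bonds (i, j). ?b (i - z, j - z) - ?b (fst (swp x (i, j)) - z, snd (swp x (i, j)) - z))
      = (\<Sum>x\<in>bonds (i - z, j - z). ?b (i - z, j - z) - ?b (fst (swp (x + z) (i, j)) - z, snd (swp (x + z) (i, j)) - z))"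
    by (simp add: sum.reindex)
  also have "\<dots> = (\<Sum>x\<in>bonds (i - z, j - z). ?b (i - z, j - z) - ?b (swp x (i - z, j - z)))"
    by (intro sum.cong refl arg_cong2[of _ _ _ _ "(-)"] arg_cong[of _ _ ?b]) (auto simp: swp_def sw_def)
  finally show "op_N lam \<gamma> (op_T z f) m p = op_T z (op_N lam \<gamma> f) m p"
    by (simp add: op_N_def op_T_def arr_N_def p)
qed

lemma op_A_T: "op_A (op_T z f) = op_T z (op_A f)"
  by (auto simp: op_A_def op_T_def arr_A_def fun_eq_iff cond_shift algebra_simps)

lemma linear_op_N: "linear (op_N lam \<gamma>)"
  by (rule linearI)
     (auto simp: op_N_def fun_eq_iff linear_add[OF linear_arr_N] linear_scale[OF linear_arr_N])

lemma linear_op_A: "linear op_A"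
  by (rule linearI)
     (auto simp: op_A_def fun_eq_iff linear_add[OF linear_arr_A] linear_scale[OF linear_arr_A])

lemma linear_op_T: "linear (op_T z)"
  by (rule linearI) (auto simp: op_T_def fun_eq_iff)

lemma subspace_arrays: "subspace (arrays C)"
  unfolding subspace_def
proof (intro conjI ballI allI)
  show "0 \<in> arrays C" by (auto simp: arrays_def bounded_supp_def arr_trace_def)
next
  fix f g assume f: "f \<in> arrays C" and g: "g \<in> arrays C"
  obtain R1 R2 where "\<forall>m\<in>Omega_D C. bounded_supp R1 (f m)" "\<forall>m\<in>Omega_D C. bounded_supp R2 (g m)"
    using f g by (auto simp: arrays_def)
  then have b: "bounded_supp (max R1 R2) (f m)" "bounded_supp (max R1 R2) (g m)" if "m \<in> Omega_D C" for m
    using that by (auto intro: bounded_supp_mono)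
  have fg: "bounded_supp (max R1 R2) ((f + g) m)" if "m \<in> Omega_D C" for m
    using b[OF that] by (auto simp: bounded_supp_iff)
  have "arr_trace ((f + g) m) = 0" if "m \<in> Omega_D C" for m
  proof -
    have "arr_trace ((f + g) m) = arr_trace (f m) + arr_trace (g m)"
      using b[OF that] fg[OF that] by (simp add: arr_trace_sum sum.distrib)
    then show ?thesis using f g that by (simp add: arrays_def)
  qed
  then show "f + g \<in> arrays C" using f g fg by (auto simp: arrays_def)
next
  fix f and r :: real assume f: "f \<in> arrays C"
  obtain R where "\<forall>m\<in>Omega_D C. bounded_supp R (f m)" using f by (auto simp: arrays_def)
  then have rf: "\<forall>m\<in>Omega_D C. bounded_supp R ((r *\<^sub>R f) m)" by (auto simp: bounded_supp_iff)
  have "arr_trace ((r *\<^sub>R f) m) = r * arr_trace (f m)" for m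
    by (simp add: arr_trace_def infsum_cmult_right')
  then show "r *\<^sub>R f \<in> arrays C" using f rf by (auto simp: arrays_def)
qed

locale chain =
  fixes lam \<gamma> C :: real and \<nu> :: "real measure"
  assumes lam_pos: "lam > 0" and \<gamma>_pos: "\<gamma> > 0" and C_gt: "C > 1"
    and site_law: "disorder_site_law C \<nu>"
begin

lemma prob_site: "prob_space \<nu>" and sets_site: "sets \<nu> = sets (restrict_space borel {1 / C..C})"
  using site_law by (auto simp: disorder_site_law_def)

lemma space_site: "space \<nu> = {1 / C..C}"
  using sets_eq_imp_space_eq[OF sets_site] by (simp add: space_restrict_space)

lemma prob_disorder: "prob_space (disorder_law \<nu>)"
  unfolding disorder_law_def by (intro prob_space_PiM prob_site)

sublocale dis: prob_space "disorder_law \<nu>" by (rule prob_disorder)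

lemma space_disorder [simp]: "space (disorder_law \<nu>) = Omega_D C"
  by (simp add: disorder_law_def space_PiM space_site Omega_D_eq_PiE)

lemma disorder_coord_measurable: "(\<lambda>m. m x) \<in> borel_measurable (disorder_law \<nu>)"
proof -
  have "(\<lambda>m. m x) \<in> disorder_law \<nu> \<rightarrow>\<^sub>M \<nu>" unfolding disorder_law_def by simp
  also have "disorder_law \<nu> \<rightarrow>\<^sub>M \<nu> = disorder_law \<nu> \<rightarrow>\<^sub>M restrict_space borel {1 / C..C}"
    by (rule measurable_cong_sets) (auto simp: sets_site)
  finally show ?thesis by (simp add: measurable_restrict_space2_iff)
qed

lemma disorder_id_measurable: "(\<lambda>m. m) \<in> borel_measurable (disorder_law \<nu>)"
  by (rule measurable_coordinatewise_then_product) (rule disorder_coord_measurable)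

lemma local_cont_measurable [measurable]:
  assumes "local_cont C \<psi>" shows "\<psi> \<in> borel_measurable (disorder_law \<nu>)"
proof -
  have "\<psi> \<in> borel_measurable (restrict_space borel (Omega_D C))"
    using assms by (intro borel_measurable_continuous_on_restrict) (simp add: local_cont_def)
  moreover have "(\<lambda>m. m) \<in> disorder_law \<nu> \<rightarrow>\<^sub>M restrict_space borel (Omega_D C)"
    by (rule measurable_restrict_space2) (auto simp: disorder_id_measurable)
  ultimately show ?thesis by (rule measurable_compose[rotated])
qed

lemma local_cont_integrable [intro]:
  assumes "local_cont C \<psi>" shows "integrable (disorder_law \<nu>) \<psi>"
proof -
  obtain B where "\<And>m. m \<in> Omega_D C \<Longrightarrow> \<bar>\<psi> m\<bar> \<le> B" using local_cont_bounded[OF assms] by blast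
  then show ?thesis
    by (intro dis.integrable_const_bound[of _ B] AE_I2 local_cont_measurable assms) auto
qed

lemma shift_measurable [measurable]: "shift_conf z \<in> disorder_law \<nu> \<rightarrow>\<^sub>M disorder_law \<nu>"
  unfolding shift_conf_def disorder_law_def
  by (rule measurable_PiM_single') (auto simp: space_PiM)

lemma distr_shift: "distr (disorder_law \<nu>) (disorder_law \<nu>) (shift_conf z) = disorder_law \<nu>"
  using distr_PiM_reindex[of UNIV "\<lambda>_. \<nu>" "\<lambda>x. z + x" UNIV] prob_site
  by (simp add: disorder_law_def shift_conf_def[abs_def] restrict_def inj_on_def)

lemma local_cont_cond: "local_cont C (\<lambda>m. cond m x)"
  unfolding cond_def
proof (rule local_cont_comp2[OF local_cont_coord local_cont_coord])
  have "1 / C > 0" using C_gt by simp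
  then show "continuous_on ({1 / C..C} \<times> {1 / C..C}) (\<lambda>(x, y). 1 / sqrt (x * y))"
    unfolding case_prod_unfold by (intro continuous_intros) auto
qed (auto simp: Omega_D_def)

lemma cond_le: 
  assumes "m \<in> Omega_D C" shows "\<bar>cond m x\<bar> \<le> C"
proof -
  have m: "1 / C \<le> m x" "1 / C \<le> m (x + 1)" using assms by (auto simp: Omega_D_def)
  have C0: "1 / C > 0" using C_gt by simp
  have "(1 / C)\<^sup>2 \<le> m x * m (x + 1)"
    unfolding power2_eq_square using m C0 by (intro mult_mono) linarith+
  then have "1 / C \<le> sqrt (m x * m (x + 1))" by (rule real_le_rsqrt)
  then have "inverse (sqrt (m x * m (x + 1))) \<le> inverse (1 / C)"
    using C0 by (rule le_imp_inverse_le)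
  moreover have "0 \<le> cond m x"
    unfolding cond_def using \<open>1 / C \<le> sqrt _\<close> C0 by (intro divide_nonneg_nonneg) linarith+
  ultimately show ?thesis by (simp add: cond_def inverse_eq_divide)
qed

lemma arrays_local: "f \<in> arrays C \<Longrightarrow> local_cont C (\<lambda>m. f m p)"
  unfolding arrays_def by blast

lemma arrays_supp2:
  assumes "f \<in> arrays C" "g \<in> arrays C"
  obtains R where "R \<ge> 0" "\<And>m. m \<in> Omega_D C \<Longrightarrow> bounded_supp R (f m)"
    "\<And>m. m \<in> Omega_D C \<Longrightarrow> bounded_supp R (g m)"
proof -
  obtain R1 R2 where "\<forall>m\<in>Omega_D C. bounded_supp R1 (f m)" "\<forall>m\<in>Omega_D C. bounded_supp R2 (g m)"
    using assms by (auto simp: arrays_def)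
  then show ?thesis
    using that[of "max 0 (max R1 R2)"] by (force intro: bounded_supp_mono)
qed

lemma arrays_fin: "\<lbrakk>f \<in> arrays C; m \<in> Omega_D C\<rbrakk> \<Longrightarrow> f m \<in> fin_arrays"
  by (auto simp: arrays_def fin_arrays_def)

lemma local_cont_arr_ip:
  assumes "f \<in> arrays C" "g \<in> arrays C" shows "local_cont C (\<lambda>m. arr_ip (f m) (g m))"
proof -
  obtain R where R: "\<And>m. m \<in> Omega_D C \<Longrightarrow> bounded_supp R (g m)"
    using arrays_supp2[OF assms] by blast
  have "local_cont C (\<lambda>m. \<Sum>p\<in>index_box R. f m p * g m p)"
    by (intro local_cont_sum local_cont_mult arrays_local[OF assms(1)] arrays_local[OF assms(2)])
  then show ?thesis by (rule local_cont_cong) (simp add: arr_ip_sum[OF R])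
qed

lemma ip_integrable:
  assumes "f \<in> arrays C" "g \<in> arrays C"
  shows "integrable (disorder_law \<nu>) (\<lambda>m. arr_ip (f m) (g m))"
  by (rule local_cont_integrable[OF local_cont_arr_ip[OF assms]])

lemma op_N_closed: "f \<in> arrays C \<Longrightarrow> op_N lam \<gamma> f \<in> arrays C"
proof -
  assume f: "f \<in> arrays C"
  then obtain R where R: "\<And>m. m \<in> Omega_D C \<Longrightarrow> bounded_supp R (f m)" by (auto simp: arrays_def)
  have "local_cont C (\<lambda>m. if fst p = snd p then 0 else f m p)" for p
    by (cases "fst p = snd p") (simp_all add: arrays_local[OF f])
  then have "local_cont C (\<lambda>m. op_N lam \<gamma> f m p)" for p
    unfolding op_N_def arr_N_def
    by (intro local_cont_add local_cont_mult local_cont_sum local_cont_diff local_cont_const arrays_local[OF f])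
  moreover have "\<forall>m\<in>Omega_D C. bounded_supp (R + 1) (op_N lam \<gamma> f m)"
    using arr_N_supp[OF R] by (simp add: op_N_def)
  moreover have "op_N lam \<gamma> f m (i, j) = op_N lam \<gamma> f m (j, i)" if "m \<in> Omega_D C" for m i j
    unfolding op_N_def by (rule arr_N_sym) (use f that in \<open>auto simp: arrays_def\<close>)
  ultimately show ?thesis
    using arr_trace_N[OF R] unfolding arrays_def op_N_def by blast
qed

lemma op_A_closed: "f \<in> arrays C \<Longrightarrow> op_A f \<in> arrays C"
proof -
  assume f: "f \<in> arrays C"
  then obtain R where R: "\<And>m. m \<in> Omega_D C \<Longrightarrow> bounded_supp R (f m)" by (auto simp: arrays_def)
  have "local_cont C (\<lambda>m. op_A f m p)" for p
    unfolding op_A_def arr_A_def case_prod_unfold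
    by (intro local_cont_add local_cont_mult local_cont_diff local_cont_cond arrays_local[OF f])
  moreover have "\<forall>m\<in>Omega_D C. bounded_supp (R + 1) (op_A f m)"
    using arr_A_supp[OF R] by (simp add: op_A_def)
  moreover have "op_A f m (i, j) = op_A f m (j, i)" if "m \<in> Omega_D C" for m i j
    unfolding op_A_def by (rule arr_A_sym) (use f that in \<open>auto simp: arrays_def\<close>)
  moreover have "arr_trace (op_A f m) = 0" if "m \<in> Omega_D C" for m
    unfolding op_A_def by (rule arr_trace_A[OF R[OF that]]) (use f that in \<open>auto simp: arrays_def\<close>)
  ultimately show ?thesis unfolding arrays_def by blast
qed

lemma op_T_supp:
  assumes "bounded_supp R (f (shift_conf z m))" shows "bounded_supp (R + \<bar>z\<bar>) (op_T z f m)"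
  unfolding bounded_supp_iff[of "R + \<bar>z\<bar>"] op_T_def
proof (intro allI impI)
  fix p assume "p \<notin> index_box (R + \<bar>z\<bar>)"
  then show "f (shift_conf z m) (fst p - z, snd p - z) = 0"
    by (intro bounded_suppD[OF assms]) auto
qed

lemma op_T_closed: "f \<in> arrays C \<Longrightarrow> op_T z f \<in> arrays C"
proof -
  assume f: "f \<in> arrays C"
  then obtain R where R: "\<And>m. m \<in> Omega_D C \<Longrightarrow> bounded_supp R (f m)" by (auto simp: arrays_def)
  have "local_cont C (\<lambda>m. op_T z f m p)" for p
    unfolding op_T_def by (rule local_cont_shift[OF arrays_local[OF f]])
  moreover have "\<forall>m\<in>Omega_D C. bounded_supp (R + \<bar>z\<bar>) (op_T z f m)"
    using R by (intro ballI op_T_supp) simp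
  moreover have "op_T z f m (i, j) = op_T z f m (j, i)" if "m \<in> Omega_D C" for m i j
    unfolding op_T_def using f that by (simp add: arrays_def)
  moreover have "arr_trace (op_T z f m) = 0" if "m \<in> Omega_D C" for m
    unfolding op_T_def[abs_def] arr_trace_shift using f that by (simp add: arrays_def)
  ultimately show ?thesis unfolding arrays_def by blast
qed

lemma arr_diss: "m \<in> Omega_D C \<Longrightarrow>
  dissipative fin_arrays arr_ip (arr_N lam \<gamma>) (arr_A (cond m)) (4 * \<gamma> + 8 * lam) (sector_const lam \<gamma> C)"
  using cond_le by (intro arr_dissipative lam_pos \<gamma>_pos) auto

abbreviation "ip0 \<equiv> arr_ip_mean \<nu>"

text \<open>The estimates for arrays in a fixed environment have constants that do not depend on the
environment, so they can be integrated over the disorder.\<close>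
sublocale plain: dissipative "arrays C" ip0 "op_N lam \<gamma>" op_A "4 * \<gamma> + 8 * lam" "sector_const lam \<gamma> C"
proof (intro dissipative.intro semi_inner.intro dissipative_axioms.intro subspace_arrays
    linear_op_N linear_op_A op_N_closed op_A_closed)
  fix f g w assume f: "f \<in> arrays C" and w: "w \<in> arrays C"
  have fm: "f m \<in> fin_arrays" "w m \<in> fin_arrays" if "m \<in> Omega_D C" for m
    using arrays_fin f w that by auto
  show "ip0 (r *\<^sub>R f) w = r * ip0 f w" for r
    unfolding arr_ip_mean_def Bochner_Integration.integral_mult_right_zero[symmetric]
    by (rule Bochner_Integration.integral_cong) (auto simp: fin_arrays.scale_left fm)
  show "ip0 f w = ip0 w f" by (simp add: arr_ip_mean_def arr_ip_sym)
  show "0 \<le> ip0 f f" unfolding arr_ip_mean_def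
    by (rule integral_nonneg_AE) (auto simp: fin_arrays.nonneg fm)
  show "ip0 (op_N lam \<gamma> f) w = ip0 f (op_N lam \<gamma> w)"
    unfolding arr_ip_mean_def op_N_def
    by (rule Bochner_Integration.integral_cong) (auto simp: dissipative.N_sym[OF arr_diss] fm)
  show "ip0 (op_A f) w = - ip0 f (op_A w)"
    unfolding arr_ip_mean_def op_A_def integral_minus[symmetric]
    by (rule Bochner_Integration.integral_cong) (auto simp: dissipative.A_anti[OF arr_diss] fm)
  show "0 \<le> ip0 (op_N lam \<gamma> f) f" unfolding arr_ip_mean_def op_N_def
    by (rule integral_nonneg_AE) (auto simp: dissipative.N_nonneg[OF arr_diss] fm)
  show "ip0 (op_N lam \<gamma> f) f \<le> (4 * \<gamma> + 8 * lam) * ip0 f f"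
    unfolding arr_ip_mean_def Bochner_Integration.integral_mult_right_zero[symmetric]
  proof (rule integral_mono[OF ip_integrable[OF op_N_closed[OF f] f] integrable_mult_right[OF ip_integrable[OF f f]]])
    fix m assume "m \<in> space (disorder_law \<nu>)"
    then show "arr_ip (op_N lam \<gamma> f m) (f m) \<le> (4 * \<gamma> + 8 * lam) * arr_ip (f m) (f m)"
      unfolding op_N_def by (intro dissipative.N_bound[OF arr_diss] fm) auto
  qed
  show "2 * ip0 (op_A f) w \<le> sector_const lam \<gamma> C * (ip0 (op_N lam \<gamma> f) f + ip0 (op_N lam \<gamma> w) w)"
  proof -
    have "2 * ip0 (op_A f) w = (\<integral>m. 2 * arr_ip (op_A f m) (w m) \<partial>disorder_law \<nu>)"
      by (simp add: arr_ip_mean_def)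
    also have "\<dots> \<le> (\<integral>m. sector_const lam \<gamma> C *
        (arr_ip (op_N lam \<gamma> f m) (f m) + arr_ip (op_N lam \<gamma> w m) (w m)) \<partial>disorder_law \<nu>)"
    proof (rule integral_mono)
      show "2 * arr_ip (op_A f m) (w m) \<le> sector_const lam \<gamma> C *
        (arr_ip (op_N lam \<gamma> f m) (f m) + arr_ip (op_N lam \<gamma> w m) (w m))"
        if "m \<in> space (disorder_law \<nu>)" for m
        unfolding op_A_def op_N_def using that by (intro dissipative.sector[OF arr_diss]) (auto simp: fm)
    qed (rule integrable_mult_right ip_integrable[OF op_A_closed[OF f] w]
          Bochner_Integration.integrable_add[OF ip_integrable[OF op_N_closed[OF f] f] ip_integrable[OF op_N_closed[OF w] w]])+
    also have "\<dots> = sector_const lam \<gamma> C * (ip0 (op_N lam \<gamma> f) f + ip0 (op_N lam \<gamma> w) w)"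
      unfolding arr_ip_mean_def
      by (simp add: Bochner_Integration.integral_add[OF ip_integrable[OF op_N_closed[OF f] f] ip_integrable[OF op_N_closed[OF w] w]])
    finally show ?thesis .
  qed
  assume g: "g \<in> arrays C"
  show "ip0 (f + g) w = ip0 f w + ip0 g w"
    unfolding arr_ip_mean_def
    unfolding Bochner_Integration.integral_add[OF ip_integrable[OF f w] ip_integrable[OF g w], symmetric]
    by (rule Bochner_Integration.integral_cong) (auto simp: fin_arrays.add_left fm arrays_fin[OF g])
next
  have "1 / C < 1" using C_gt by simp
  then have "1 / C \<le> C" using C_gt by linarith
  then have "(\<lambda>_. 1 / C) \<in> Omega_D C" by (simp add: Omega_D_def)
  from arr_diss[OF this] show "0 \<le> sector_const lam \<gamma> C" by (rule dissipative.\<kappa>_nonneg)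
  show "0 \<le> 4 * \<gamma> + 8 * lam" using lam_pos \<gamma>_pos by simp
qed

text \<open>Translations are isometries because the disorder is stationary.\<close>
sublocale translation_system "arrays C" ip0 "op_N lam \<gamma>" op_A "4 * \<gamma> + 8 * lam"
  "sector_const lam \<gamma> C" op_T
proof (intro translation_system.intro translation_system_axioms.intro plain.dissipative_axioms linear_op_T op_T_closed op_N_T op_A_T)
  show "op_T u (op_T z f) = op_T (u + z) f" for u z f
    by (auto simp: op_T_def fun_eq_iff shift_conf_def algebra_simps)
  show "op_T 0 f = f" for f by (auto simp: op_T_def fun_eq_iff shift_conf_def)
next
  fix f g z assume f: "f \<in> arrays C" and g: "g \<in> arrays C"
  have "ip0 (op_T z f) (op_T z g) = (\<integral>m. arr_ip (f (shift_conf z m)) (g (shift_conf z m)) \<partial>disorder_law \<nu>)"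
    unfolding arr_ip_mean_def op_T_def[abs_def] by (simp add: arr_ip_translate)
  also have "\<dots> = (\<integral>m. arr_ip (f m) (g m) \<partial>distr (disorder_law \<nu>) (disorder_law \<nu>) (shift_conf z))"
    by (rule integral_distr[OF shift_measurable local_cont_measurable[OF local_cont_arr_ip[OF f g]], symmetric])
  also have "\<dots> = ip0 f g" by (simp add: distr_shift arr_ip_mean_def)
  finally show "ip0 (op_T z f) (op_T z g) = ip0 f g" .
next
  fix f g assume f: "f \<in> arrays C" and g: "g \<in> arrays C"
  obtain R where R: "R \<ge> 0" "\<And>m. m \<in> Omega_D C \<Longrightarrow> bounded_supp R (f m)" "\<And>m. m \<in> Omega_D C \<Longrightarrow> bounded_supp R (g m)"
    using arrays_supp2[OF f g] by blast
  have far: "ip0 f (op_T z g) = 0" if "\<bar>z\<bar> > 2 * R" for z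
  proof -
    have "arr_ip (f m) (op_T z g m) = 0" if m: "m \<in> Omega_D C" for m
    proof -
      have "f m p * op_T z g m p = 0" for p
      proof (cases "p \<in> index_box R")
        case True
        have "g (shift_conf z m) (fst p - z, snd p - z) = 0"
          by (rule bounded_suppD[OF R(3)]) (use m True \<open>\<bar>z\<bar> > 2 * R\<close> in auto)
        then show ?thesis by (simp add: op_T_def)
      next
        case False
        then show ?thesis using bounded_suppD[OF R(2)[OF m]] by simp
      qed
      then show ?thesis unfolding arr_ip_def by (intro infsum_0)
    qed
    then show ?thesis unfolding arr_ip_mean_def by (subst Bochner_Integration.integral_cong[OF refl, of _ _ "\<lambda>_. 0"]) auto
  qed
  have "{z. ip0 f (op_T z g) \<noteq> 0} \<subseteq> {- (2 * R)..2 * R}"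
  proof
    fix z assume "z \<in> {z. ip0 f (op_T z g) \<noteq> 0}"
    then have "\<not> \<bar>z\<bar> > 2 * R" using far[of z] by blast
    then show "z \<in> {- (2 * R)..2 * R}" by (smt (verit) atLeastAtMost_iff)
  qed
  then show "finite {z. ip0 f (op_T z g) \<noteq> 0}" by (rule finite_subset) simp
qed

end

definition qform :: "arr \<Rightarrow> conf \<Rightarrow> real" where
  "qform a \<omega> = (\<Sum>\<^sub>\<infinity>p. a p * (\<omega> (fst p) * \<omega> (snd p)))"

definition obs_of :: "darr \<Rightarrow> obs" where "obs_of f m \<omega> = qform (f m) \<omega>"

lemma infsum_box:
  assumes "\<And>p. p \<notin> index_box R \<Longrightarrow> h p = 0"
  shows "infsum h UNIV = (\<Sum>p\<in>index_box R. h p :: real)"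
  unfolding infsum_finite[OF finite_box, symmetric]
  by (rule infsum_cong_neutral) (use assms in blast)+

lemma summable_box:
  assumes "\<And>p. p \<notin> index_box R \<Longrightarrow> h p = (0 :: real)"
  shows "h summable_on UNIV"
  by (rule finite_nonzero_values_imp_summable_on, rule finite_subset[OF _ finite_box[of R]])
     (use assms in blast)

lemma qform_sum: 
  assumes "bounded_supp R a"
  shows "qform a \<omega> = (\<Sum>p\<in>index_box R. a p * (\<omega> (fst p) * \<omega> (snd p)))"
  unfolding qform_def by (rule infsum_box) (simp add: bounded_suppD[OF assms])

lemma qform_summable:
  assumes "bounded_supp R a"
  shows "(\<lambda>p. a p * (\<omega> (fst p) * \<omega> (snd p))) summable_on S"
  by (rule summable_on_subset_banach[OF summable_box[of R]]) (simp_all add: bounded_suppD[OF assms])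

subsection \<open>The generator on quadratic forms\<close>

text \<open>A flip at \<open>x\<close> reverses exactly those off-diagonal monomials that contain \<open>\<omega> x\<close>, and each of these
monomials is reversed by two flips.\<close>
lemma qform_flip:
  assumes R: "bounded_supp R a"
  shows "(\<Sum>\<^sub>\<infinity>x\<in>UNIV. qform a (flip x \<omega>) - qform a \<omega>) = - 4 * qform (offd a) \<omega>"
proof -
  let ?w = "\<lambda>p. \<omega> (fst p) * \<omega> (snd p)"
  define ind where "ind x p = (if fst p \<noteq> snd p \<and> (x = fst p \<or> x = snd p) then 1 else 0 :: real)" for x :: int and p
  have fl: "flip x \<omega> i * flip x \<omega> j = \<omega> i * \<omega> j - 2 * ind x (i, j) * (\<omega> i * \<omega> j)" for x i j
    by (auto simp: flip_def ind_def)
  have d: "qform a (flip x \<omega>) - qform a \<omega> = (\<Sum>p\<in>index_box R. - 2 * (a p * ?w p) * ind x p)" for x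
    unfolding qform_sum[OF R] sum_subtractf[symmetric]
    by (rule sum.cong) (auto simp: fl algebra_simps)
  have zero: "ind x p = 0" if "x \<notin> {-R..R}" "p \<in> index_box R" for x p
    using that by (auto simp: ind_def)
  have cnt: "(\<Sum>x\<in>{-R..R}. ind x p) = (if fst p = snd p then 0 else 2)" if "p \<in> index_box R" for p
  proof (cases "fst p = snd p")
    case False
    have "(\<Sum>x\<in>{-R..R}. ind x p) = (\<Sum>x\<in>{fst p, snd p}. ind x p)"
      by (rule sum.mono_neutral_right) (use that in \<open>auto simp: ind_def abs_le_iff\<close>)
    then show ?thesis using False by (simp add: ind_def)
  qed (simp add: ind_def)
  have "(\<Sum>\<^sub>\<infinity>x\<in>UNIV. qform a (flip x \<omega>) - qform a \<omega>) = (\<Sum>x\<in>{-R..R}. qform a (flip x \<omega>) - qform a \<omega>)"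
    unfolding infsum_finite[OF finite_atLeastAtMost_int, symmetric]
    by (rule infsum_cong_neutral) (simp_all add: d zero)
  also have "\<dots> = (\<Sum>p\<in>index_box R. - 2 * (a p * ?w p) * (\<Sum>x\<in>{-R..R}. ind x p))"
    unfolding d by (subst sum.swap) (simp only: sum_distrib_left)
  also have "\<dots> = (\<Sum>p\<in>index_box R. - 4 * (offd a p * ?w p))"
    by (rule sum.cong) (auto simp: cnt offd_def)
  also have "\<dots> = - 4 * qform (offd a) \<omega>"
    unfolding qform_sum[OF offd_supp[OF R]] sum_distrib_left by simp
  finally show ?thesis .
qed

lemma exchange_apply: "exchange x \<omega> i = \<omega> (sw x i)"
  by (simp add: exchange_def sw_def)

lemma qform_exchange:
  assumes R: "bounded_supp R a"
  shows "(\<Sum>\<^sub>\<infinity>x\<in>UNIV. qform a (exchange x \<omega>) - qform a \<omega>)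
    = - (\<Sum>p\<in>index_box (R + 1). (\<Sum>x\<in>bonds p. a p - a (swp x p)) * (\<omega> (fst p) * \<omega> (snd p)))"
proof -
  let ?w = "\<lambda>p. \<omega> (fst p) * \<omega> (snd p)"
  let ?B = "index_box (R + 1)" and ?I = "{- R - 1..R}"
  have R1: "bounded_supp (R + 1) a" using bounded_supp_mono[OF R] by simp
  have ex: "exchange x \<omega> (fst p) * exchange x \<omega> (snd p) = ?w (swp x p)" for x p
    by (simp add: exchange_apply swp_def)
  have out: "qform a (exchange x \<omega>) - qform a \<omega> = 0" if "x \<notin> ?I" for x
  proof -
    have e: "a p * ?w (swp x p) = a p * ?w p" for p
    proof (cases "p \<in> index_box R")
      case True
      then have "x \<notin> bonds p" using that by (auto simp: bonds_def)
      then show ?thesis by (simp add: swp_id)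
    qed (simp add: bounded_suppD[OF R])
    show ?thesis unfolding qform_def ex e by simp
  qed
  have d: "qform a (exchange x \<omega>) - qform a \<omega> = (\<Sum>p\<in>?B. - ((a p - a (swp x p)) * ?w p))" if "x \<in> ?I" for x
  proof -
    have "qform a (exchange x \<omega>) = (\<Sum>p\<in>?B. a (swp x p) * ?w p)"
      unfolding qform_sum[OF R1] ex using sum_swp_box[OF that, of "\<lambda>p. a (swp x p) * ?w p"] by simp
    then show ?thesis
      by (simp add: qform_sum[OF R1] sum_subtractf[symmetric] algebra_simps)
  qed
  have bd: "(\<Sum>x\<in>?I. a p - a (swp x p)) = (\<Sum>x\<in>bonds p. a p - a (swp x p))" for p
  proof (cases "bonds p \<subseteq> ?I")
    case True
    then show ?thesis by (intro sum.mono_neutral_right) (auto simp: swp_id)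
  next
    case False
    \<comment> \<open>Then the bonds of \<open>p\<close> outside \<open>?I\<close> exchange pairs at which \<open>a\<close> vanishes.\<close>
    have z: "a p - a (swp x p) = 0" if "x \<notin> ?I" "x \<in> bonds p" for x
    proof -
      have "p \<notin> index_box R" using that by (auto simp: bonds_def)
      moreover have "swp x p \<notin> index_box R"
        using that by (cases p) (auto simp: bonds_def swp_def sw_def)
      ultimately show ?thesis by (simp add: bounded_suppD[OF R])
    qed
    have "(\<Sum>x\<in>?I. a p - a (swp x p)) = (\<Sum>x\<in>?I \<union> bonds p. a p - a (swp x p))"
      by (rule sum.mono_neutral_left) (use z in \<open>auto simp: bonds_def\<close>)
    also have "\<dots> = (\<Sum>x\<in>bonds p. a p - a (swp x p))"
      by (rule sum.mono_neutral_right) (auto simp: swp_id bonds_def[of p])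
    finally show ?thesis .
  qed
  have "(\<Sum>\<^sub>\<infinity>x\<in>UNIV. qform a (exchange x \<omega>) - qform a \<omega>) = (\<Sum>x\<in>?I. qform a (exchange x \<omega>) - qform a \<omega>)"
    unfolding infsum_finite[OF finite_atLeastAtMost_int, symmetric]
    by (rule infsum_cong_neutral) (use out in auto)
  also have "\<dots> = (\<Sum>x\<in>?I. \<Sum>p\<in>?B. - ((a p - a (swp x p)) * ?w p))"
    by (rule sum.cong[OF refl d])
  also have "\<dots> = (\<Sum>p\<in>?B. - ((\<Sum>x\<in>?I. a p - a (swp x p)) * ?w p))"
    by (subst sum.swap) (simp only: sum_distrib_right sum_negf)
  finally show ?thesis by (simp only: bd sum_negf)
qed

lemma gen_S_obs_of:
  assumes R: "bounded_supp R (f m)"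
  shows "gen_S lam \<gamma> (obs_of f) m \<omega> = - obs_of (op_N lam \<gamma> f) m \<omega>"
proof -
  let ?w = "\<lambda>p. \<omega> (fst p) * \<omega> (snd p)" and ?a = "f m"
  have "obs_of (op_N lam \<gamma> f) m \<omega> = (\<Sum>p\<in>index_box (R + 1). arr_N lam \<gamma> ?a p * ?w p)"
    unfolding obs_of_def op_N_def by (rule qform_sum[OF arr_N_supp[OF R]])
  also have "\<dots> = (\<Sum>p\<in>index_box (R + 1). 4 * \<gamma> * (offd ?a p * ?w p))
      + (\<Sum>p\<in>index_box (R + 1). lam * ((\<Sum>x\<in>bonds p. ?a p - ?a (swp x p)) * ?w p))"
    unfolding sum.distrib[symmetric]
    by (rule sum.cong) (simp_all add: arr_N_def offd_def distrib_right mult.assoc)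
  also have "(\<Sum>p\<in>index_box (R + 1). 4 * \<gamma> * (offd ?a p * ?w p)) = 4 * \<gamma> * qform (offd ?a) \<omega>"
    using qform_sum[OF bounded_supp_mono[OF offd_supp[OF R], of "R + 1"]] by (simp add: sum_distrib_left)
  finally show ?thesis
    using qform_flip[OF R, of \<omega>] qform_exchange[OF R, of \<omega>]
    by (simp add: gen_S_def obs_of_def sum_distrib_left)
qed

definition dqform :: "arr \<Rightarrow> int \<Rightarrow> conf \<Rightarrow> real" where
  "dqform a x \<omega> = (\<Sum>\<^sub>\<infinity>p. a p * ((if fst p = x then \<omega> (snd p) else 0) + (if snd p = x then \<omega> (fst p) else 0)))"

lemma dqform_sum:
  assumes "bounded_supp R a"
  shows "dqform a x \<omega>
    = (\<Sum>p\<in>index_box R. a p * ((if fst p = x then \<omega> (snd p) else 0) + (if snd p = x then \<omega> (fst p) else 0)))"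
  unfolding dqform_def by (rule infsum_box) (simp add: bounded_suppD[OF assms])

lemma qform_deriv:
  assumes R: "bounded_supp R a"
  shows "((\<lambda>s. qform a ((\<omega>)(x := s))) has_real_derivative dqform a x \<omega>) (at (\<omega> x))"
proof -
  have c: "((\<lambda>s. ((\<omega>)(x := s)) i) has_real_derivative (if i = x then 1 else 0)) (at (\<omega> x))" for i
    by (cases "i = x") (auto intro!: derivative_eq_intros)
  show ?thesis
    unfolding qform_sum[OF R] dqform_sum[OF R]
    by (rule DERIV_sum) (rule DERIV_cong, rule DERIV_cmult[OF DERIV_mult[OF c c]], simp)
qed

lemma partial_omega_obs_of:
  "bounded_supp R (f m) \<Longrightarrow> partial_omega x (obs_of f) m \<omega> = dqform (f m) x \<omega>"
  unfolding partial_omega_def obs_of_def by (rule DERIV_imp_deriv[OF qform_deriv])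

lemma qform_arr_A:
  fixes c :: "int \<Rightarrow> real"
  assumes R: "bounded_supp R a"
  defines "v \<equiv> \<lambda>\<omega> x. c x * \<omega> (x + 1) - c (x - 1) * \<omega> (x - 1)"
  shows "qform (arr_A c a) \<omega> = (\<Sum>p\<in>index_box R. a p * (v \<omega> (fst p) * \<omega> (snd p) + v \<omega> (snd p) * \<omega> (fst p)))"
proof -
  let ?t1 = "\<lambda>p. c (fst p - 1) * a (fst p - 1, snd p) * (\<omega> (fst p) * \<omega> (snd p))"
  let ?t2 = "\<lambda>p. c (fst p) * a (fst p + 1, snd p) * (\<omega> (fst p) * \<omega> (snd p))"
  let ?t3 = "\<lambda>p. c (snd p - 1) * a (fst p, snd p - 1) * (\<omega> (fst p) * \<omega> (snd p))"
  let ?t4 = "\<lambda>p. c (snd p) * a (fst p, snd p + 1) * (\<omega> (fst p) * \<omega> (snd p))"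
  let ?u1 = "\<lambda>p. c (fst p) * a p * (\<omega> (fst p + 1) * \<omega> (snd p))"
  let ?u2 = "\<lambda>p. c (fst p - 1) * a p * (\<omega> (fst p - 1) * \<omega> (snd p))"
  let ?u3 = "\<lambda>p. c (snd p) * a p * (\<omega> (fst p) * \<omega> (snd p + 1))"
  let ?u4 = "\<lambda>p. c (snd p - 1) * a p * (\<omega> (fst p) * \<omega> (snd p - 1))"
  have z: "a (fst p - 1, snd p) = 0" "a (fst p + 1, snd p) = 0" "a (fst p, snd p - 1) = 0" "a (fst p, snd p + 1) = 0"
    if "p \<notin> index_box (R + 1)" for p
    by (rule bounded_suppD[OF R]; use that in auto)+
  have s: "?t1 summable_on UNIV" "?t2 summable_on UNIV" "?t3 summable_on UNIV" "?t4 summable_on UNIV"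
    by (rule summable_box[of "R + 1"], simp add: z del: index_box_iff)+
  have su: "?u1 summable_on UNIV" "?u2 summable_on UNIV" "?u3 summable_on UNIV" "?u4 summable_on UNIV"
    by (rule summable_box[of R], simp add: bounded_suppD[OF R] del: index_box_iff)+
  have e1: "infsum ?t1 UNIV = infsum ?u1 UNIV"
    by (rule infsum_reindex_bij_witness[of _ "\<lambda>p. (fst p + 1, snd p)" "\<lambda>p. (fst p - 1, snd p)"]) auto
  have e2: "infsum ?t2 UNIV = infsum ?u2 UNIV"
    by (rule infsum_reindex_bij_witness[of _ "\<lambda>p. (fst p - 1, snd p)" "\<lambda>p. (fst p + 1, snd p)"]) auto
  have e3: "infsum ?t3 UNIV = infsum ?u3 UNIV"
    by (rule infsum_reindex_bij_witness[of _ "\<lambda>p. (fst p, snd p + 1)" "\<lambda>p. (fst p, snd p - 1)"]) auto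
  have e4: "infsum ?t4 UNIV = infsum ?u4 UNIV"
    by (rule infsum_reindex_bij_witness[of _ "\<lambda>p. (fst p, snd p - 1)" "\<lambda>p. (fst p, snd p + 1)"]) auto
  have "qform (arr_A c a) \<omega> = (\<Sum>\<^sub>\<infinity>p. ?t1 p + ?t3 p + (- 1) * (?t2 p + ?t4 p))"
    unfolding qform_def by (intro infsum_cong) (auto simp: arr_A_def algebra_simps)
  also have "\<dots> = infsum ?u1 UNIV + infsum ?u3 UNIV + (- 1) * (infsum ?u2 UNIV + infsum ?u4 UNIV)"
    unfolding e1[symmetric] e2[symmetric] e3[symmetric] e4[symmetric] using s
    by (simp only: infsum_add infsum_cmult_right' summable_on_add summable_on_cmult_right)
  also have "\<dots> = (\<Sum>\<^sub>\<infinity>p. ?u1 p + ?u3 p + (- 1) * (?u2 p + ?u4 p))"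
    using su by (simp only: infsum_add infsum_cmult_right' summable_on_add summable_on_cmult_right)
  also have "\<dots> = (\<Sum>p\<in>index_box R. ?u1 p + ?u3 p + (- 1) * (?u2 p + ?u4 p))"
    by (rule infsum_box) (simp add: bounded_suppD[OF R] del: index_box_iff)
  also have "\<dots> = (\<Sum>p\<in>index_box R. a p * (v \<omega> (fst p) * \<omega> (snd p) + v \<omega> (snd p) * \<omega> (fst p)))"
    by (rule sum.cong) (simp_all add: v_def algebra_simps)
  finally show ?thesis .
qed

lemma gen_A_obs_of:
  assumes R: "bounded_supp R (f m)"
  shows "gen_A (obs_of f) m \<omega> = obs_of (op_A f) m \<omega>"
proof -
  let ?v = "\<lambda>x. cond m x * \<omega> (x + 1) - cond m (x - 1) * \<omega> (x - 1)" and ?a = "f m"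
  have d0: "dqform ?a x \<omega> = 0" if "x \<notin> {-R..R}" for x
    unfolding dqform_sum[OF R] using that by (intro sum.neutral) auto
  have "gen_A (obs_of f) m \<omega> = (\<Sum>\<^sub>\<infinity>x\<in>UNIV. ?v x * dqform ?a x \<omega>)"
    unfolding gen_A_def partial_omega_obs_of[of R f m, OF R] by (simp add: cond_def)
  also have "\<dots> = (\<Sum>x\<in>{-R..R}. ?v x * dqform ?a x \<omega>)"
    unfolding infsum_finite[OF finite_atLeastAtMost_int, symmetric]
    by (rule infsum_cong_neutral) (use d0 in auto)
  also have "\<dots> = (\<Sum>p\<in>index_box R. \<Sum>x\<in>{-R..R}. ?v x * (?a p *
      ((if fst p = x then \<omega> (snd p) else 0) + (if snd p = x then \<omega> (fst p) else 0))))"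
    unfolding dqform_sum[OF R] sum_distrib_left by (rule sum.swap)
  also have "\<dots> = (\<Sum>p\<in>index_box R. ?a p * (?v (fst p) * \<omega> (snd p) + ?v (snd p) * \<omega> (fst p)))"
  proof (rule sum.cong[OF refl])
    fix p assume "p \<in> index_box R"
    then have p: "fst p \<in> {-R..R}" "snd p \<in> {-R..R}" by auto
    have "(\<Sum>x\<in>{-R..R}. ?v x * (?a p * ((if fst p = x then \<omega> (snd p) else 0) + (if snd p = x then \<omega> (fst p) else 0))))
        = (\<Sum>x\<in>{-R..R}. (if fst p = x then ?a p * (?v x * \<omega> (snd p)) else 0)
          + (if snd p = x then ?a p * (?v x * \<omega> (fst p)) else 0))"
      by (rule sum.cong) (auto simp: algebra_simps)
    also have "\<dots> = ?a p * (?v (fst p) * \<omega> (snd p)) + ?a p * (?v (snd p) * \<omega> (fst p))"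
      unfolding sum.distrib using p by (simp only: sum.delta' finite_atLeastAtMost_int if_True)
    finally show "(\<Sum>x\<in>{-R..R}. ?v x * (?a p * ((if fst p = x then \<omega> (snd p) else 0) + (if snd p = x then \<omega> (fst p) else 0))))
        = ?a p * (?v (fst p) * \<omega> (snd p) + ?v (snd p) * \<omega> (fst p))" by (simp only: distrib_left)
  qed
  also have "\<dots> = obs_of (op_A f) m \<omega>"
    unfolding obs_of_def op_A_def by (rule qform_arr_A[OF R, symmetric])
  finally show ?thesis .
qed

lemma translate_obs_of: "translate z (obs_of f) m \<omega> = obs_of (op_T z f) m \<omega>"
  unfolding translate_def obs_of_def qform_def op_T_def
  by (rule infsum_reindex_bij_witness[of _ "\<lambda>p. (fst p - z, snd p - z)" "\<lambda>p. (fst p + z, snd p + z)"])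
     (auto simp: shift_conf_def add.commute)

definition current_arr :: darr where
  "current_arr m p = (if p = (0, 1) \<or> p = (1, 0) then - cond m 0 else 0)"

lemma current_arr_supp: "bounded_supp 1 (current_arr m)"
  by (auto simp: bounded_supp_def current_arr_def)

lemma current_obs_of: "current m \<omega> = obs_of current_arr m \<omega>"
proof -
  have "obs_of current_arr m \<omega> = (\<Sum>\<^sub>\<infinity>p\<in>{(0, 1), (1, 0)}. current_arr m p * (\<omega> (fst p) * \<omega> (snd p)))"
    unfolding obs_of_def qform_def by (rule infsum_cong_neutral) (auto simp: current_arr_def)
  also have "\<dots> = current m \<omega>" by (simp add: current_arr_def current_def cond_def)
  finally show ?thesis by simp
qed

subsection \<open>Quadratic observables are the arrays of trace zero\<close>

lemma qform_diag_off:
  assumes R: "bounded_supp R a"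
  shows "qform a \<omega> = (\<Sum>\<^sub>\<infinity>i. a (i, i) * (\<omega> i)\<^sup>2) + (\<Sum>\<^sub>\<infinity>(i, j)\<in>{(i, j). i \<noteq> j}. a (i, j) * \<omega> i * \<omega> j)"
proof -
  let ?h = "\<lambda>p. a p * (\<omega> (fst p) * \<omega> (snd p))"
  have U: "UNIV = range (\<lambda>i::int. (i, i)) \<union> {(i, j). i \<noteq> j}" by auto
  have "qform a \<omega> = infsum ?h (range (\<lambda>i. (i, i))) + infsum ?h {(i, j). i \<noteq> j}"
    unfolding qform_def by (subst U, rule infsum_Un_disjoint) (auto intro: qform_summable[OF R])
  also have "infsum ?h (range (\<lambda>i. (i, i))) = (\<Sum>\<^sub>\<infinity>i. a (i, i) * (\<omega> i)\<^sup>2)"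
    by (subst infsum_reindex) (auto simp: inj_on_def o_def power2_eq_square)
  also have "infsum ?h {(i, j). i \<noteq> j} = (\<Sum>\<^sub>\<infinity>(i, j)\<in>{(i, j). i \<noteq> j}. a (i, j) * \<omega> i * \<omega> j)"
    by (rule infsum_cong) (auto simp: mult.assoc)
  finally show ?thesis .
qed

lemma gradient_sum:
  fixes s :: "int \<Rightarrow> real"
  assumes "\<And>i. i < l \<or> u < i \<Longrightarrow> s i = 0"
  shows "(\<Sum>\<^sub>\<infinity>i. s i * (h (i + 1) - h i)) = (\<Sum>\<^sub>\<infinity>i. (s (i - 1) - s i) * h i)"
proof -
  have s1: "(\<lambda>i. s i * h (i + 1)) summable_on UNIV" and s2: "(\<lambda>i. s i * h i) summable_on UNIV"
    by (rule summable_on_interval[of l u]; simp add: assms)+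
  have s3: "(\<lambda>i. s (i - 1) * h i) summable_on UNIV"
    by (rule summable_on_interval[of l "u + 1"]) (auto intro!: assms)
  have "(\<Sum>\<^sub>\<infinity>i. s i * (h (i + 1) - h i)) = (\<Sum>\<^sub>\<infinity>i. s i * h (i + 1) + (- 1) * (s i * h i))"
    by (intro infsum_cong) (simp add: algebra_simps)
  also have "\<dots> = (\<Sum>\<^sub>\<infinity>i. s i * h (i + 1)) + (- 1) * (\<Sum>\<^sub>\<infinity>i. s i * h i)"
    using s1 s2 by (simp only: infsum_add infsum_cmult_right' summable_on_cmult_right)
  also have "(\<Sum>\<^sub>\<infinity>i. s i * h (i + 1)) = (\<Sum>\<^sub>\<infinity>i. s (i - 1) * h i)"
    by (rule infsum_reindex_bij_witness[of _ "\<lambda>i. i - 1" "\<lambda>i. i + 1"]) auto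
  also have "\<dots> + (- 1) * (\<Sum>\<^sub>\<infinity>i. s i * h i) = (\<Sum>\<^sub>\<infinity>i. s (i - 1) * h i + (- 1) * (s i * h i))"
    using s3 s2 by (simp only: infsum_add infsum_cmult_right' summable_on_cmult_right)
  also have "\<dots> = (\<Sum>\<^sub>\<infinity>i. (s (i - 1) - s i) * h i)"
    by (intro infsum_cong) (simp add: algebra_simps)
  finally show ?thesis .
qed

text \<open>Summation by parts turns the gradients into squares with coefficients
\<open>\<psi> (i - 1) (i - 1) m - \<psi> i i m\<close>, which telescope to trace zero.\<close>
lemma quad_obs_imp_arrays:
  assumes "g \<in> quad_obs C"
  shows "\<exists>f\<in>arrays C. \<forall>m\<in>Omega_D C. \<forall>\<omega>. g m \<omega> = obs_of f m \<omega>"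
proof -
  obtain \<psi> where lc: "\<And>i j. local_cont C (\<psi> i j)"
    and sym: "\<And>i j m. m \<in> Omega_D C \<Longrightarrow> \<psi> i j m = \<psi> j i m"
    and fin: "finite {(i, j). \<exists>m\<in>Omega_D C. \<psi> i j m \<noteq> 0}"
    and g: "\<And>m \<omega>. m \<in> Omega_D C \<Longrightarrow> g m \<omega> =
        (\<Sum>\<^sub>\<infinity>i\<in>UNIV. \<psi> i i m * ((\<omega> (i + 1))\<^sup>2 - (\<omega> i)\<^sup>2))
        + (\<Sum>\<^sub>\<infinity>(i, j)\<in>{(i, j). i \<noteq> j}. \<psi> i j m * \<omega> i * \<omega> j)"
    using assms unfolding quad_obs_def by blast
  let ?F = "{(i, j). \<exists>m\<in>Omega_D C. \<psi> i j m \<noteq> 0}"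
  define R where "R = (\<Sum>p\<in>?F. \<bar>fst p\<bar> + \<bar>snd p\<bar>)"
  have R: "\<psi> i j m = 0" if "m \<in> Omega_D C" "(i, j) \<notin> index_box R" for i j m
  proof (rule ccontr)
    assume "\<psi> i j m \<noteq> 0"
    then have "(i, j) \<in> ?F" using that by auto
    then have "\<bar>fst (i, j)\<bar> + \<bar>snd (i, j)\<bar> \<le> R"
      unfolding R_def using fin by (intro member_le_sum) auto
    then show False using that by auto
  qed
  define f :: darr where "f m p = (if fst p = snd p then \<psi> (fst p - 1) (fst p - 1) m - \<psi> (fst p) (fst p) m
     else \<psi> (fst p) (snd p) m)" for m p
  have supp: "bounded_supp (R + 1) (f m)" if "m \<in> Omega_D C" for m
    unfolding bounded_supp_def using R[OF that] by (auto simp: f_def) (smt (verit) index_box_iff fst_conv snd_conv)+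
  have zero: "\<psi> i i m = 0" if "m \<in> Omega_D C" "i < - R \<or> R < i" for i m
    using R[OF that(1), of i i] that(2) by auto
  have f: "f \<in> arrays C"
    unfolding arrays_def
  proof (intro CollectI conjI allI ballI exI[of _ "R + 1"])
    show "local_cont C (\<lambda>m. f m p)" for p
      by (cases "fst p = snd p") (simp_all add: f_def lc local_cont_diff)
    show "f m (i, j) = f m (j, i)" if "m \<in> Omega_D C" for m i j
      using sym[OF that] by (simp add: f_def)
    show "arr_trace (f m) = 0" if "m \<in> Omega_D C" for m
      unfolding arr_trace_def f_def fst_conv snd_conv
      using telescope_infsum[OF summable_on_interval, of "- R" R "\<lambda>i. \<psi> i i m"] zero[OF that] by simp
  qed (rule supp)
  have "g m \<omega> = obs_of f m \<omega>" if m: "m \<in> Omega_D C" for m \<omega>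
  proof -
    have "(\<Sum>\<^sub>\<infinity>i\<in>UNIV. \<psi> i i m * ((\<omega> (i + 1))\<^sup>2 - (\<omega> i)\<^sup>2)) = (\<Sum>\<^sub>\<infinity>i. f m (i, i) * (\<omega> i)\<^sup>2)"
      using gradient_sum[of "- R" R "\<lambda>i. \<psi> i i m" "\<lambda>i. (\<omega> i)\<^sup>2"] zero[OF m] by (simp add: f_def)
    moreover have "(\<Sum>\<^sub>\<infinity>(i, j)\<in>{(i, j). i \<noteq> j}. \<psi> i j m * \<omega> i * \<omega> j)
        = (\<Sum>\<^sub>\<infinity>(i, j)\<in>{(i, j). i \<noteq> j}. f m (i, j) * \<omega> i * \<omega> j)"
      by (rule infsum_cong) (auto simp: f_def)
    ultimately show ?thesis
      unfolding g[OF m] obs_of_def qform_diag_off[OF supp[OF m]] by simp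
  qed
  then show ?thesis using f by blast
qed

text \<open>Conversely, a finitely supported diagonal of sum zero has finitely supported partial sums, and
these, up to sign, are the coefficients of the gradients.\<close>
lemma arrays_imp_quad_obs:
  assumes f: "f \<in> arrays C" and g: "\<And>m \<omega>. m \<in> Omega_D C \<Longrightarrow> g m \<omega> = obs_of f m \<omega>"
  shows "g \<in> quad_obs C"
proof -
  obtain R where R: "\<And>m. m \<in> Omega_D C \<Longrightarrow> bounded_supp R (f m)"
    using f unfolding arrays_def by blast
  have lc: "local_cont C (\<lambda>m. f m p)" for p using f unfolding arrays_def by blast
  define s where "s i m = (\<Sum>k\<in>{-R..i}. - f m (k, k))" for i and m :: conf
  define \<psi> where "\<psi> i j = (if i = j then s i else (\<lambda>m. f m (i, j)))" for i j
  have s0: "s i m = 0" if m: "m \<in> Omega_D C" and "i < - R \<or> R < i" for i m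
    using that(2)
  proof
    assume "R < i"
    have "s i m = - (\<Sum>k\<in>{-R..R}. f m (k, k))"
      unfolding s_def sum_negf[symmetric] using \<open>R < i\<close>
      by (intro sum.mono_neutral_right) (auto intro!: bounded_supp_offdiag[OF R[OF m]])
    also have "(\<Sum>k\<in>{-R..R}. f m (k, k)) = arr_trace (f m)" by (rule arr_trace_sum[OF R[OF m], symmetric])
    also have "\<dots> = 0" using f m unfolding arrays_def by blast
    finally show ?thesis by simp
  qed (simp add: s_def)
  have diff: "s (i - 1) m - s i m = f m (i, i)" if m: "m \<in> Omega_D C" for i m
  proof (cases "- R \<le> i")
    case True
    then have "{-R..i} = insert i {-R..i - 1}" by auto
    then show ?thesis by (simp add: s_def)
  next
    case False
    then show ?thesis by (simp add: s_def bounded_supp_offdiag[OF R[OF m]])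
  qed
  show ?thesis
    unfolding quad_obs_def
  proof (intro CollectI exI[of _ \<psi>] conjI allI ballI)
    show "local_cont C (\<psi> i j)" for i j
    proof (cases "i = j")
      case True
      have "local_cont C (\<lambda>m. \<Sum>k\<in>{-R..i}. 0 - f m (k, k))"
        by (intro local_cont_sum local_cont_diff local_cont_const lc)
      then show ?thesis using True by (simp add: \<psi>_def s_def[abs_def])
    qed (simp add: \<psi>_def lc)
    show "\<psi> i j m = \<psi> j i m" if "m \<in> Omega_D C" for i j m
      using f that by (simp add: \<psi>_def arrays_def)
    have "{(i, j). \<exists>m\<in>Omega_D C. \<psi> i j m \<noteq> 0} \<subseteq> index_box R"
    proof clarify
      fix i j m assume m: "m \<in> Omega_D C" and nz: "\<psi> i j m \<noteq> 0"
      show "(i, j) \<in> index_box R"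
      proof (rule ccontr)
        assume nb: "(i, j) \<notin> index_box R"
        show False
        proof (cases "i = j")
          case True
          then have "i < - R \<or> R < i" using nb by auto
          then show False using s0[OF m] nz True by (simp add: \<psi>_def)
        next
          case False
          then show False using bounded_suppD[OF R[OF m] nb] nz by (simp add: \<psi>_def)
        qed
      qed
    qed
    then show "finite {(i, j). \<exists>m\<in>Omega_D C. \<psi> i j m \<noteq> 0}" by (rule finite_subset) simp
    fix m \<omega> assume m: "m \<in> Omega_D C"
    have "(\<Sum>\<^sub>\<infinity>i\<in>UNIV. \<psi> i i m * ((\<omega> (i + 1))\<^sup>2 - (\<omega> i)\<^sup>2)) = (\<Sum>\<^sub>\<infinity>i. f m (i, i) * (\<omega> i)\<^sup>2)"
      using gradient_sum[of "- R" R "\<lambda>i. s i m" "\<lambda>i. (\<omega> i)\<^sup>2"] s0[OF m] diff[OF m] by (simp add: \<psi>_def)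
    moreover have "(\<Sum>\<^sub>\<infinity>(i, j)\<in>{(i, j). i \<noteq> j}. \<psi> i j m * \<omega> i * \<omega> j)
        = (\<Sum>\<^sub>\<infinity>(i, j)\<in>{(i, j). i \<noteq> j}. f m (i, j) * \<omega> i * \<omega> j)"
      by (rule infsum_cong) (auto simp: \<psi>_def)
    ultimately show "g m \<omega> = (\<Sum>\<^sub>\<infinity>i\<in>UNIV. \<psi> i i m * ((\<omega> (i + 1))\<^sup>2 - (\<omega> i)\<^sup>2))
        + (\<Sum>\<^sub>\<infinity>(i, j)\<in>{(i, j). i \<noteq> j}. \<psi> i j m * \<omega> i * \<omega> j)"
      unfolding g[OF m] obs_of_def qform_diag_off[OF R[OF m]] by simp
  qed
qed

section \<open>Gaussian expectations\<close>

definition gauss :: "real \<Rightarrow> real measure" where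
  "gauss \<beta> = density lborel (normal_density 0 (sqrt (1 / \<beta>)))"

definition gauss_moment :: "real \<Rightarrow> nat \<Rightarrow> real" where
  "gauss_moment \<beta> n = (\<integral>x. x ^ n \<partial>gauss \<beta>)"

context
  fixes \<beta> :: real assumes \<beta>: "\<beta> > 0"
begin

lemma sd_pos: "sqrt (1 / \<beta>) > 0" using \<beta> by simp

lemma prob_gauss: "prob_space (gauss \<beta>)"
  unfolding gauss_def by (rule prob_space_normal_density[OF sd_pos])

lemma gauss_integrable: "integrable (gauss \<beta>) (\<lambda>x. x ^ n)"
  unfolding gauss_def using integrable_normal_moment[OF sd_pos, of 0 n]
  by (subst integrable_density) (auto simp: normal_density_nonneg)

lemma gauss_moment_eq: "gauss_moment \<beta> n = (\<integral>x. normal_density 0 (sqrt (1 / \<beta>)) x * x ^ n \<partial>lborel)"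
  unfolding gauss_moment_def gauss_def by (subst integral_density) (auto simp: normal_density_nonneg)

lemma gauss_moments:
  "gauss_moment \<beta> 0 = 1" "gauss_moment \<beta> (Suc 0) = 0" "gauss_moment \<beta> 2 = 1 / \<beta>"
  "gauss_moment \<beta> 3 = 0" "gauss_moment \<beta> 4 = 3 * (1 / \<beta>)\<^sup>2"
proof -
  note ev = integral_normal_moment_even[OF sd_pos, of 0, unfolded diff_0_right]
    and od = integral_normal_moment_odd[OF sd_pos, of 0, unfolded diff_0_right]
  show "gauss_moment \<beta> 0 = 1" using ev[of 0] by (simp add: gauss_moment_eq)
  show "gauss_moment \<beta> (Suc 0) = 0" using od[of 0] by (simp add: gauss_moment_eq)
  show "gauss_moment \<beta> 2 = 1 / \<beta>" using ev[of 1] \<beta> by (simp add: gauss_moment_eq)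
  show "gauss_moment \<beta> 3 = 0" using od[of 1] by (simp add: gauss_moment_eq)
  show "gauss_moment \<beta> 4 = 3 * (1 / \<beta>)\<^sup>2"
    using ev[of 2] \<beta> by (simp add: gauss_moment_eq fact_numeral power2_eq_square field_simps)
qed

lemma gibbs_eq: "gibbs \<beta> = (\<Pi>\<^sub>M x\<in>(UNIV :: int set). gauss \<beta>)"
  by (simp add: gibbs_def gauss_def)

lemma prob_gibbs: "prob_space (gibbs \<beta>)"
  unfolding gibbs_eq by (intro prob_space_PiM prob_gauss)

lemma gibbs_monomial:
  assumes I: "finite I"
  shows "integrable (gibbs \<beta>) (\<lambda>\<omega>. \<Prod>x\<in>I. \<omega> x ^ n x)"
    and "(\<integral>\<omega>. (\<Prod>x\<in>I. \<omega> x ^ n x) \<partial>gibbs \<beta>) = (\<Prod>x\<in>I. gauss_moment \<beta> (n x))"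
proof -
  interpret g: prob_space "gauss \<beta>" by (rule prob_gauss)
  interpret product_prob_space "\<lambda>_. gauss \<beta>" "UNIV :: int set" by unfold_locales
  have d: "distr (gibbs \<beta>) (\<Pi>\<^sub>M x\<in>I. gauss \<beta>) (\<lambda>\<omega>. restrict \<omega> I) = (\<Pi>\<^sub>M x\<in>I. gauss \<beta>)"
    unfolding gibbs_eq by (rule distr_PiM_restrict_finite[OF I]) simp
  have meas: "(\<lambda>\<omega>. restrict \<omega> I) \<in> gibbs \<beta> \<rightarrow>\<^sub>M (\<Pi>\<^sub>M x\<in>I. gauss \<beta>)"
    unfolding gibbs_eq by (rule measurable_restrict_subset) simp
  let ?h = "\<lambda>\<omega>. \<Prod>x\<in>I. \<omega> x ^ n x"
  have int: "integrable (\<Pi>\<^sub>M x\<in>I. gauss \<beta>) ?h"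
    by (rule product_integrable_prod[OF I gauss_integrable])
  have r: "?h (restrict \<omega> I) = ?h \<omega>" for \<omega> by (rule prod.cong) auto
  show "integrable (gibbs \<beta>) ?h"
    using integrable_distr[OF meas, of ?h] int unfolding d r by blast
  have "(\<integral>\<omega>. ?h \<omega> \<partial>gibbs \<beta>) = (\<integral>\<omega>. ?h (restrict \<omega> I) \<partial>gibbs \<beta>)" unfolding r ..
  also have "\<dots> = (\<integral>\<omega>. ?h \<omega> \<partial>distr (gibbs \<beta>) (\<Pi>\<^sub>M x\<in>I. gauss \<beta>) (\<lambda>\<omega>. restrict \<omega> I))"
    by (rule integral_distr[OF meas borel_measurable_integrable[OF int], symmetric])
  also have "\<dots> = (\<Prod>x\<in>I. gauss_moment \<beta> (n x))"
    unfolding d gauss_moment_def by (rule product_integral_prod[OF I gauss_integrable])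
  finally show "(\<integral>\<omega>. ?h \<omega> \<partial>gibbs \<beta>) = (\<Prod>x\<in>I. gauss_moment \<beta> (n x))" .
qed

text \<open>Isserlis' theorem for four coordinates. The monomial is written as a product over its distinct
sites, so independence reduces the claim to the moments of a single Gaussian.\<close>
lemma gibbs_fourth:
  fixes i j k l :: int
  shows "integrable (gibbs \<beta>) (\<lambda>\<omega>. (\<omega> i * \<omega> j) * (\<omega> k * \<omega> l))"
    and "(\<integral>\<omega>. (\<omega> i * \<omega> j) * (\<omega> k * \<omega> l) \<partial>gibbs \<beta>) = (1 / \<beta>)\<^sup>2 *
      (of_bool (i = j \<and> k = l) + of_bool (i = k \<and> j = l) + of_bool (i = l \<and> j = k))"
proof -
  define I where "I = {i, j, k, l}"
  define n :: "int \<Rightarrow> nat" where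
    "n x = (if x = i then 1 else 0) + (if x = j then 1 else 0) + (if x = k then 1 else 0) + (if x = l then 1 else 0)" for x
  have I: "finite I" "i \<in> I" "j \<in> I" "k \<in> I" "l \<in> I" by (auto simp: I_def)
  have pw: "\<omega> x ^ (if x = y then 1 else 0) = (if x = y then \<omega> x else (1::real))" for x y and \<omega> :: conf by simp
  have e: "(\<omega> i * \<omega> j) * (\<omega> k * \<omega> l) = (\<Prod>x\<in>I. \<omega> x ^ n x)" for \<omega> :: conf
    unfolding n_def power_add prod.distrib pw using I by (simp add: prod.delta mult.assoc)
  show "integrable (gibbs \<beta>) (\<lambda>\<omega>. (\<omega> i * \<omega> j) * (\<omega> k * \<omega> l))"
    unfolding e by (rule gibbs_monomial(1)[OF I(1)])
  have "(\<integral>\<omega>. (\<omega> i * \<omega> j) * (\<omega> k * \<omega> l) \<partial>gibbs \<beta>) = (\<Prod>x\<in>I. gauss_moment \<beta> (n x))"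
    unfolding e by (rule gibbs_monomial(2)[OF I(1)])
  also have "\<dots> = (1 / \<beta>)\<^sup>2 *
      (of_bool (i = j \<and> k = l) + of_bool (i = k \<and> j = l) + of_bool (i = l \<and> j = k))"
  proof -
    have 2: "gauss_moment \<beta> (Suc (Suc 0)) = 1 / \<beta>" using gauss_moments(3) by (simp add: numeral_2_eq_2)
    have 3: "gauss_moment \<beta> (Suc (Suc (Suc 0))) = 0" using gauss_moments(4) by (simp add: numeral_3_eq_3)
    have 4: "gauss_moment \<beta> (Suc (Suc (Suc (Suc 0)))) = 3 * (1 / \<beta>)\<^sup>2"
      using gauss_moments(5) by (simp add: eval_nat_numeral)
    note m = gauss_moments(1,2) 2 3 4
    show ?thesis
      unfolding I_def n_def
      by (cases "i = j"; cases "i = k"; cases "i = l"; cases "j = k"; cases "j = l"; cases "k = l";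
          simp add: m power2_eq_square insert_commute)
  qed
  finally show "(\<integral>\<omega>. (\<omega> i * \<omega> j) * (\<omega> k * \<omega> l) \<partial>gibbs \<beta>) = (1 / \<beta>)\<^sup>2 *
      (of_bool (i = j \<and> k = l) + of_bool (i = k \<and> j = l) + of_bool (i = l \<and> j = k))" .
qed

end

context chain
begin

lemma star_sigma_finite: "\<beta> > 0 \<Longrightarrow> pair_sigma_finite (disorder_law \<nu>) (gibbs \<beta>)"
  unfolding pair_sigma_finite_def using prob_disorder prob_gibbs
  by (simp add: prob_space_imp_sigma_finite)

lemma prob_star: "\<beta> > 0 \<Longrightarrow> prob_space (star_measure \<nu> \<beta>)"
  unfolding star_measure_def
  by (intro prob_space_pair prob_disorder prob_gibbs)

lemma star_product:
  assumes \<beta>: "\<beta> > 0" and \<phi>: "local_cont C \<phi>" and h: "integrable (gibbs \<beta>) h"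
  shows "integrable (star_measure \<nu> \<beta>) (\<lambda>p. \<phi> (fst p) * h (snd p))"
    and "(\<integral>p. \<phi> (fst p) * h (snd p) \<partial>star_measure \<nu> \<beta>) = (\<integral>m. \<phi> m * (\<integral>\<omega>. h \<omega> \<partial>gibbs \<beta>) \<partial>disorder_law \<nu>)"
proof -
  interpret pair_sigma_finite "disorder_law \<nu>" "gibbs \<beta>" by (rule star_sigma_finite[OF \<beta>])
  have [measurable]: "\<phi> \<in> borel_measurable (disorder_law \<nu>)" "h \<in> borel_measurable (gibbs \<beta>)"
    using \<phi> h by auto
  obtain B where B: "\<And>m. m \<in> Omega_D C \<Longrightarrow> \<bar>\<phi> m\<bar> \<le> B" using local_cont_bounded[OF \<phi>] by blast
  let ?f = "\<lambda>p. \<phi> (fst p) * h (snd p)"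
  show int: "integrable (star_measure \<nu> \<beta>) ?f"
    unfolding star_measure_def
  proof (rule Fubini_integrable)
    show "?f \<in> borel_measurable (disorder_law \<nu> \<Otimes>\<^sub>M gibbs \<beta>)" by measurable
    have "integrable (disorder_law \<nu>) (\<lambda>m. \<bar>\<phi> m\<bar> * (\<integral>\<omega>. \<bar>h \<omega>\<bar> \<partial>gibbs \<beta>))"
      by (intro integrable_mult_left integrable_abs local_cont_integrable \<phi>)
    then show "integrable (disorder_law \<nu>) (\<lambda>m. \<integral>\<omega>. norm (?f (m, \<omega>)) \<partial>gibbs \<beta>)"
      by (simp add: abs_mult)
    show "AE m in disorder_law \<nu>. integrable (gibbs \<beta>) (\<lambda>\<omega>. ?f (m, \<omega>))"
      using h by simp
  qed
  show "(\<integral>p. ?f p \<partial>star_measure \<nu> \<beta>) = (\<integral>m. \<phi> m * (\<integral>\<omega>. h \<omega> \<partial>gibbs \<beta>) \<partial>disorder_law \<nu>)"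
    unfolding star_measure_def using integral_fst'[OF int[unfolded star_measure_def]] by simp
qed

lemma space_star: "space (star_measure \<nu> \<beta>) = Omega_D C \<times> space (gibbs \<beta>)"
  by (simp add: star_measure_def space_pair_measure)

lemma E_star_cong:
  "(\<And>m \<omega>. m \<in> Omega_D C \<Longrightarrow> f m \<omega> = g m \<omega>) \<Longrightarrow> E_star \<nu> \<beta> f = E_star \<nu> \<beta> g"
  unfolding E_star_def by (rule Bochner_Integration.integral_cong) (auto simp: space_star)

text \<open>Of the three pairings in Isserlis' theorem, the one that pairs indices within each form
contributes a product of traces, which vanishes; each of the others contributes the inner
product of the arrays, by symmetry.\<close>
lemma obs_of_product:
  assumes \<beta>: "\<beta> > 0" and f: "f \<in> arrays C" and g: "g \<in> arrays C"
  shows "integrable (star_measure \<nu> \<beta>) (\<lambda>p. obs_of f (fst p) (snd p) * obs_of g (fst p) (snd p))"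
    and "E_star \<nu> \<beta> (\<lambda>m \<omega>. obs_of f m \<omega> * obs_of g m \<omega>) = 2 / \<beta>\<^sup>2 * ip0 f g"
proof -
  obtain R where "R \<ge> 0" and R: "\<And>m. m \<in> Omega_D C \<Longrightarrow> bounded_supp R (f m)"
      "\<And>m. m \<in> Omega_D C \<Longrightarrow> bounded_supp R (g m)"
    by (rule arrays_supp2[OF f g]) (rule that)
  define mono where "mono p q \<omega> = (\<omega> (fst p) * \<omega> (snd p)) * (\<omega> (fst q) * \<omega> (snd q))"
    for p q :: "int \<times> int" and \<omega> :: conf
  define W where "W p q = (1 / \<beta>)\<^sup>2 * (of_bool (fst p = snd p \<and> fst q = snd q)
      + of_bool (fst p = fst q \<and> snd p = snd q) + of_bool (fst p = snd q \<and> snd p = fst q))" for p q :: "int \<times> int"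
  have lc: "local_cont C (\<lambda>m. f m p * g m q)" for p q
    by (intro local_cont_mult arrays_local f g)
  have mi: "integrable (gibbs \<beta>) (mono p q)" and mv: "integral\<^sup>L (gibbs \<beta>) (mono p q) = W p q" for p q
    unfolding mono_def W_def by (rule gibbs_fourth[OF \<beta>])+
  let ?S = "\<lambda>x. \<Sum>p\<in>index_box R. \<Sum>q\<in>index_box R. (f (fst x) p * g (fst x) q) * mono p q (snd x)"
  have expand: "obs_of f (fst x) (snd x) * obs_of g (fst x) (snd x) = ?S x" if "x \<in> space (star_measure \<nu> \<beta>)" for x
  proof -
    have m: "fst x \<in> Omega_D C" using that by (auto simp: space_star)
    show ?thesis
      unfolding obs_of_def qform_sum[OF R(1)[OF m]] qform_sum[OF R(2)[OF m]] sum_product mono_def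
      by (intro sum.cong refl) simp
  qed
  have term_int: "integrable (star_measure \<nu> \<beta>) (\<lambda>x. (f (fst x) p * g (fst x) q) * mono p q (snd x))" for p q
    by (rule star_product(1)[OF \<beta> lc mi])
  have "integrable (star_measure \<nu> \<beta>) ?S"
    by (intro Bochner_Integration.integrable_sum term_int)
  then show "integrable (star_measure \<nu> \<beta>) (\<lambda>p. obs_of f (fst p) (snd p) * obs_of g (fst p) (snd p))"
    by (rule Bochner_Integration.integrable_cong[THEN iffD1, rotated -1]) (auto simp: expand)
  have inner: "(\<Sum>p\<in>index_box R. \<Sum>q\<in>index_box R. f m p * g m q * W p q) = 2 / \<beta>\<^sup>2 * arr_ip (f m) (g m)"
    if m: "m \<in> Omega_D C" for m
  proof -
    have g_sym: "g m (j, i) = g m (i, j)" for i j using g m by (simp add: arrays_def)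
    have tr: "(\<Sum>q\<in>index_box R. g m q * of_bool (fst q = snd q)) = 0"
    proof -
      have "(\<Sum>q\<in>index_box R. g m q * of_bool (fst q = snd q)) = (\<Sum>q\<in>(\<lambda>i. (i, i)) ` {-R..R}. g m q)"
        by (rule sum.mono_neutral_cong_right) (auto simp: image_iff abs_le_iff)
      also have "\<dots> = (\<Sum>i\<in>{-R..R}. g m (i, i))" by (subst sum.reindex) (auto simp: inj_on_def)
      also have "\<dots> = arr_trace (g m)" by (rule arr_trace_sum[OF R(2)[OF m], symmetric])
      also have "\<dots> = 0" using g m unfolding arrays_def by blast
      finally show ?thesis .
    qed
    have row: "(\<Sum>q\<in>index_box R. g m q * W p q) = (1 / \<beta>)\<^sup>2 * (2 * g m p)" if p: "p \<in> index_box R" for p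
    proof -
      have 1: "(\<Sum>q\<in>index_box R. g m q * of_bool (fst p = snd p \<and> fst q = snd q)) = 0"
        using tr by (cases "fst p = snd p") simp_all
      have 2: "(\<Sum>q\<in>index_box R. g m q * of_bool (fst p = fst q \<and> snd p = snd q)) = g m p"
      proof -
        have "(\<Sum>q\<in>index_box R. g m q * of_bool (fst p = fst q \<and> snd p = snd q)) = (\<Sum>q\<in>index_box R. if q = p then g m q else 0)"
          by (rule sum.cong) (auto simp: prod_eq_iff)
        then show ?thesis using p by (simp del: index_box_iff)
      qed
      have 3: "(\<Sum>q\<in>index_box R. g m q * of_bool (fst p = snd q \<and> snd p = fst q)) = g m p"
      proof -
        have "(\<Sum>q\<in>index_box R. g m q * of_bool (fst p = snd q \<and> snd p = fst q))
            = (\<Sum>q\<in>index_box R. if q = (snd p, fst p) then g m q else 0)"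
          by (rule sum.cong) (auto simp: prod_eq_iff)
        also have "\<dots> = g m (snd p, fst p)" using p by simp
        finally show ?thesis using g_sym[of "snd p" "fst p"] by simp
      qed
      have "(\<Sum>q\<in>index_box R. g m q * W p q) = (1 / \<beta>)\<^sup>2 * (
          (\<Sum>q\<in>index_box R. g m q * of_bool (fst p = snd p \<and> fst q = snd q))
          + (\<Sum>q\<in>index_box R. g m q * of_bool (fst p = fst q \<and> snd p = snd q))
          + (\<Sum>q\<in>index_box R. g m q * of_bool (fst p = snd q \<and> snd p = fst q)))"
        unfolding W_def sum.distrib[symmetric] sum_distrib_left
        by (intro sum.cong refl) (simp only: distrib_left mult_ac)
      then show ?thesis unfolding 1 2 3 by simp
    qed
    have "(\<Sum>p\<in>index_box R. \<Sum>q\<in>index_box R. f m p * g m q * W p q) = (\<Sum>p\<in>index_box R. f m p * (\<Sum>q\<in>index_box R. g m q * W p q))"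
      by (simp add: sum_distrib_left mult.assoc)
    also have "\<dots> = (\<Sum>p\<in>index_box R. f m p * ((1 / \<beta>)\<^sup>2 * (2 * g m p)))"
      by (intro sum.cong refl arg_cong2[of _ _ _ _ "(*)"] row)
    also have "\<dots> = 2 / \<beta>\<^sup>2 * arr_ip (f m) (g m)"
      unfolding arr_ip_sum[OF R(2)[OF m]] sum_distrib_left
      by (intro sum.cong refl) (simp add: power_divide)
    finally show ?thesis .
  qed
  have "E_star \<nu> \<beta> (\<lambda>m \<omega>. obs_of f m \<omega> * obs_of g m \<omega>) = (\<integral>x. ?S x \<partial>star_measure \<nu> \<beta>)"
    unfolding E_star_def by (rule Bochner_Integration.integral_cong[OF refl expand])
  also have "\<dots> = (\<Sum>p\<in>index_box R. \<Sum>q\<in>index_box R. \<integral>x. (f (fst x) p * g (fst x) q) * mono p q (snd x) \<partial>star_measure \<nu> \<beta>)"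
    by (simp only: Bochner_Integration.integral_sum Bochner_Integration.integrable_sum term_int)
  also have "\<dots> = (\<Sum>p\<in>index_box R. \<Sum>q\<in>index_box R. \<integral>m. f m p * g m q * W p q \<partial>disorder_law \<nu>)"
    unfolding star_product(2)[OF \<beta> lc mi] mv ..
  also have "\<dots> = (\<integral>m. (\<Sum>p\<in>index_box R. \<Sum>q\<in>index_box R. f m p * g m q * W p q) \<partial>disorder_law \<nu>)"
    using integrable_mult_left[OF local_cont_integrable[OF lc]]
    by (simp only: Bochner_Integration.integral_sum Bochner_Integration.integrable_sum)
  also have "\<dots> = (\<integral>m. 2 / \<beta>\<^sup>2 * arr_ip (f m) (g m) \<partial>disorder_law \<nu>)"
    by (rule Bochner_Integration.integral_cong) (auto simp: inner)
  finally show "E_star \<nu> \<beta> (\<lambda>m \<omega>. obs_of f m \<omega> * obs_of g m \<omega>) = 2 / \<beta>\<^sup>2 * ip0 f g"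
    by (simp add: arr_ip_mean_def)
qed

end

section \<open>The diffusion coefficient in terms of arrays\<close>

context chain
begin

lemma current_arr_in: "current_arr \<in> arrays C"
  unfolding arrays_def
proof (intro CollectI conjI allI ballI exI[of _ 1])
  have "local_cont C (\<lambda>m. 0 - cond m 0)" by (intro local_cont_diff local_cont_const local_cont_cond)
  then show "local_cont C (\<lambda>m. current_arr m p)" for p
    by (cases "p = (0, 1) \<or> p = (1, 0)") (simp_all add: current_arr_def)
  show "bounded_supp 1 (current_arr m)" for m by (rule current_arr_supp)
  show "current_arr m (i, j) = current_arr m (j, i)" for m i j by (auto simp: current_arr_def)
  show "arr_trace (current_arr m) = 0" for m
    unfolding arr_trace_def by (intro infsum_0) (simp add: current_arr_def)
qed

lemma plain_off_dual:
  assumes w: "w \<in> arrays C" "\<And>m. m \<in> Omega_D C \<Longrightarrow> offd (w m) = w m" and g: "g \<in> arrays C"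
  shows "2 * ip0 w g \<le> 1 / (4 * \<gamma>) * ip0 w w + ip0 (op_N lam \<gamma> g) g"
proof -
  have "(\<integral>m. 2 * arr_ip (w m) (g m) \<partial>disorder_law \<nu>)
      \<le> (\<integral>m. 1 / (4 * \<gamma>) * arr_ip (w m) (w m) + arr_ip (op_N lam \<gamma> g m) (g m) \<partial>disorder_law \<nu>)"
  proof (rule integral_mono)
    show "integrable (disorder_law \<nu>) (\<lambda>m. 2 * arr_ip (w m) (g m))"
      by (rule integrable_mult_right[OF ip_integrable[OF w(1) g]])
    show "integrable (disorder_law \<nu>) (\<lambda>m. 1 / (4 * \<gamma>) * arr_ip (w m) (w m) + arr_ip (op_N lam \<gamma> g m) (g m))"
      by (rule Bochner_Integration.integrable_add[OF integrable_mult_right[OF ip_integrable[OF w(1) w(1)]]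
            ip_integrable[OF op_N_closed[OF g] g]])
    fix m assume "m \<in> space (disorder_law \<nu>)"
    then have m: "m \<in> Omega_D C" by simp
    show "2 * arr_ip (w m) (g m) \<le> 1 / (4 * \<gamma>) * arr_ip (w m) (w m) + arr_ip (op_N lam \<gamma> g m) (g m)"
      unfolding op_N_def using arrays_fin[OF w(1) m] arrays_fin[OF g m] w(2)[OF m]
      by (intro arr_off_dual lam_pos \<gamma>_pos)
  qed
  also have "\<dots> = 1 / (4 * \<gamma>) * ip0 w w + ip0 (op_N lam \<gamma> g) g"
    unfolding arr_ip_mean_def
    by (subst Bochner_Integration.integral_add[OF integrable_mult_right[OF ip_integrable[OF w(1) w(1)]]
            ip_integrable[OF op_N_closed[OF g] g]]) simp
  finally show ?thesis by (simp add: arr_ip_mean_def)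
qed

lemma offd_box_sum_current: "offd (box_sum n current_arr m) = box_sum n current_arr m"
proof -
  have "box_sum n current_arr m p = 0" if "fst p = snd p" for p
  proof -
    have "(\<Sum>k<n. op_T (int k) current_arr) m p = (\<Sum>k<n. op_T (int k) current_arr m p)"
      by (induction n) auto
    also have "\<dots> = 0" using that by (intro sum.neutral) (auto simp: op_T_def current_arr_def)
    finally show ?thesis by (simp add: box_sum_def)
  qed
  then show ?thesis by (auto simp: offd_def fun_eq_iff)
qed

definition current_dual :: real where
  "current_dual = sqrt (1 / (4 * \<gamma>) * sip current_arr current_arr)"

text \<open>The current is off-diagonal, and so are its translates and their sums over boxes. Hence the
spectral gap of the flips bounds its dual norm, also for the summed form.\<close>
sublocale src: dissipative_source "arrays C" sip "op_N lam \<gamma>" op_A "4 * \<gamma> + 8 * lam"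
  "sector_const lam \<gamma> C" current_arr current_dual
proof (intro dissipative_source.intro star.dissipative_axioms dissipative_source_axioms.intro current_arr_in)
  have nn: "sip current_arr current_arr \<ge> 0" by (rule star.nonneg[OF current_arr_in])
  then show "0 \<le> current_dual" using \<gamma>_pos by (simp add: current_dual_def)
  fix g assume g: "g \<in> arrays C"
  have "2 * sip current_arr g \<le> 1 / (4 * \<gamma>) * sip current_arr current_arr + 1 * sip (op_N lam \<gamma> g) g"
  proof (rule sip_ineq[OF current_arr_in current_arr_in op_N_closed[OF g] g current_arr_in g])
    fix n
    show "2 * ip0 (box_sum n current_arr) (box_sum n g)
        \<le> 1 / (4 * \<gamma>) * ip0 (box_sum n current_arr) (box_sum n current_arr)
          + 1 * ip0 (box_sum n (op_N lam \<gamma> g)) (box_sum n g)"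
      using plain_off_dual[OF box_sum_closed[OF current_arr_in] offd_box_sum_current box_sum_closed[OF g]]
      by (simp add: N_box_sum)
  qed
  also have "1 / (4 * \<gamma>) * sip current_arr current_arr = current_dual\<^sup>2"
    unfolding current_dual_def using nn \<gamma>_pos by simp
  finally show "2 * sip current_arr g \<le> current_dual\<^sup>2 + sip (op_N lam \<gamma> g) g" by simp
qed

text \<open>An observable matters on \<open>Omega_D C\<close> only, so an array does not determine it completely.\<close>
definition represents :: "obs \<Rightarrow> darr \<Rightarrow> bool" where
  "represents F f \<longleftrightarrow> f \<in> arrays C \<and> (\<forall>m\<in>Omega_D C. \<forall>\<omega>. F m \<omega> = obs_of f m \<omega>)"

lemma quad_obs_iff: "F \<in> quad_obs C \<longleftrightarrow> (\<exists>f. represents F f)"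
  using quad_obs_imp_arrays[of F C] arrays_imp_quad_obs[of _ C F] unfolding represents_def by blast

lemma represents_obs_of: "f \<in> arrays C \<Longrightarrow> represents (obs_of f) f"
  by (simp add: represents_def)

lemma represents_supp: "\<lbrakk>represents F f; m \<in> Omega_D C\<rbrakk> \<Longrightarrow> \<exists>R. bounded_supp R (f m)"
  unfolding represents_def arrays_def by blast

lemma represents_eq: "\<lbrakk>represents F f; m \<in> Omega_D C\<rbrakk> \<Longrightarrow> F m = obs_of f m"
  by (auto simp: represents_def)

lemma represents_S: "represents F f \<Longrightarrow> represents (\<lambda>m \<omega>. - gen_S lam \<gamma> F m \<omega>) (op_N lam \<gamma> f)"
proof -
  assume F: "represents F f"
  have "- gen_S lam \<gamma> F m \<omega> = obs_of (op_N lam \<gamma> f) m \<omega>" if m: "m \<in> Omega_D C" for m \<omega>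
  proof -
    obtain R where R: "bounded_supp R (f m)" using represents_supp[OF F m] by blast
    have "gen_S lam \<gamma> F m \<omega> = gen_S lam \<gamma> (obs_of f) m \<omega>"
      unfolding gen_S_def represents_eq[OF F m] ..
    then show ?thesis using gen_S_obs_of[of R f m, OF R] by simp
  qed
  then show ?thesis using F op_N_closed by (simp add: represents_def)
qed

lemma represents_A: "represents F f \<Longrightarrow> represents (gen_A F) (op_A f)"
proof -
  assume F: "represents F f"
  have "gen_A F m \<omega> = obs_of (op_A f) m \<omega>" if m: "m \<in> Omega_D C" for m \<omega>
  proof -
    obtain R where R: "bounded_supp R (f m)" using represents_supp[OF F m] by blast
    have "gen_A F m \<omega> = gen_A (obs_of f) m \<omega>"
      unfolding gen_A_def partial_omega_def represents_eq[OF F m] ..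
    then show ?thesis using gen_A_obs_of[of R f m, OF R] by simp
  qed
  then show ?thesis using F op_A_closed by (simp add: represents_def)
qed

lemma obs_of_diff:
  assumes "f \<in> arrays C" "g \<in> arrays C" "m \<in> Omega_D C"
  shows "obs_of (f - g) m \<omega> = obs_of f m \<omega> - obs_of g m \<omega>"
proof -
  obtain R where R: "bounded_supp R (f m)" "bounded_supp R (g m)"
    using common_supp[OF arrays_fin[OF assms(1,3)] arrays_fin[OF assms(2,3)]] by blast
  then have "bounded_supp R ((f - g) m)" by (simp add: bounded_supp_iff)
  then show ?thesis
    unfolding obs_of_def using R by (simp add: qform_sum sum_subtractf[symmetric] left_diff_distrib)
qed

lemma represents_diff:
  assumes F: "represents F f" and G: "represents G g"
  shows "represents (\<lambda>m \<omega>. F m \<omega> - G m \<omega>) (f - g)"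
  using assms obs_of_diff[of f g] plain.V_closed(3)[of f g] by (auto simp: represents_def)

lemma represents_current: "represents current current_arr"
  by (simp add: represents_def current_arr_in current_obs_of)

lemma star_inner_eq:
  assumes \<beta>: "\<beta> > 0" and F: "represents F f" and G: "represents G g"
  shows "star_inner \<nu> \<beta> F G = 2 / \<beta>\<^sup>2 * sip f g"
proof -
  have f: "f \<in> arrays C" and g: "g \<in> arrays C" using F G by (auto simp: represents_def)
  have "E_star \<nu> \<beta> (\<lambda>m \<omega>. F m \<omega> * translate x G m \<omega>) = 2 / \<beta>\<^sup>2 * ip0 f (op_T x g)" for x
  proof -
    have "E_star \<nu> \<beta> (\<lambda>m \<omega>. F m \<omega> * translate x G m \<omega>)
        = E_star \<nu> \<beta> (\<lambda>m \<omega>. obs_of f m \<omega> * obs_of (op_T x g) m \<omega>)"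
    proof (rule E_star_cong)
      fix m \<omega> assume m: "m \<in> Omega_D C"
      have "translate x G m \<omega> = translate x (obs_of g) m \<omega>"
        unfolding translate_def represents_eq[OF G shift_conf_Omega_D[OF m]] ..
      then show "F m \<omega> * translate x G m \<omega> = obs_of f m \<omega> * obs_of (op_T x g) m \<omega>"
        by (simp add: represents_eq[OF F m] translate_obs_of)
    qed
    also have "\<dots> = 2 / \<beta>\<^sup>2 * ip0 f (op_T x g)"
      by (rule obs_of_product(2)[OF \<beta> f op_T_closed[OF g]])
    finally show ?thesis .
  qed
  then show ?thesis unfolding star_inner_def sip_def by (simp only: infsum_cmult_right')
qed

lemma var_functional_eq:
  assumes \<beta>: "\<beta> > 0" and F: "represents F f" and G: "represents G g"
  shows "var_functional lam \<gamma> \<nu> \<beta> F G = 2 / \<beta>\<^sup>2 * src.\<Phi> f g"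
proof -
  have f: "f \<in> arrays C" and g: "g \<in> arrays C" using F G by (auto simp: represents_def)
  have "var_functional lam \<gamma> \<nu> \<beta> F G = 2 / \<beta>\<^sup>2 * sip f (op_N lam \<gamma> f)
      + 2 * (2 / \<beta>\<^sup>2 * sip (current_arr - op_A f) g) - 2 / \<beta>\<^sup>2 * sip g (op_N lam \<gamma> g)"
    unfolding var_functional_def
    by (simp only: star_inner_eq[OF \<beta> F represents_S[OF F]] star_inner_eq[OF \<beta> G represents_S[OF G]]
        star_inner_eq[OF \<beta> represents_diff[OF represents_current represents_A[OF F]] G])
  also have "\<dots> = 2 / \<beta>\<^sup>2 * src.\<Phi> f g"
    unfolding src.\<Phi>_def using star.N_sym[OF f f] star.N_sym[OF g g] by (simp add: algebra_simps)
  finally show ?thesis .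
qed

text \<open>The factor \<open>2 / \<beta>\<^sup>2\<close> of the Gaussian covariances cancels \<open>chi \<beta>\<close>, so the right-hand side is
independent of \<open>\<beta>\<close>.\<close>
lemma diffusion_coeff_eq:
  assumes \<beta>: "\<beta> > 0"
  shows "diffusion_coeff lam \<gamma> C \<nu> \<beta>
    = ereal lam + (INF f\<in>arrays C. SUP g\<in>arrays C. ereal (src.\<Phi> f g))"
proof -
  let ?K = "2 / \<beta>\<^sup>2"
  have K: "?K > 0" using \<beta> by simp
  define Y where "Y f = (SUP g\<in>arrays C. ereal (src.\<Phi> f g))" for f
  have ne: "arrays C \<noteq> {}" using current_arr_in by blast
  have sup: "(SUP G\<in>quad_obs C. ereal (var_functional lam \<gamma> \<nu> \<beta> F G)) = ereal ?K * Y f"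
    if F: "represents F f" for F f
  proof -
    have "(SUP G\<in>quad_obs C. ereal (var_functional lam \<gamma> \<nu> \<beta> F G)) = (SUP g\<in>arrays C. ereal ?K * ereal (src.\<Phi> f g))"
    proof (rule SUP_eq)
      fix G assume "G \<in> quad_obs C"
      then obtain g where g: "represents G g" using quad_obs_iff by blast
      then show "\<exists>g\<in>arrays C. ereal (var_functional lam \<gamma> \<nu> \<beta> F G) \<le> ereal ?K * ereal (src.\<Phi> f g)"
        using var_functional_eq[OF \<beta> F g] by (intro bexI[of _ g]) (auto simp: represents_def)
    next
      fix g assume "g \<in> arrays C"
      then have g: "represents (obs_of g) g" by (rule represents_obs_of)
      then show "\<exists>G\<in>quad_obs C. ereal ?K * ereal (src.\<Phi> f g) \<le> ereal (var_functional lam \<gamma> \<nu> \<beta> F G)"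
        using var_functional_eq[OF \<beta> F g] quad_obs_iff by (intro bexI[of _ "obs_of g"]) auto
    qed
    also have "\<dots> = ereal ?K * Y f"
      unfolding Y_def using K by (intro Sup_ereal_mult_left'[symmetric] ne) simp
    finally show ?thesis .
  qed
  have "(INF F\<in>quad_obs C. SUP G\<in>quad_obs C. ereal (var_functional lam \<gamma> \<nu> \<beta> F G)) = (INF f\<in>arrays C. ereal ?K * Y f)"
  proof (rule INF_eq)
    fix f assume "f \<in> arrays C"
    then have f: "represents (obs_of f) f" by (rule represents_obs_of)
    then show "\<exists>F\<in>quad_obs C. (SUP G\<in>quad_obs C. ereal (var_functional lam \<gamma> \<nu> \<beta> F G)) \<le> ereal ?K * Y f"
      using sup[OF f] quad_obs_iff by (intro bexI[of _ "obs_of f"]) auto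
  next
    fix F assume "F \<in> quad_obs C"
    then obtain f where f: "represents F f" using quad_obs_iff by blast
    then show "\<exists>f\<in>arrays C. ereal ?K * Y f \<le> (SUP G\<in>quad_obs C. ereal (var_functional lam \<gamma> \<nu> \<beta> F G))"
      using sup[OF f] by (intro bexI[of _ f]) (auto simp: represents_def)
  qed
  also have "\<dots> = Inf {ereal ?K * x |x. x \<in> Y ` arrays C}"
    by (rule arg_cong[of _ _ Inf]) auto
  also have "\<dots> = ereal ?K * (INF f\<in>arrays C. Y f)"
    by (subst ereal_Inf_cmult[OF K]) simp
  finally have "diffusion_coeff lam \<gamma> C \<nu> \<beta> = ereal lam + ereal (1 / chi \<beta>) * (ereal ?K * (INF f\<in>arrays C. Y f))"
    unfolding diffusion_coeff_def by simp
  also have "ereal (1 / chi \<beta>) * (ereal ?K * (INF f\<in>arrays C. Y f)) = ereal (1 / chi \<beta> * ?K) * (INF f\<in>arrays C. Y f)"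
    by (simp only: mult.assoc[symmetric] times_ereal.simps)
  also have "1 / chi \<beta> * ?K = 1" using \<beta> by (simp add: chi_def)
  finally show ?thesis by (simp add: Y_def one_ereal_def[symmetric])
qed

end

section \<open>Quadratic observables lie in the core of the generator\<close>

context chain
begin

lemma obs_of_sum:
  "bounded_supp R (f m) \<Longrightarrow> obs_of f m \<omega> = (\<Sum>p\<in>index_box R. f m p * (\<omega> (fst p) * \<omega> (snd p)))"
  unfolding obs_of_def by (rule qform_sum)

lemma continuous_on_conf_coord:
  "continuous_on (A \<times> (UNIV :: conf set)) (\<lambda>x. snd x i)"
  by (rule continuous_on_compose2[OF continuous_on_product_coordinates continuous_on_snd[OF continuous_on_id]]) simp

lemma continuous_on_disorder_coeff:
  assumes "local_cont C \<psi>" shows "continuous_on (Omega_D C \<times> (UNIV :: conf set)) (\<lambda>x. \<psi> (fst x))"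
  by (rule continuous_on_compose2[OF _ continuous_on_fst[OF continuous_on_id]])
     (use assms in \<open>auto simp: local_cont_def\<close>)

lemma obs_of_cyl_obs:
  assumes f: "f \<in> arrays C" shows "obs_of f \<in> cyl_obs C"
proof -
  obtain R where R: "\<And>m. m \<in> Omega_D C \<Longrightarrow> bounded_supp R (f m)"
    using f unfolding arrays_def by blast
  have lc: "local_cont C (\<lambda>m. f m p)" for p by (rule arrays_local[OF f])
  define dep where "dep p A \<longleftrightarrow> finite A \<and>
    (\<forall>m\<in>Omega_D C. \<forall>m'\<in>Omega_D C. (\<forall>x\<in>A. m x = m' x) \<longrightarrow> f m p = f m' p)" for p and A :: "int set"
  have "\<exists>A. dep p A" for p using lc[of p] unfolding local_cont_def dep_def by blast
  then obtain S where S: "\<And>p. dep p (S p)" by metis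
  have "\<exists>B. \<forall>m\<in>Omega_D C. \<bar>f m p\<bar> \<le> B" for p using local_cont_bounded[OF lc[of p]] by metis
  then obtain B where B: "\<And>p m. m \<in> Omega_D C \<Longrightarrow> \<bar>f m p\<bar> \<le> B p" by metis
  have "Omega_D C \<noteq> {}" using dis.not_empty by simp
  then have B0: "B p \<ge> 0" for p using B[of _ p] by (metis abs_ge_zero ex_in_conv order.trans)
  define A where "A = {-R..R} \<union> (\<Union>p\<in>index_box R. S p)"
  define K where "K = (\<Sum>p\<in>index_box R. 2 * B p)"
  have finA: "finite A" using S by (auto simp: A_def dep_def)
  let ?s = "\<lambda>\<omega>::conf. 1 + (\<Sum>x\<in>A. \<bar>\<omega> x\<bar>)"
  have s1: "?s \<omega> \<ge> 1" for \<omega> by (simp add: sum_nonneg)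
  have coord: "\<bar>\<omega> i\<bar> \<le> ?s \<omega>" if "i \<in> {-R..R}" for \<omega> i
    using member_le_sum[of i A "\<lambda>x. \<bar>\<omega> x\<bar>"] that finA by (auto simp: A_def)
  have pd: "partial_omega x (obs_of f) m \<omega> = dqform (f m) x \<omega>" if "m \<in> Omega_D C" for x m \<omega>
    by (rule partial_omega_obs_of[of R f m, OF R[OF that]])
  show ?thesis
    unfolding cyl_obs_def
  proof (intro CollectI exI[of _ A] conjI allI ballI impI)
    show "finite A" by (rule finA)
    show "obs_of f m \<omega> = obs_of f m' \<omega>'"
      if m: "m \<in> Omega_D C" "m' \<in> Omega_D C" and eq: "\<forall>x\<in>A. m x = m' x \<and> \<omega> x = \<omega>' x" for m m' \<omega> \<omega>'
      unfolding obs_of_sum[of R f m, OF R[OF m(1)]] obs_of_sum[of R f m', OF R[OF m(2)]]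
    proof (rule sum.cong[OF refl])
      fix p assume p: "p \<in> index_box R"
      have "\<forall>x\<in>S p. m x = m' x" using eq p unfolding A_def by blast
      then have "f m p = f m' p" using S[of p] m unfolding dep_def by blast
      moreover have "fst p \<in> A" "snd p \<in> A" using p by (auto simp: A_def abs_le_iff)
      then have "\<omega> (fst p) = \<omega>' (fst p)" "\<omega> (snd p) = \<omega>' (snd p)" using eq by blast+
      ultimately show "f m p * (\<omega> (fst p) * \<omega> (snd p)) = f m' p * (\<omega>' (fst p) * \<omega>' (snd p))" by simp
    qed
    have "continuous_on (Omega_D C \<times> UNIV) (\<lambda>x. \<Sum>p\<in>index_box R. f (fst x) p * (snd x (fst p) * snd x (snd p)))"
      by (rule continuous_on_sum, rule continuous_on_mult[OF continuous_on_disorder_coeff[OF lc]],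
          rule continuous_on_mult[OF continuous_on_conf_coord continuous_on_conf_coord])
    then show "continuous_on (Omega_D C \<times> UNIV) (\<lambda>(m, \<omega>). obs_of f m \<omega>)"
      by (rule continuous_on_cong[THEN iffD1, rotated -1]) (auto simp: obs_of_sum[of R f] R)
    show "(\<lambda>s. obs_of f m ((\<omega>)(x := s))) differentiable at (\<omega> x)" if "m \<in> Omega_D C" for m \<omega> x
      unfolding obs_of_def real_differentiable_def using qform_deriv[OF R[OF that]] by blast
    show "continuous_on (Omega_D C \<times> UNIV) (\<lambda>(m, \<omega>). partial_omega x (obs_of f) m \<omega>)" for x
    proof -
      have c0: "continuous_on (Omega_D C \<times> (UNIV :: conf set)) (\<lambda>y. if b then snd y i else 0)" for b and i :: int
        by (cases b) (simp_all add: continuous_on_conf_coord)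
      have "continuous_on (Omega_D C \<times> UNIV) (\<lambda>y. \<Sum>p\<in>index_box R. f (fst y) p *
          ((if fst p = x then snd y (snd p) else 0) + (if snd p = x then snd y (fst p) else 0)))"
        by (rule continuous_on_sum, rule continuous_on_mult[OF continuous_on_disorder_coeff[OF lc]],
            rule continuous_on_add[OF c0 c0])
      then show ?thesis
        by (rule continuous_on_cong[THEN iffD1, rotated -1]) (auto simp: pd dqform_sum[OF R] cong: if_cong)
    qed
    show "\<exists>K n. \<forall>m\<in>Omega_D C. \<forall>\<omega>. \<bar>obs_of f m \<omega>\<bar> \<le> K * ?s \<omega> ^ n \<and>
        (\<forall>x\<in>A. \<bar>partial_omega x (obs_of f) m \<omega>\<bar> \<le> K * ?s \<omega> ^ n)"
    proof (intro exI[of _ K] exI[of _ 2] ballI allI conjI)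
      fix m \<omega> assume m: "m \<in> Omega_D C"
      have cp: "\<bar>\<omega> (fst p)\<bar> \<le> ?s \<omega>" "\<bar>\<omega> (snd p)\<bar> \<le> ?s \<omega>" if "p \<in> index_box R" for p
        using that by (auto intro!: coord)
      have "\<bar>obs_of f m \<omega>\<bar> \<le> (\<Sum>p\<in>index_box R. \<bar>f m p * (\<omega> (fst p) * \<omega> (snd p))\<bar>)"
        unfolding obs_of_sum[of R f m, OF R[OF m]] by (rule sum_abs)
      also have "\<dots> \<le> (\<Sum>p\<in>index_box R. (2 * B p) * ?s \<omega> ^ 2)"
      proof (rule sum_mono)
        fix p assume p: "p \<in> index_box R"
        have "\<bar>f m p\<bar> * (\<bar>\<omega> (fst p)\<bar> * \<bar>\<omega> (snd p)\<bar>) \<le> (2 * B p) * (?s \<omega> * ?s \<omega>)"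
          using B[OF m, of p] B0[of p] cp[OF p] s1[of \<omega>] by (intro mult_mono) auto
        then show "\<bar>f m p * (\<omega> (fst p) * \<omega> (snd p))\<bar> \<le> (2 * B p) * ?s \<omega> ^ 2"
          by (simp add: abs_mult power2_eq_square)
      qed
      finally show "\<bar>obs_of f m \<omega>\<bar> \<le> K * ?s \<omega> ^ 2" by (simp add: K_def sum_distrib_right)
      fix x
      have "\<bar>partial_omega x (obs_of f) m \<omega>\<bar> \<le> (\<Sum>p\<in>index_box R. \<bar>f m p * ((if fst p = x then \<omega> (snd p) else 0) + (if snd p = x then \<omega> (fst p) else 0))\<bar>)"
        unfolding pd[OF m] dqform_sum[OF R[OF m]] by (rule sum_abs)
      also have "\<dots> \<le> (\<Sum>p\<in>index_box R. (2 * B p) * ?s \<omega> ^ 2)"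
      proof (rule sum_mono)
        fix p assume p: "p \<in> index_box R"
        let ?v = "(if fst p = x then \<omega> (snd p) else 0) + (if snd p = x then \<omega> (fst p) else 0)"
        have "\<bar>?v\<bar> \<le> 2 * ?s \<omega>" using cp[OF p] s1[of \<omega>] by (auto simp: abs_le_iff)
        also have "2 * ?s \<omega> \<le> 2 * ?s \<omega> ^ 2" by (intro mult_left_mono self_le_power s1) simp_all
        finally have "\<bar>f m p\<bar> * \<bar>?v\<bar> \<le> B p * (2 * ?s \<omega> ^ 2)"
          using B[OF m, of p] B0[of p] by (intro mult_mono) auto
        then show "\<bar>f m p * ?v\<bar> \<le> (2 * B p) * ?s \<omega> ^ 2" by (simp add: abs_mult)
      qed
      finally show "\<bar>partial_omega x (obs_of f) m \<omega>\<bar> \<le> K * ?s \<omega> ^ 2" by (simp add: K_def sum_distrib_right)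
    qed
  qed
qed

subsection \<open>Square integrable observables\<close>

abbreviation "star1 \<equiv> star_measure \<nu> 1"

lemma prob_star1: "prob_space star1" by (rule prob_star) simp

sublocale st: prob_space star1 by (rule prob_star1)

lemma norm_star_sq: "(norm_star \<nu> f)\<^sup>2 = (\<integral>p. (f (fst p) (snd p))\<^sup>2 \<partial>star1)"
  unfolding norm_star_def E_star_def by simp

lemma norm_star_nonneg [simp]: "norm_star \<nu> f \<ge> 0"
  unfolding norm_star_def E_star_def by simp

lemma L2_starI:
  "\<lbrakk>(\<lambda>p. f (fst p) (snd p)) \<in> borel_measurable star1; integrable star1 (\<lambda>p. (f (fst p) (snd p))\<^sup>2)\<rbrakk> \<Longrightarrow> f \<in> L2_star \<nu>"
  by (simp add: L2_star_def)

lemma L2_star_meas: "f \<in> L2_star \<nu> \<Longrightarrow> (\<lambda>p. f (fst p) (snd p)) \<in> borel_measurable star1"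
  by (simp add: L2_star_def)

lemma L2_star_int: "f \<in> L2_star \<nu> \<Longrightarrow> integrable star1 (\<lambda>p. (f (fst p) (snd p))\<^sup>2)"
  by (simp add: L2_star_def)

lemma L2_star_bound:
  assumes "(\<lambda>p. f (fst p) (snd p)) \<in> borel_measurable star1" "g \<in> L2_star \<nu>" "\<And>m \<omega>. \<bar>f m \<omega>\<bar> \<le> \<bar>g m \<omega>\<bar>"
  shows "f \<in> L2_star \<nu>" "norm_star \<nu> f \<le> norm_star \<nu> g"
proof -
  have le: "(f m \<omega>)\<^sup>2 \<le> (g m \<omega>)\<^sup>2" for m \<omega>
    using assms(3)[of m \<omega>] by (simp add: abs_le_square_iff)
  have int: "integrable star1 (\<lambda>p. (f (fst p) (snd p))\<^sup>2)"
    by (rule Bochner_Integration.integrable_bound[OF L2_star_int[OF assms(2)]])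
       (use assms(1) le in \<open>auto intro: borel_measurable_power\<close>)
  then show "f \<in> L2_star \<nu>" using assms(1) by (intro L2_starI)
  have "(norm_star \<nu> f)\<^sup>2 \<le> (norm_star \<nu> g)\<^sup>2"
    unfolding norm_star_sq by (rule integral_mono[OF int L2_star_int[OF assms(2)] le])
  then show "norm_star \<nu> f \<le> norm_star \<nu> g" by (rule power2_le_imp_le) simp
qed

lemma L2_star_add:
  assumes "f \<in> L2_star \<nu>" "g \<in> L2_star \<nu>" shows "(\<lambda>m \<omega>. f m \<omega> + g m \<omega>) \<in> L2_star \<nu>"
proof (rule L2_starI)
  note [measurable] = L2_star_meas[OF assms(1)] L2_star_meas[OF assms(2)]
  show "(\<lambda>p. f (fst p) (snd p) + g (fst p) (snd p)) \<in> borel_measurable star1" by measurable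
  have "integrable star1 (\<lambda>p. 2 * (f (fst p) (snd p))\<^sup>2 + 2 * (g (fst p) (snd p))\<^sup>2)"
    using L2_star_int[OF assms(1)] L2_star_int[OF assms(2)] by simp
  then show "integrable star1 (\<lambda>p. (f (fst p) (snd p) + g (fst p) (snd p))\<^sup>2)"
  proof (rule Bochner_Integration.integrable_bound)
    have "(a + b)\<^sup>2 \<le> 2 * a\<^sup>2 + 2 * b\<^sup>2" for a b :: real
      using zero_le_power2[of "a - b"] by (simp add: power2_sum power2_diff)
    then show "AE p in star1. norm ((f (fst p) (snd p) + g (fst p) (snd p))\<^sup>2)
        \<le> norm (2 * (f (fst p) (snd p))\<^sup>2 + 2 * (g (fst p) (snd p))\<^sup>2)" by simp
  qed measurable
qed

lemma L2_star_scale: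
  assumes "f \<in> L2_star \<nu>" shows "(\<lambda>m \<omega>. r * f m \<omega>) \<in> L2_star \<nu>"
proof (rule L2_starI)
  note [measurable] = L2_star_meas[OF assms]
  show "(\<lambda>p. r * f (fst p) (snd p)) \<in> borel_measurable star1" by measurable
  show "integrable star1 (\<lambda>p. (r * f (fst p) (snd p))\<^sup>2)"
    using L2_star_int[OF assms] by (simp add: power_mult_distrib)
qed

lemma L2_star_diff:
  "\<lbrakk>f \<in> L2_star \<nu>; g \<in> L2_star \<nu>\<rbrakk> \<Longrightarrow> (\<lambda>m \<omega>. f m \<omega> - g m \<omega>) \<in> L2_star \<nu>"
  using L2_star_add[OF _ L2_star_scale[of g "-1"], of f] by simp

lemma L2_star_const: "(\<lambda>m \<omega>. 1) \<in> L2_star \<nu>"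
  by (rule L2_starI) simp_all

lemma obs_of_measurable: 
  assumes "f \<in> arrays C" shows "(\<lambda>p. obs_of f (fst p) (snd p)) \<in> borel_measurable star1"
proof -
  obtain R where R: "\<And>m. m \<in> Omega_D C \<Longrightarrow> bounded_supp R (f m)"
    using assms unfolding arrays_def by blast
  have lc [measurable]: "(\<lambda>m. f m p) \<in> borel_measurable (disorder_law \<nu>)" for p
    by (rule local_cont_measurable[OF arrays_local[OF assms]])
  have [measurable]: "(\<lambda>\<omega>. \<omega> i) \<in> borel_measurable (gibbs 1)" for i
    unfolding gibbs_def by (rule measurable_compose[OF measurable_component_singleton]) simp_all
  have "(\<lambda>x. \<Sum>p\<in>index_box R. f (fst x) p * (snd x (fst p) * snd x (snd p))) \<in> borel_measurable star1"
    unfolding star_measure_def by measurable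
  then show ?thesis
    by (rule measurable_cong[THEN iffD1, rotated]) (auto simp: space_star obs_of_sum[of R f] R)
qed

lemma obs_of_L2:
  assumes "f \<in> arrays C" shows "obs_of f \<in> L2_star \<nu>" "norm_star \<nu> (obs_of f) = sqrt 2 * plain.nm f"
proof -
  show "obs_of f \<in> L2_star \<nu>"
    using obs_of_product(1)[of 1, OF _ assms assms] obs_of_measurable[OF assms]
    by (intro L2_starI) (simp_all add: power2_eq_square)
  show "norm_star \<nu> (obs_of f) = sqrt 2 * plain.nm f"
    unfolding norm_star_def plain.nm_def power2_eq_square
    using obs_of_product(2)[of 1, OF _ assms assms] by (simp add: real_sqrt_mult)
qed

lemma gen_L_obs_of:
  assumes f: "f \<in> arrays C" and m: "m \<in> Omega_D C"
  shows "gen_L lam \<gamma> (obs_of f) m \<omega> = obs_of (plain.L f) m \<omega>"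
proof -
  obtain R where R: "bounded_supp R (f m)" using f m unfolding arrays_def by blast
  show ?thesis
    unfolding gen_L_def gen_A_obs_of[of R f m, OF R] gen_S_obs_of[of R f m, OF R] plain.L_def
    by (simp add: obs_of_diff[OF op_A_closed[OF f] op_N_closed[OF f] m])
qed

end

section \<open>Correlations of the process\<close>

text \<open>A joint law is determined by its values on rectangles, so a conditional law given \<open>Z\<close>, known
event by event, already disintegrates the law of the pair.\<close>
lemma joint_law_eq_bind:
  assumes prob: "prob_space M" and Z: "Z \<in> M \<rightarrow>\<^sub>M N" and X: "X \<in> M \<rightarrow>\<^sub>M B"
    and \<kappa>: "\<kappa> \<in> N \<rightarrow>\<^sub>M prob_algebra B"
    and rect: "\<And>a b. \<lbrakk>a \<in> sets N; b \<in> sets B\<rbrakk> \<Longrightarrow>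
      emeasure M {\<xi> \<in> space M. Z \<xi> \<in> a \<and> X \<xi> \<in> b} = (\<integral>\<^sup>+\<xi>. indicator a (Z \<xi>) * emeasure (\<kappa> (Z \<xi>)) b \<partial>M)"
  shows "distr M (N \<Otimes>\<^sub>M B) (\<lambda>\<xi>. (Z \<xi>, X \<xi>)) = distr M N Z \<bind> (\<lambda>z. distr (\<kappa> z) (N \<Otimes>\<^sub>M B) (Pair z))"
    (is "?l = ?r")
proof -
  interpret prob_space M by (rule prob)
  note [measurable] = Z X
  have \<kappa>s [measurable]: "\<kappa> \<in> N \<rightarrow>\<^sub>M subprob_algebra B" by (rule measurable_prob_algebraD[OF \<kappa>])
  have kern: "(\<lambda>z. distr (\<kappa> z) (N \<Otimes>\<^sub>M B) (Pair z)) \<in> N \<rightarrow>\<^sub>M subprob_algebra (N \<Otimes>\<^sub>M B)"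
    by (rule measurable_distr2[OF _ \<kappa>s]) simp
  have ne: "space M \<noteq> {}" by (rule not_empty)
  have neN: "space (distr M N Z) \<noteq> {}" using ne measurable_space[OF Z] by auto
  have kern': "(\<lambda>z. distr (\<kappa> z) (N \<Otimes>\<^sub>M B) (Pair z)) \<in> distr M N Z \<rightarrow>\<^sub>M subprob_algebra (N \<Otimes>\<^sub>M B)"
    using kern by simp
  have sets_r: "sets ?r = sets (N \<Otimes>\<^sub>M B)"
    by (rule sets_bind[OF sets_kernel[OF kern'] neN]) simp
  show ?thesis
  proof (rule measure_eqI_generator_eq[OF Int_stable_pair_measure_generator[of N B] pair_measure_closed])
    show "sets ?l = sigma_sets (space N \<times> space B) {a \<times> b |a b. a \<in> sets N \<and> b \<in> sets B}"
      by (simp add: sets_pair_measure)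
    show "sets ?r = sigma_sets (space N \<times> space B) {a \<times> b |a b. a \<in> sets N \<and> b \<in> sets B}"
      using sets_r by (simp add: sets_pair_measure)
    show "range (\<lambda>i::nat. space N \<times> space B) \<subseteq> {a \<times> b |a b. a \<in> sets N \<and> b \<in> sets B}" by auto
    show "(\<Union>i::nat. space N \<times> space B) = space N \<times> space B" by simp
    show "emeasure ?l (space N \<times> space B) \<noteq> \<infinity>" for i :: nat
    proof -
      interpret l: prob_space ?l by (rule prob_space_distr) simp
      show ?thesis by simp
    qed
    fix R assume "R \<in> {a \<times> b |a b. a \<in> sets N \<and> b \<in> sets B}"
    then obtain a b where R: "R = a \<times> b" and a[measurable]: "a \<in> sets N" and b[measurable]: "b \<in> sets B" by blast
    have Rs: "R \<in> sets (N \<Otimes>\<^sub>M B)" using R by simp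
    have "emeasure ?l R = emeasure M {\<xi> \<in> space M. Z \<xi> \<in> a \<and> X \<xi> \<in> b}"
      unfolding R by (subst emeasure_distr) (auto intro!: arg_cong[of _ _ "emeasure M"])
    also have "\<dots> = (\<integral>\<^sup>+\<xi>. indicator a (Z \<xi>) * emeasure (\<kappa> (Z \<xi>)) b \<partial>M)" by (rule rect[OF a b])
    also have "\<dots> = (\<integral>\<^sup>+z. indicator a z * emeasure (\<kappa> z) b \<partial>distr M N Z)"
      by (subst nn_integral_distr) simp_all
    also have "\<dots> = (\<integral>\<^sup>+z. emeasure (distr (\<kappa> z) (N \<Otimes>\<^sub>M B) (Pair z)) R \<partial>distr M N Z)"
    proof (rule nn_integral_cong)
      fix z assume "z \<in> space (distr M N Z)"
      then have z: "z \<in> space N" by simp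
      have sk: "sets (\<kappa> z) = sets B" by (rule sets_kernel[OF \<kappa>s z])
      then have spk: "space (\<kappa> z) = space B" by (rule sets_eq_imp_space_eq)
      have "Pair z \<in> \<kappa> z \<rightarrow>\<^sub>M N \<Otimes>\<^sub>M B" using z measurable_Pair1'[OF z, of B] measurable_cong_sets[OF sk refl] by blast
      then have "emeasure (distr (\<kappa> z) (N \<Otimes>\<^sub>M B) (Pair z)) R = emeasure (\<kappa> z) (Pair z -` R \<inter> space (\<kappa> z))"
        by (rule emeasure_distr[OF _ Rs])
      also have "Pair z -` R \<inter> space (\<kappa> z) = (if z \<in> a then b else {})"
        unfolding R spk using sets.sets_into_space[OF b] by auto
      finally show "indicator a z * emeasure (\<kappa> z) b = emeasure (distr (\<kappa> z) (N \<Otimes>\<^sub>M B) (Pair z)) R" by simp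
    qed
    also have "\<dots> = emeasure ?r R" by (rule emeasure_bind[OF neN kern' Rs, symmetric])
    finally show "emeasure ?l R = emeasure ?r R" .
  qed
qed

locale chain_process = chain lam \<gamma> C \<nu>
  for lam \<gamma> C :: real and \<nu> :: "real measure" +
  fixes M :: "'a measure" and mm :: "'a \<Rightarrow> conf" and W :: "real \<Rightarrow> 'a \<Rightarrow> conf" and K :: kernel
  assumes prob_M: "prob_space M"
    and mm_meas [measurable]: "mm \<in> M \<rightarrow>\<^sub>M disorder_law \<nu>"
    and W_meas: "t \<ge> 0 \<Longrightarrow> W t \<in> M \<rightarrow>\<^sub>M conf_space"
    and law0: "distr M (star_measure \<nu> 1) (\<lambda>\<xi>. (mm \<xi>, W 0 \<xi>)) = star_measure \<nu> 1"
    and gen: "generated_by_L lam \<gamma> C \<nu> K"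
    and markov: "\<lbrakk>0 \<le> s; s \<le> t; B \<in> sets conf_space\<rbrakk> \<Longrightarrow>
       AE \<xi> in M. real_cond_exp M (past M \<nu> mm W s) (indicator {\<zeta> \<in> space M. W t \<zeta> \<in> B}) \<xi>
         = measure (K (mm \<xi>) (t - s) (W s \<xi>)) B"
begin

sublocale P: prob_space M by (rule prob_M)

abbreviation "dis_conf \<equiv> disorder_law \<nu> \<Otimes>\<^sub>M conf_space"
abbreviation "past_space \<equiv> dis_conf \<Otimes>\<^sub>M conf_space"

lemma space_conf [simp]: "space conf_space = UNIV"
  by (simp add: conf_space_def space_PiM)

lemma sets_star1: "sets star1 = sets dis_conf"
  unfolding star_measure_def gibbs_def conf_space_def
  by (intro sets_pair_measure_cong sets_PiM_cong) auto

lemma star1_measurable_eq: "star1 \<rightarrow>\<^sub>M A = dis_conf \<rightarrow>\<^sub>M A"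
  by (rule measurable_cong_sets[OF sets_star1 refl])

lemma start_meas: "(\<lambda>\<xi>. (mm \<xi>, W 0 \<xi>)) \<in> M \<rightarrow>\<^sub>M star1"
  unfolding measurable_cong_sets[OF refl sets_star1] using W_meas[of 0] by simp

lemma mm_Omega: "\<xi> \<in> space M \<Longrightarrow> mm \<xi> \<in> Omega_D C"
  using measurable_space[OF mm_meas] by simp

lemma K_meas: "t \<ge> 0 \<Longrightarrow> (\<lambda>p. K (fst p) t (snd p)) \<in> dis_conf \<rightarrow>\<^sub>M prob_algebra conf_space"
  using gen unfolding generated_by_L_def transition_function_def by blast

lemma K_prob:
  assumes "t \<ge> 0" "m \<in> Omega_D C"
  shows "prob_space (K m t \<omega>)" "sets (K m t \<omega>) = sets conf_space"
  using measurable_space[OF K_meas[OF assms(1)], of "(m, \<omega>)"] assms(2)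
  by (auto simp: space_pair_measure space_prob_algebra)

subsection \<open>The Markov property for integrals\<close>

text \<open>The part of the past on which the correlations with time \<open>0\<close> depend.\<close>
definition upto :: "real \<Rightarrow> 'a \<Rightarrow> (conf \<times> conf) \<times> conf" where
  "upto s \<xi> = ((mm \<xi>, W 0 \<xi>), W s \<xi>)"

lemma past_map_meas:
  "(\<lambda>\<xi>. (mm \<xi>, \<lambda>u\<in>{0..s}. W u \<xi>)) \<in> M \<rightarrow>\<^sub>M disorder_law \<nu> \<Otimes>\<^sub>M (\<Pi>\<^sub>M u\<in>{0..s}. conf_space)"
  by (intro measurable_Pair mm_meas measurable_restrict W_meas) simp

lemma past_map_space:
  "(\<lambda>\<xi>. (mm \<xi>, \<lambda>u\<in>{0..s}. W u \<xi>)) \<in> space M \<rightarrow> space (disorder_law \<nu> \<Otimes>\<^sub>M (\<Pi>\<^sub>M u\<in>{0..s}. conf_space))"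
  using measurable_space[OF past_map_meas] by blast

lemma subalgebra_past: "subalgebra M (past M \<nu> mm W s)"
  unfolding subalgebra_def past_def sets_vimage_algebra2[OF past_map_space]
  using measurable_sets[OF past_map_meas] by auto

lemma upto_past_meas:
  assumes "s \<ge> 0" shows "upto s \<in> past M \<nu> mm W s \<rightarrow>\<^sub>M past_space"
proof -
  have "(\<lambda>(m, w). ((m, w 0), w s)) \<in> disorder_law \<nu> \<Otimes>\<^sub>M (\<Pi>\<^sub>M u\<in>{0..s}. conf_space) \<rightarrow>\<^sub>M past_space"
    unfolding case_prod_unfold
    by (intro measurable_Pair measurable_fst measurable_compose[OF measurable_snd measurable_component_singleton])
       (use assms in auto)
  from measurable_compose[OF measurable_vimage_algebra1[OF past_map_space] this]
  show ?thesis using assms by (simp add: past_def upto_def[abs_def])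
qed

lemma upto_meas: "s \<ge> 0 \<Longrightarrow> upto s \<in> M \<rightarrow>\<^sub>M past_space"
  by (rule measurable_from_subalg[OF subalgebra_past upto_past_meas])

lemma kernel_meas:
  assumes "t \<ge> 0"
  shows "(\<lambda>z. K (fst (fst z)) t (snd z)) \<in> past_space \<rightarrow>\<^sub>M prob_algebra conf_space"
  using measurable_compose[OF _ K_meas[OF assms], of "\<lambda>z. (fst (fst z), snd z)" past_space] by simp

lemma joint_law:
  assumes s: "0 \<le> s" and h: "0 \<le> h"
  shows "distr M (past_space \<Otimes>\<^sub>M conf_space) (\<lambda>\<xi>. (upto s \<xi>, W (s + h) \<xi>))
    = distr M past_space (upto s) \<bind>
      (\<lambda>z. distr (K (fst (fst z)) h (snd z)) (past_space \<Otimes>\<^sub>M conf_space) (Pair z))"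
proof (rule joint_law_eq_bind[OF prob_M upto_meas[OF s] W_meas kernel_meas[OF h]])
  show "0 \<le> s + h" using s h by simp
  fix a b assume a: "a \<in> sets past_space" and b: "b \<in> sets conf_space"
  interpret sub: finite_measure_subalgebra M "past M \<nu> mm W s"
    by unfold_locales (rule subalgebra_past)
  have W_sh: "W (s + h) \<in> M \<rightarrow>\<^sub>M conf_space" using s h by (intro W_meas) simp
  let ?E = "{\<zeta> \<in> space M. W (s + h) \<zeta> \<in> b}"
  let ?ia = "\<lambda>\<xi>. indicator a (upto s \<xi>) :: real"
  have E: "?E \<in> sets M" using measurable_sets[OF W_sh b] by (simp add: vimage_def Int_def conj_commute)
  have ia: "?ia \<in> borel_measurable (past M \<nu> mm W s)"
    by (rule measurable_compose[OF upto_past_meas[OF s] borel_measurable_indicator[OF a]])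
  have iaM: "?ia \<in> borel_measurable M" by (rule measurable_from_subalg[OF subalgebra_past ia])
  have iE: "(indicator ?E :: 'a \<Rightarrow> real) \<in> borel_measurable M" by (rule borel_measurable_indicator[OF E])
  have int: "integrable M (\<lambda>\<xi>. ?ia \<xi> * indicator ?E \<xi>)"
    by (rule P.integrable_const_bound[of _ 1, OF _ borel_measurable_times[OF iaM iE]])
       (auto simp: indicator_def)
  have meas_k: "(\<lambda>\<xi>. measure (K (mm \<xi>) h (W s \<xi>)) b) \<in> borel_measurable M"
    using measurable_compose[OF upto_meas[OF s] measurable_compose[OF kernel_meas[OF h] measurable_measure_prob_algebra[OF b]]]
    by (simp add: upto_def)
  have "emeasure M {\<xi> \<in> space M. upto s \<xi> \<in> a \<and> W (s + h) \<xi> \<in> b} = (\<integral>\<^sup>+\<xi>. ennreal (?ia \<xi> * indicator ?E \<xi>) \<partial>M)"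
  proof -
    have set: "{\<xi> \<in> space M. upto s \<xi> \<in> a \<and> W (s + h) \<xi> \<in> b} \<in> sets M"
    proof -
      have "{\<xi> \<in> space M. upto s \<xi> \<in> a} \<in> sets M"
        using measurable_sets[OF upto_meas[OF s] a] by (simp add: vimage_def Int_def conj_commute)
      then have "{\<xi> \<in> space M. upto s \<xi> \<in> a} \<inter> ?E \<in> sets M" using E by blast
      also have "{\<xi> \<in> space M. upto s \<xi> \<in> a} \<inter> ?E = {\<xi> \<in> space M. upto s \<xi> \<in> a \<and> W (s + h) \<xi> \<in> b}" by auto
      finally show ?thesis .
    qed
    show ?thesis
      by (subst nn_integral_indicator[OF set, symmetric], rule nn_integral_cong) (auto simp: indicator_def)
  qed
  also have "\<dots> = ennreal (\<integral>\<xi>. ?ia \<xi> * indicator ?E \<xi> \<partial>M)"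
    by (rule nn_integral_eq_integral[OF int]) simp
  also have "(\<integral>\<xi>. ?ia \<xi> * indicator ?E \<xi> \<partial>M) = (\<integral>\<xi>. ?ia \<xi> * real_cond_exp M (past M \<nu> mm W s) (indicator ?E) \<xi> \<partial>M)"
    by (rule sub.real_cond_exp_intg(2)[OF int ia iE, symmetric])
  also have "\<dots> = (\<integral>\<xi>. ?ia \<xi> * measure (K (mm \<xi>) h (W s \<xi>)) b \<partial>M)"
  proof (rule integral_cong_AE)
    show "(\<lambda>\<xi>. ?ia \<xi> * real_cond_exp M (past M \<nu> mm W s) (indicator ?E) \<xi>) \<in> borel_measurable M"
      using iaM by (intro borel_measurable_times borel_measurable_cond_exp2)
    show "(\<lambda>\<xi>. ?ia \<xi> * measure (K (mm \<xi>) h (W s \<xi>)) b) \<in> borel_measurable M"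
      by (rule borel_measurable_times[OF iaM meas_k])
    have "AE \<xi> in M. real_cond_exp M (past M \<nu> mm W s) (indicator ?E) \<xi> = measure (K (mm \<xi>) (s + h - s) (W s \<xi>)) b"
      by (rule markov) (use s h b in auto)
    then show "AE \<xi> in M. ?ia \<xi> * real_cond_exp M (past M \<nu> mm W s) (indicator ?E) \<xi>
        = ?ia \<xi> * measure (K (mm \<xi>) h (W s \<xi>)) b" by eventually_elim simp
  qed
  also have "ennreal \<dots> = (\<integral>\<^sup>+\<xi>. ennreal (?ia \<xi> * measure (K (mm \<xi>) h (W s \<xi>)) b) \<partial>M)"
  proof (rule nn_integral_eq_integral[symmetric])
    show "integrable M (\<lambda>\<xi>. ?ia \<xi> * measure (K (mm \<xi>) h (W s \<xi>)) b)"
    proof (rule P.integrable_const_bound[of _ 1])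
      show "AE \<xi> in M. norm (?ia \<xi> * measure (K (mm \<xi>) h (W s \<xi>)) b) \<le> 1"
        using prob_space.prob_le_1[OF K_prob(1)[OF h mm_Omega]]
        by (intro AE_I2) (auto simp: indicator_def)
    qed (rule borel_measurable_times[OF iaM meas_k])
  qed simp
  also have "\<dots> = (\<integral>\<^sup>+\<xi>. indicator a (upto s \<xi>) * emeasure (K (fst (fst (upto s \<xi>))) h (snd (upto s \<xi>))) b \<partial>M)"
  proof (rule nn_integral_cong)
    fix \<xi> assume "\<xi> \<in> space M"
    then interpret k: prob_space "K (mm \<xi>) h (W s \<xi>)" by (intro K_prob[OF h] mm_Omega)
    show "ennreal (?ia \<xi> * measure (K (mm \<xi>) h (W s \<xi>)) b)
        = indicator a (upto s \<xi>) * emeasure (K (fst (fst (upto s \<xi>))) h (snd (upto s \<xi>))) b"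
      by (simp add: upto_def k.emeasure_eq_measure indicator_def)
  qed
  finally show "emeasure M {\<xi> \<in> space M. upto s \<xi> \<in> a \<and> W (s + h) \<xi> \<in> b}
      = (\<integral>\<^sup>+\<xi>. indicator a (upto s \<xi>) * emeasure (K (fst (fst (upto s \<xi>))) h (snd (upto s \<xi>))) b \<partial>M)" .
qed

lemma markov_nn:
  assumes s: "0 \<le> s" and h: "0 \<le> h" and H: "H \<in> borel_measurable (past_space \<Otimes>\<^sub>M conf_space)"
  shows "(\<integral>\<^sup>+\<xi>. H (upto s \<xi>, W (s + h) \<xi>) \<partial>M) = (\<integral>\<^sup>+\<xi>. (\<integral>\<^sup>+\<omega>. H (upto s \<xi>, \<omega>) \<partial>K (mm \<xi>) h (W s \<xi>)) \<partial>M)"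
    and "(\<lambda>\<xi>. \<integral>\<^sup>+\<omega>. H (upto s \<xi>, \<omega>) \<partial>K (mm \<xi>) h (W s \<xi>)) \<in> borel_measurable M"
proof -
  have W_sh: "W (s + h) \<in> M \<rightarrow>\<^sub>M conf_space" using s h by (intro W_meas) simp
  have ks: "(\<lambda>z. K (fst (fst z)) h (snd z)) \<in> past_space \<rightarrow>\<^sub>M subprob_algebra conf_space"
    by (rule measurable_prob_algebraD[OF kernel_meas[OF h]])
  have kern: "(\<lambda>z. distr (K (fst (fst z)) h (snd z)) (past_space \<Otimes>\<^sub>M conf_space) (Pair z))
      \<in> past_space \<rightarrow>\<^sub>M subprob_algebra (past_space \<Otimes>\<^sub>M conf_space)"
    by (rule measurable_distr2[OF _ ks]) simp
  have inner_meas: "(\<lambda>z. \<integral>\<^sup>+\<omega>. H (z, \<omega>) \<partial>K (fst (fst z)) h (snd z)) \<in> borel_measurable past_space"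
    by (rule nn_integral_measurable_subprob_algebra2[OF _ ks]) (use H in simp)
  show "(\<lambda>\<xi>. \<integral>\<^sup>+\<omega>. H (upto s \<xi>, \<omega>) \<partial>K (mm \<xi>) h (W s \<xi>)) \<in> borel_measurable M"
    using measurable_compose[OF upto_meas[OF s] inner_meas] by (simp add: upto_def)
  have "(\<integral>\<^sup>+\<xi>. H (upto s \<xi>, W (s + h) \<xi>) \<partial>M)
      = (\<integral>\<^sup>+x. H x \<partial>distr M (past_space \<Otimes>\<^sub>M conf_space) (\<lambda>\<xi>. (upto s \<xi>, W (s + h) \<xi>)))"
    using H by (subst nn_integral_distr) (auto intro: measurable_Pair upto_meas s W_sh)
  also have "\<dots> = (\<integral>\<^sup>+z. \<integral>\<^sup>+x. H x \<partial>distr (K (fst (fst z)) h (snd z)) (past_space \<Otimes>\<^sub>M conf_space) (Pair z) \<partial>distr M past_space (upto s))"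
    unfolding joint_law[OF s h] by (rule nn_integral_bind[OF H]) (use kern in simp)
  also have "\<dots> = (\<integral>\<^sup>+z. \<integral>\<^sup>+\<omega>. H (z, \<omega>) \<partial>K (fst (fst z)) h (snd z) \<partial>distr M past_space (upto s))"
  proof (rule nn_integral_cong)
    fix z assume "z \<in> space (distr M past_space (upto s))"
    then have z: "z \<in> space past_space" by simp
    have "Pair z \<in> K (fst (fst z)) h (snd z) \<rightarrow>\<^sub>M past_space \<Otimes>\<^sub>M conf_space"
      using measurable_Pair1'[OF z, of conf_space] measurable_cong_sets[OF sets_kernel[OF ks z] refl] by blast
    then show "(\<integral>\<^sup>+x. H x \<partial>distr (K (fst (fst z)) h (snd z)) (past_space \<Otimes>\<^sub>M conf_space) (Pair z))
        = (\<integral>\<^sup>+\<omega>. H (z, \<omega>) \<partial>K (fst (fst z)) h (snd z))"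
      by (rule nn_integral_distr) (use H in simp)
  qed
  also have "\<dots> = (\<integral>\<^sup>+\<xi>. (\<integral>\<^sup>+\<omega>. H (upto s \<xi>, \<omega>) \<partial>K (mm \<xi>) h (W s \<xi>)) \<partial>M)"
    by (subst nn_integral_distr[OF upto_meas[OF s]]) (simp_all add: inner_meas upto_def)
  finally show "(\<integral>\<^sup>+\<xi>. H (upto s \<xi>, W (s + h) \<xi>) \<partial>M) = \<dots>" .
qed

text \<open>The inner integral has the default value \<open>0\<close> where it diverges, but by the Markov property for
the positive and negative parts this happens on a null set only.\<close>
lemma markov_integral:
  fixes H :: "((conf \<times> conf) \<times> conf) \<times> conf \<Rightarrow> real"
  assumes s: "0 \<le> s" and h: "0 \<le> h" and H: "H \<in> borel_measurable (past_space \<Otimes>\<^sub>M conf_space)"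
    and int: "integrable M (\<lambda>\<xi>. H (upto s \<xi>, W (s + h) \<xi>))"
  shows "(\<integral>\<xi>. H (upto s \<xi>, W (s + h) \<xi>) \<partial>M) = (\<integral>\<xi>. (\<integral>\<omega>. H (upto s \<xi>, \<omega>) \<partial>K (mm \<xi>) h (W s \<xi>)) \<partial>M)"
proof -
  let ?X = "\<lambda>\<xi>. H (upto s \<xi>, W (s + h) \<xi>)"
  define a where "a \<xi> = (\<integral>\<^sup>+\<omega>. ennreal (H (upto s \<xi>, \<omega>)) \<partial>K (mm \<xi>) h (W s \<xi>))" for \<xi>
  define b where "b \<xi> = (\<integral>\<^sup>+\<omega>. ennreal (- H (upto s \<xi>, \<omega>)) \<partial>K (mm \<xi>) h (W s \<xi>))" for \<xi>
  have Hp: "(\<lambda>x. ennreal (H x)) \<in> borel_measurable (past_space \<Otimes>\<^sub>M conf_space)"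
    and Hm: "(\<lambda>x. ennreal (- H x)) \<in> borel_measurable (past_space \<Otimes>\<^sub>M conf_space)"
    using H by measurable
  have am: "a \<in> borel_measurable M" and bm: "b \<in> borel_measurable M"
    unfolding a_def[abs_def] b_def[abs_def] by (rule markov_nn(2)[OF s h Hp], rule markov_nn(2)[OF s h Hm])
  have ai: "(\<integral>\<^sup>+\<xi>. ennreal (?X \<xi>) \<partial>M) = (\<integral>\<^sup>+\<xi>. a \<xi> \<partial>M)" and bi: "(\<integral>\<^sup>+\<xi>. ennreal (- ?X \<xi>) \<partial>M) = (\<integral>\<^sup>+\<xi>. b \<xi> \<partial>M)"
    unfolding a_def b_def by (rule markov_nn(1)[OF s h Hp], rule markov_nn(1)[OF s h Hm])
  have fin: "(\<integral>\<^sup>+\<xi>. a \<xi> \<partial>M) \<noteq> \<infinity>" "(\<integral>\<^sup>+\<xi>. b \<xi> \<partial>M) \<noteq> \<infinity>"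
    using int unfolding ai[symmetric] bi[symmetric] real_integrable_def by auto
  have afin: "AE \<xi> in M. a \<xi> \<noteq> \<infinity>" and bfin: "AE \<xi> in M. b \<xi> \<noteq> \<infinity>"
    by (rule nn_integral_PInf_AE[OF am fin(1)], rule nn_integral_PInf_AE[OF bm fin(2)])
  have inner: "(\<integral>\<omega>. H (upto s \<xi>, \<omega>) \<partial>K (mm \<xi>) h (W s \<xi>))
      = (if a \<xi> = \<infinity> \<or> b \<xi> = \<infinity> then 0 else enn2real (a \<xi>) - enn2real (b \<xi>))"
    if \<xi>: "\<xi> \<in> space M" for \<xi>
  proof -
    have "(\<lambda>\<omega>. H (upto s \<xi>, \<omega>)) \<in> borel_measurable conf_space"
      using measurable_compose[OF measurable_Pair1'[OF measurable_space[OF upto_meas[OF s] \<xi>]] H] .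
    then have "(\<lambda>\<omega>. H (upto s \<xi>, \<omega>)) \<in> borel_measurable (K (mm \<xi>) h (W s \<xi>))"
      using measurable_cong_sets[OF K_prob(2)[OF h mm_Omega[OF \<xi>]] refl] by blast
    then have "integrable (K (mm \<xi>) h (W s \<xi>)) (\<lambda>\<omega>. H (upto s \<xi>, \<omega>)) \<longleftrightarrow> \<not> (a \<xi> = \<infinity> \<or> b \<xi> = \<infinity>)"
      unfolding real_integrable_def a_def b_def by simp
    then show ?thesis
      using real_lebesgue_integral_def[of "K (mm \<xi>) h (W s \<xi>)" "\<lambda>\<omega>. H (upto s \<xi>, \<omega>)"]
        not_integrable_integral_eq[of "K (mm \<xi>) h (W s \<xi>)" "\<lambda>\<omega>. H (upto s \<xi>, \<omega>)"]
      unfolding a_def[symmetric] b_def[symmetric] by auto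
  qed
  have eint: "integrable M (\<lambda>\<xi>. enn2real (c \<xi>)) \<and> (\<integral>\<xi>. enn2real (c \<xi>) \<partial>M) = enn2real (\<integral>\<^sup>+\<xi>. c \<xi> \<partial>M)"
    if c: "c \<in> borel_measurable M" "(\<integral>\<^sup>+\<xi>. c \<xi> \<partial>M) \<noteq> \<infinity>" for c :: "'a \<Rightarrow> ennreal"
  proof -
    have "(\<integral>\<^sup>+\<xi>. ennreal (enn2real (c \<xi>)) \<partial>M) = (\<integral>\<^sup>+\<xi>. c \<xi> \<partial>M)"
      using nn_integral_PInf_AE[OF c]
      by (intro nn_integral_cong_AE) (auto simp: less_top)
    moreover have m: "(\<lambda>\<xi>. enn2real (c \<xi>)) \<in> borel_measurable M" using c(1) by measurable
    ultimately show ?thesis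
      using integral_eq_nn_integral[OF m] integrableI_nonneg[OF m] c(2) by (auto simp: less_top)
  qed
  have "(\<integral>\<xi>. ?X \<xi> \<partial>M) = enn2real (\<integral>\<^sup>+\<xi>. a \<xi> \<partial>M) - enn2real (\<integral>\<^sup>+\<xi>. b \<xi> \<partial>M)"
    unfolding real_lebesgue_integral_def[OF int] ai bi ..
  also have "\<dots> = (\<integral>\<xi>. enn2real (a \<xi>) - enn2real (b \<xi>) \<partial>M)"
    using eint[OF am fin(1)] eint[OF bm fin(2)] by (simp add: Bochner_Integration.integral_diff)
  also have "\<dots> = (\<integral>\<xi>. (\<integral>\<omega>. H (upto s \<xi>, \<omega>) \<partial>K (mm \<xi>) h (W s \<xi>)) \<partial>M)"
  proof (rule integral_cong_AE)
    show "(\<lambda>\<xi>. enn2real (a \<xi>) - enn2real (b \<xi>)) \<in> borel_measurable M" using am bm by measurable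
    have "(\<lambda>\<xi>. if a \<xi> = \<infinity> \<or> b \<xi> = \<infinity> then 0 else enn2real (a \<xi>) - enn2real (b \<xi>)) \<in> borel_measurable M"
      using am bm by measurable
    then show "(\<lambda>\<xi>. \<integral>\<omega>. H (upto s \<xi>, \<omega>) \<partial>K (mm \<xi>) h (W s \<xi>)) \<in> borel_measurable M"
      by (rule measurable_cong[THEN iffD2, rotated]) (rule inner)
    show "AE \<xi> in M. enn2real (a \<xi>) - enn2real (b \<xi>) = (\<integral>\<omega>. H (upto s \<xi>, \<omega>) \<partial>K (mm \<xi>) h (W s \<xi>))"
      using afin bfin AE_space by eventually_elim (simp add: inner)
  qed
  finally show ?thesis .
qed

end

subsection \<open>Correlations are controlled by the contraction semigroup\<close>

text \<open>The Markov property only controls increments forward in time. For the derivative from the left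
the increment starts at \<open>t - h\<close>, and the modulus of continuity \<open>s\<close> of \<open>v\<close> compensates for the
different base point.\<close>
lemma one_sided_increments_imp_deriv:
  fixes u v r s :: "real \<Rightarrow> real"
  assumes inc: "\<And>t h. \<lbrakk>t \<ge> 0; h > 0\<rbrakk> \<Longrightarrow> \<bar>u (t + h) - u t - h * v t\<bar> \<le> h * r h"
    and vc: "\<And>t h. \<lbrakk>t \<ge> 0; h > 0\<rbrakk> \<Longrightarrow> \<bar>v (t + h) - v t\<bar> \<le> s h"
    and r: "(r \<longlongrightarrow> 0) (at_right 0)" and s: "(s \<longlongrightarrow> 0) (at_right 0)"
  shows "t > 0 \<Longrightarrow> (u has_real_derivative v t) (at t)"
    and "continuous_on {0..T} u"
proof -
  have abs_lim: "filterlim abs (at_right 0) (at (0::real))"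
    unfolding filterlim_at by (auto intro!: tendsto_eq_intros simp: eventually_at_filter)
  have lim: "((\<lambda>h. r \<bar>h\<bar> + s \<bar>h\<bar>) \<longlongrightarrow> 0 + 0) (at 0)"
    by (intro tendsto_add filterlim_compose[OF r abs_lim] filterlim_compose[OF s abs_lim])
  have der: "(u has_real_derivative v t) (at t)" if t: "t > 0" for t
    unfolding DERIV_def
  proof (rule LIM_zero_cancel, rule Lim_null_comparison)
    show "((\<lambda>h. r \<bar>h\<bar> + s \<bar>h\<bar>) \<longlongrightarrow> 0) (at 0)" using lim by simp
    have "\<forall>\<^sub>F h in at 0. h \<noteq> 0 \<and> \<bar>h\<bar> < t"
      using t unfolding eventually_at by (intro exI[of _ t]) (auto simp: dist_real_def)
    then show "\<forall>\<^sub>F h in at 0. norm ((u (t + h) - u t) / h - v t) \<le> r \<bar>h\<bar> + s \<bar>h\<bar>"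
    proof eventually_elim
      case (elim h)
      show ?case
      proof (cases "h > 0")
        case True
        have "\<bar>(u (t + h) - u t) / h - v t\<bar> = \<bar>u (t + h) - u t - h * v t\<bar> / h"
          using True by (simp add: field_simps abs_divide[symmetric] del: abs_divide)
            (simp add: abs_if divide_simps)
        also have "\<dots> \<le> r h" using inc[of t h] t True by (simp add: divide_le_eq mult.commute)
        finally have "\<bar>(u (t + h) - u t) / h - v t\<bar> \<le> r h" .
        moreover have "0 \<le> s h" using vc[of t h] t True by (smt (verit) abs_ge_zero)
        ultimately show ?thesis using True by simp
      next
        case False
        define k where "k = - h"
        have k: "k > 0" "t - k \<ge> 0" using False elim by (auto simp: k_def)
        have "\<bar>(u (t + h) - u t) / h - v (t - k)\<bar> = \<bar>u (t - k + k) - u (t - k) - k * v (t - k)\<bar> / k"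
        proof -
          have "(u (t + h) - u t) / h - v (t - k) = (u (t - k + k) - u (t - k) - k * v (t - k)) / k"
            using k by (simp add: k_def divide_simps)
          then show ?thesis using k by (simp add: abs_divide)
        qed
        also have "\<dots> \<le> r k" using inc[of "t - k" k] k by (simp add: divide_le_eq mult.commute)
        finally have "\<bar>(u (t + h) - u t) / h - v (t - k)\<bar> \<le> r k" .
        moreover have "\<bar>v t - v (t - k)\<bar> \<le> s k" using vc[of "t - k" k] k by simp
        moreover have "\<bar>h\<bar> = k" using False by (simp add: k_def)
        ultimately show ?thesis by (simp add: abs_le_iff)
      qed
    qed
  qed
  show "t > 0 \<Longrightarrow> (u has_real_derivative v t) (at t)" by (rule der)
  show "continuous_on {0..T} u"
    unfolding continuous_on_eq_continuous_within
  proof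
    fix x assume x: "x \<in> {0..T}"
    show "continuous (at x within {0..T}) u"
    proof (cases "x = 0")
      case False
      then have "isCont u x" using der[of x] x by (intro DERIV_isCont) auto
      then show ?thesis by (rule continuous_at_imp_continuous_at_within)
    next
      case True
      have "((\<lambda>h. h * \<bar>v 0\<bar> + h * r h) \<longlongrightarrow> 0 * \<bar>v 0\<bar> + 0 * 0) (at_right 0)"
        by (intro tendsto_intros r)
      then have l0: "((\<lambda>h. h * \<bar>v 0\<bar> + h * r h) \<longlongrightarrow> 0) (at_right 0)" by simp
      have "\<forall>\<^sub>F h in at_right 0. norm (u h - u 0) \<le> h * \<bar>v 0\<bar> + h * r h"
        using eventually_at_right_less[of 0]
      proof eventually_elim
        case (elim h)
        have "\<bar>u h - u 0\<bar> \<le> \<bar>u h - u 0 - h * v 0\<bar> + \<bar>h * v 0\<bar>" by simp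
        then show ?case using inc[of 0 h] elim by (simp add: abs_mult)
      qed
      then have "((\<lambda>h. u h - u 0) \<longlongrightarrow> 0) (at_right 0)" by (rule Lim_null_comparison[OF _ l0])
      then have "(u \<longlongrightarrow> u 0) (at_right 0)" by (rule LIM_zero_cancel)
      then have "(u \<longlongrightarrow> u 0) (at 0 within {0..})" by (simp add: at_within_Ici_at_right)
      then have "(u \<longlongrightarrow> u 0) (at 0 within {0..T})" by (rule tendsto_within_subset) auto
      then show ?thesis unfolding True continuous_within .
    qed
  qed
qed

context chain
begin

lemma L2_star_product_integrable:
  assumes "f \<in> L2_star \<nu>" "g \<in> L2_star \<nu>"
  shows "integrable star1 (\<lambda>p. f (fst p) (snd p) * g (fst p) (snd p))"
proof (rule Bochner_Integration.integrable_bound)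
  show "integrable star1 (\<lambda>p. (f (fst p) (snd p))\<^sup>2 + (g (fst p) (snd p))\<^sup>2)"
    by (rule Bochner_Integration.integrable_add[OF L2_star_int[OF assms(1)] L2_star_int[OF assms(2)]])
  show "(\<lambda>p. f (fst p) (snd p) * g (fst p) (snd p)) \<in> borel_measurable star1"
    by (rule borel_measurable_times[OF L2_star_meas[OF assms(1)] L2_star_meas[OF assms(2)]])
  have "\<bar>a * b\<bar> \<le> a\<^sup>2 + b\<^sup>2" for a b :: real
  proof -
    have "0 \<le> (\<bar>a\<bar> - \<bar>b\<bar>)\<^sup>2" "0 \<le> \<bar>a\<bar> * \<bar>b\<bar>" by auto
    then have "\<bar>a\<bar> * \<bar>b\<bar> \<le> \<bar>a\<bar>\<^sup>2 + \<bar>b\<bar>\<^sup>2" by (simp only: power2_diff)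
    then show ?thesis by (simp add: abs_mult)
  qed
  then show "AE p in star1. norm (f (fst p) (snd p) * g (fst p) (snd p))
      \<le> norm ((f (fst p) (snd p))\<^sup>2 + (g (fst p) (snd p))\<^sup>2)" by (auto simp: abs_of_nonneg)
qed

sublocale L2: semi_inner "L2_star \<nu>" "\<lambda>f g. E_star \<nu> 1 (\<lambda>m \<omega>. f m \<omega> * g m \<omega>)"
proof
  show "subspace (L2_star \<nu>)"
    unfolding subspace_def
  proof (intro conjI ballI allI)
    show "0 \<in> L2_star \<nu>" using L2_star_scale[OF L2_star_const, of 0] by (simp add: zero_fun_def)
    show "f + g \<in> L2_star \<nu>" if "f \<in> L2_star \<nu>" "g \<in> L2_star \<nu>" for f g
      using L2_star_add[OF that] by (simp add: plus_fun_def)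
    show "r *\<^sub>R f \<in> L2_star \<nu>" if "f \<in> L2_star \<nu>" for f and r :: real
      using L2_star_scale[OF that, of r] by (simp add: scaleR_fun_def)
  qed
  fix f g w and r :: real
  show "E_star \<nu> 1 (\<lambda>m \<omega>. f m \<omega> * g m \<omega>) = E_star \<nu> 1 (\<lambda>m \<omega>. g m \<omega> * f m \<omega>)" by (simp add: mult.commute)
  show "0 \<le> E_star \<nu> 1 (\<lambda>m \<omega>. f m \<omega> * f m \<omega>)" unfolding E_star_def by simp
  show "E_star \<nu> 1 (\<lambda>m \<omega>. (r *\<^sub>R f) m \<omega> * w m \<omega>) = r * E_star \<nu> 1 (\<lambda>m \<omega>. f m \<omega> * w m \<omega>)"
    unfolding E_star_def by (simp add: mult.assoc)
  assume "f \<in> L2_star \<nu>" "g \<in> L2_star \<nu>" "w \<in> L2_star \<nu>"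
  then show "E_star \<nu> 1 (\<lambda>m \<omega>. (f + g) m \<omega> * w m \<omega>)
      = E_star \<nu> 1 (\<lambda>m \<omega>. f m \<omega> * w m \<omega>) + E_star \<nu> 1 (\<lambda>m \<omega>. g m \<omega> * w m \<omega>)"
    unfolding E_star_def
    by (simp add: distrib_right Bochner_Integration.integral_add L2_star_product_integrable)
qed

lemma L2_nm: "L2.nm f = norm_star \<nu> f"
  by (simp add: L2.nm_def norm_star_def power2_eq_square)

end

context chain_process
begin

lemma L2_meas: "f \<in> L2_star \<nu> \<Longrightarrow> (\<lambda>p. f (fst p) (snd p)) \<in> borel_measurable dis_conf"
  using L2_star_meas[of f] by (simp add: star1_measurable_eq)

lemma start_integral:
  assumes "h \<in> borel_measurable star1"
  shows "(\<integral>\<xi>. (h (mm \<xi>, W 0 \<xi>) :: real) \<partial>M) = (\<integral>p. h p \<partial>star1)"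
    and "integrable M (\<lambda>\<xi>. h (mm \<xi>, W 0 \<xi>)) \<longleftrightarrow> integrable star1 h"
  using integral_distr[OF start_meas assms] integrable_distr_eq[OF start_meas assms] unfolding law0 by auto

lemma contraction:
  assumes "t \<ge> 0" "f \<in> L2_star \<nu>"
  shows "trans_op K t f \<in> L2_star \<nu>" "norm_star \<nu> (trans_op K t f) \<le> norm_star \<nu> f"
  using gen assms unfolding generated_by_L_def L2_contraction_semigroup_def by blast+

lemma obs_path_meas:
  assumes "t \<ge> 0" "f \<in> L2_star \<nu>" shows "(\<lambda>\<xi>. f (mm \<xi>) (W t \<xi>)) \<in> borel_measurable M"
  using measurable_compose[OF measurable_Pair[OF mm_meas W_meas[OF assms(1)]] L2_meas[OF assms(2)]] by simp

text \<open>The joint observable \<open>g (m, \<omega>') * G (m, \<omega>\<^sub>0)\<close> as a function of the past and the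
  configuration at the later time.\<close>
definition pair_obs :: "obs \<Rightarrow> obs \<Rightarrow> ((conf \<times> conf) \<times> conf) \<times> conf \<Rightarrow> real" where
  "pair_obs g G x = g (fst (fst (fst x))) (snd x) * G (fst (fst (fst x))) (snd (fst (fst x)))"

lemma pair_obs_meas:
  assumes "g \<in> L2_star \<nu>" "G \<in> L2_star \<nu>"
  shows "pair_obs g G \<in> borel_measurable (past_space \<Otimes>\<^sub>M conf_space)"
proof -
  have a: "(\<lambda>x. (fst (fst (fst x)), snd x)) \<in> past_space \<Otimes>\<^sub>M conf_space \<rightarrow>\<^sub>M dis_conf" by simp
  have b: "(\<lambda>x. fst (fst x)) \<in> past_space \<Otimes>\<^sub>M conf_space \<rightarrow>\<^sub>M dis_conf" by simp
  show ?thesis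
    unfolding pair_obs_def[abs_def]
    using borel_measurable_times[OF measurable_compose[OF a L2_meas[OF assms(1)]] measurable_compose[OF b L2_meas[OF assms(2)]]]
    by simp
qed

lemma pair_obs_upto: "pair_obs g G (upto s \<xi>, \<omega>) = g (mm \<xi>) \<omega> * G (mm \<xi>) (W 0 \<xi>)"
  by (simp add: pair_obs_def upto_def)

text \<open>The semigroup contracts \<open>L\<^sup>2\<close>, but it is given as an integral, which is a default value
  where it does not exist; so the bound is proved for truncations of \<open>g\<close> and passes to the
  limit by monotone convergence.\<close>
lemma correlation_nn_bound:
  assumes t: "t \<ge> 0" and g: "g \<in> L2_star \<nu>" and G: "G \<in> L2_star \<nu>"
  shows "(\<integral>\<^sup>+\<xi>. ennreal (\<bar>g (mm \<xi>) (W t \<xi>)\<bar> * \<bar>G (mm \<xi>) (W 0 \<xi>)\<bar>) \<partial>M) \<le> ennreal (norm_star \<nu> g * norm_star \<nu> G)"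
proof -
  define gn where "gn n m \<omega> = min \<bar>g m \<omega>\<bar> (real n)" for n :: nat and m \<omega>
  define aG where "aG m \<omega> = \<bar>G m \<omega>\<bar>" for m \<omega>
  have aG: "aG \<in> L2_star \<nu>" "norm_star \<nu> aG \<le> norm_star \<nu> G"
    by (rule L2_star_bound[OF _ G]; use L2_star_meas[OF G] in \<open>simp add: aG_def\<close>)+
  have gn: "gn n \<in> L2_star \<nu>" "norm_star \<nu> (gn n) \<le> norm_star \<nu> g" for n
    by (rule L2_star_bound[OF _ g]; use L2_star_meas[OF g] in \<open>simp add: gn_def\<close>)+
  let ?I = "\<lambda>n \<xi>. ennreal (gn n (mm \<xi>) (W t \<xi>) * aG (mm \<xi>) (W 0 \<xi>))"
  have bound: "(\<integral>\<^sup>+\<xi>. ?I n \<xi> \<partial>M) \<le> ennreal (norm_star \<nu> g * norm_star \<nu> G)" for n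
  proof -
    let ?u = "trans_op K t (gn n)"
    have u: "?u \<in> L2_star \<nu>" "norm_star \<nu> ?u \<le> norm_star \<nu> g"
      using contraction[OF t gn(1)] gn(2) by (auto intro: order.trans)
    have u0: "?u m \<omega> \<ge> 0" for m \<omega> unfolding trans_op_def by (rule integral_nonneg_AE) (simp add: gn_def)
    have pm: "(\<lambda>x. ennreal (pair_obs (gn n) aG x)) \<in> borel_measurable (past_space \<Otimes>\<^sub>M conf_space)"
      using pair_obs_meas[OF gn(1)[of n] aG(1)] by measurable
    have "(\<integral>\<^sup>+\<xi>. ?I n \<xi> \<partial>M) = (\<integral>\<^sup>+\<xi>. \<integral>\<^sup>+\<omega>. ennreal (gn n (mm \<xi>) \<omega> * aG (mm \<xi>) (W 0 \<xi>)) \<partial>K (mm \<xi>) t (W 0 \<xi>) \<partial>M)"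
      using markov_nn(1)[OF order.refl t pm] by (simp only: pair_obs_upto add_0)
    also have "\<dots> = (\<integral>\<^sup>+\<xi>. ennreal (?u (mm \<xi>) (W 0 \<xi>) * aG (mm \<xi>) (W 0 \<xi>)) \<partial>M)"
    proof (rule nn_integral_cong)
      fix \<xi> assume \<xi>: "\<xi> \<in> space M"
      let ?k = "K (mm \<xi>) t (W 0 \<xi>)"
      interpret k: prob_space ?k by (rule K_prob(1)[OF t mm_Omega[OF \<xi>]])
      have "gn n (mm \<xi>) \<in> borel_measurable conf_space"
        using measurable_compose[OF measurable_Pair1'[OF measurable_space[OF mm_meas \<xi>]] L2_meas[OF gn(1)[of n]]] by simp
      then have "gn n (mm \<xi>) \<in> borel_measurable ?k"
        using measurable_cong_sets[OF K_prob(2)[OF t mm_Omega[OF \<xi>]] refl] by blast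
      then have i: "integrable ?k (gn n (mm \<xi>))"
        by (intro k.integrable_const_bound[of _ "real n"]) (simp_all add: gn_def)
      have "(\<integral>\<^sup>+\<omega>. ennreal (gn n (mm \<xi>) \<omega> * aG (mm \<xi>) (W 0 \<xi>)) \<partial>?k)
          = ennreal (\<integral>\<omega>. gn n (mm \<xi>) \<omega> * aG (mm \<xi>) (W 0 \<xi>) \<partial>?k)"
        by (rule nn_integral_eq_integral[OF integrable_mult_left[OF i]]) (simp add: gn_def aG_def)
      then show "(\<integral>\<^sup>+\<omega>. ennreal (gn n (mm \<xi>) \<omega> * aG (mm \<xi>) (W 0 \<xi>)) \<partial>?k)
          = ennreal (?u (mm \<xi>) (W 0 \<xi>) * aG (mm \<xi>) (W 0 \<xi>))"
        by (simp add: trans_op_def)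
    qed
    also have "\<dots> = ennreal (\<integral>\<xi>. ?u (mm \<xi>) (W 0 \<xi>) * aG (mm \<xi>) (W 0 \<xi>) \<partial>M)"
    proof (rule nn_integral_eq_integral)
      show "integrable M (\<lambda>\<xi>. ?u (mm \<xi>) (W 0 \<xi>) * aG (mm \<xi>) (W 0 \<xi>))"
        using L2_star_product_integrable[OF u(1) aG(1)]
          start_integral(2)[OF borel_measurable_integrable[OF L2_star_product_integrable[OF u(1) aG(1)]]] by simp
    qed (simp add: u0 aG_def)
    also have "(\<integral>\<xi>. ?u (mm \<xi>) (W 0 \<xi>) * aG (mm \<xi>) (W 0 \<xi>) \<partial>M) = E_star \<nu> 1 (\<lambda>m \<omega>. ?u m \<omega> * aG m \<omega>)"
      using start_integral(1)[OF borel_measurable_integrable[OF L2_star_product_integrable[OF u(1) aG(1)]]]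
      by (simp add: E_star_def)
    finally have eq: "(\<integral>\<^sup>+\<xi>. ?I n \<xi> \<partial>M) = ennreal (E_star \<nu> 1 (\<lambda>m \<omega>. ?u m \<omega> * aG m \<omega>))" .
    have "E_star \<nu> 1 (\<lambda>m \<omega>. ?u m \<omega> * aG m \<omega>) \<le> norm_star \<nu> ?u * norm_star \<nu> aG"
      using L2.Cauchy_Schwarz[OF u(1) aG(1)] by (simp add: L2_nm abs_le_iff)
    also have "norm_star \<nu> ?u * norm_star \<nu> aG \<le> norm_star \<nu> g * norm_star \<nu> G"
      by (rule mult_mono[OF u(2) aG(2) norm_star_nonneg norm_star_nonneg])
    finally show ?thesis unfolding eq by (rule ennreal_leI)
  qed
  have meas: "?I n \<in> borel_measurable M" for n
    using obs_path_meas[OF t gn(1)[of n]] obs_path_meas[OF order.refl aG(1)] by measurable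
  have inc: "incseq ?I"
    by (intro incseq_SucI le_funI ennreal_leI mult_right_mono) (auto simp: gn_def aG_def)
  have sup: "(SUP n. ?I n \<xi>) = ennreal (\<bar>g (mm \<xi>) (W t \<xi>)\<bar> * \<bar>G (mm \<xi>) (W 0 \<xi>)\<bar>)" for \<xi>
  proof (rule antisym)
    show "(SUP n. ?I n \<xi>) \<le> ennreal (\<bar>g (mm \<xi>) (W t \<xi>)\<bar> * \<bar>G (mm \<xi>) (W 0 \<xi>)\<bar>)"
      by (intro SUP_least ennreal_leI mult_mono) (auto simp: gn_def aG_def)
    obtain n :: nat where "\<bar>g (mm \<xi>) (W t \<xi>)\<bar> \<le> real n" using real_arch_simple by blast
    then have "ennreal (\<bar>g (mm \<xi>) (W t \<xi>)\<bar> * \<bar>G (mm \<xi>) (W 0 \<xi>)\<bar>) = ?I n \<xi>"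
      by (simp add: gn_def aG_def min_absorb1)
    also have "\<dots> \<le> (SUP n. ?I n \<xi>)" by (rule SUP_upper) simp
    finally show "ennreal (\<bar>g (mm \<xi>) (W t \<xi>)\<bar> * \<bar>G (mm \<xi>) (W 0 \<xi>)\<bar>) \<le> (SUP n. ?I n \<xi>)" .
  qed
  have "(\<integral>\<^sup>+\<xi>. (SUP n. ?I n \<xi>) \<partial>M) = (SUP n. \<integral>\<^sup>+\<xi>. ?I n \<xi> \<partial>M)"
    by (rule nn_integral_monotone_convergence_SUP[OF inc meas])
  also have "\<dots> \<le> ennreal (norm_star \<nu> g * norm_star \<nu> G)" by (rule SUP_least[OF bound])
  finally show ?thesis by (simp only: sup)
qed

definition corr :: "obs \<Rightarrow> obs \<Rightarrow> real \<Rightarrow> real" where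
  "corr g G t = (\<integral>\<xi>. g (mm \<xi>) (W t \<xi>) * G (mm \<xi>) (W 0 \<xi>) \<partial>M)"

lemma corr_integrable:
  assumes t: "t \<ge> 0" and g: "g \<in> L2_star \<nu>" and G: "G \<in> L2_star \<nu>"
  shows "integrable M (\<lambda>\<xi>. g (mm \<xi>) (W t \<xi>) * G (mm \<xi>) (W 0 \<xi>))"
  unfolding integrable_iff_bounded
proof
  show "(\<lambda>\<xi>. g (mm \<xi>) (W t \<xi>) * G (mm \<xi>) (W 0 \<xi>)) \<in> borel_measurable M"
    by (rule borel_measurable_times[OF obs_path_meas[OF t g] obs_path_meas[OF order.refl G]])
  show "(\<integral>\<^sup>+\<xi>. ennreal (norm (g (mm \<xi>) (W t \<xi>) * G (mm \<xi>) (W 0 \<xi>))) \<partial>M) < \<infinity>"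
    using correlation_nn_bound[OF assms] by (simp add: abs_mult le_less_trans)
qed

lemma corr_bound:
  assumes t: "t \<ge> 0" and g: "g \<in> L2_star \<nu>" and G: "G \<in> L2_star \<nu>"
  shows "\<bar>corr g G t\<bar> \<le> norm_star \<nu> g * norm_star \<nu> G"
proof -
  have "ennreal \<bar>corr g G t\<bar> \<le> (\<integral>\<^sup>+\<xi>. ennreal (norm (g (mm \<xi>) (W t \<xi>) * G (mm \<xi>) (W 0 \<xi>))) \<partial>M)"
    unfolding corr_def using integral_norm_bound_ennreal[OF corr_integrable[OF assms]] by simp
  also have "\<dots> \<le> ennreal (norm_star \<nu> g * norm_star \<nu> G)"
    using correlation_nn_bound[OF assms] by (simp add: abs_mult)
  finally show ?thesis by (simp add: ennreal_le_iff)
qed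

lemma corr_0:
  assumes g: "g \<in> L2_star \<nu>" and G: "G \<in> L2_star \<nu>"
  shows "corr g G 0 = E_star \<nu> 1 (\<lambda>m \<omega>. g m \<omega> * G m \<omega>)"
  using start_integral(1)[OF borel_measurable_integrable[OF L2_star_product_integrable[OF assms]]]
  by (simp add: corr_def E_star_def)

lemma corr_diff:
  assumes "t \<ge> 0" "f \<in> L2_star \<nu>" "g \<in> L2_star \<nu>" "G \<in> L2_star \<nu>"
  shows "corr (\<lambda>m \<omega>. f m \<omega> - g m \<omega>) G t = corr f G t - corr g G t"
  unfolding corr_def left_diff_distrib
  by (rule Bochner_Integration.integral_diff) (rule corr_integrable assms)+

lemma corr_scale: "corr (\<lambda>m \<omega>. r * f m \<omega>) G t = r * corr f G t"
  unfolding corr_def by (simp add: mult.assoc)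

lemma corr_cong: "(\<And>m \<omega>. m \<in> Omega_D C \<Longrightarrow> f m \<omega> = g m \<omega>) \<Longrightarrow> corr f G t = corr g G t"
  unfolding corr_def by (rule Bochner_Integration.integral_cong) (auto simp: mm_Omega)

lemma corr_markov:
  assumes s: "s \<ge> 0" and h: "h \<ge> 0" and g: "g \<in> L2_star \<nu>" and G: "G \<in> L2_star \<nu>"
  shows "corr g G (s + h) = corr (trans_op K h g) G s"
proof -
  have "(\<integral>\<xi>. pair_obs g G (upto s \<xi>, W (s + h) \<xi>) \<partial>M)
      = (\<integral>\<xi>. (\<integral>\<omega>. pair_obs g G (upto s \<xi>, \<omega>) \<partial>K (mm \<xi>) h (W s \<xi>)) \<partial>M)"
  proof (rule markov_integral[OF s h pair_obs_meas[OF g G]])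
    show "integrable M (\<lambda>\<xi>. pair_obs g G (upto s \<xi>, W (s + h) \<xi>))"
      unfolding pair_obs_upto using s h by (intro corr_integrable g G) simp
  qed
  then show ?thesis unfolding pair_obs_upto corr_def trans_op_def by simp
qed

definition gen_rate :: "darr \<Rightarrow> real \<Rightarrow> real" where
  "gen_rate f h = norm_star \<nu> (\<lambda>m \<omega>. (trans_op K h (obs_of f) m \<omega> - obs_of f m \<omega>) / h - gen_L lam \<gamma> (obs_of f) m \<omega>)"

lemma obs_of_generator:
  assumes "f \<in> arrays C"
  shows "gen_L lam \<gamma> (obs_of f) \<in> L2_star \<nu>" "(gen_rate f \<longlongrightarrow> 0) (at_right 0)"
  using gen obs_of_cyl_obs[OF assms] unfolding generated_by_L_def L2_generator_def gen_rate_def[abs_def] by blast+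

text \<open>By the Markov property the increment over \<open>h\<close> is again a correlation at time \<open>t\<close>, now of the
difference quotient of the semigroup; contractivity makes the estimate uniform in \<open>t\<close>.\<close>
lemma corr_increment:
  assumes f: "f \<in> arrays C" and G: "G \<in> L2_star \<nu>" and t: "t \<ge> 0" and h: "h > 0"
  shows "\<bar>corr (obs_of f) G (t + h) - corr (obs_of f) G t - h * corr (obs_of (plain.L f)) G t\<bar>
    \<le> h * (gen_rate f h * norm_star \<nu> G)"
proof -
  let ?F = "obs_of f" and ?P = "trans_op K h (obs_of f)" and ?L = "gen_L lam \<gamma> (obs_of f)"
  have F: "?F \<in> L2_star \<nu>" by (rule obs_of_L2[OF f])
  have P: "?P \<in> L2_star \<nu>" using h by (intro contraction F) simp
  have L: "?L \<in> L2_star \<nu>" by (rule obs_of_generator[OF f])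
  let ?D = "\<lambda>m \<omega>. ?P m \<omega> - ?F m \<omega>"
  have D: "?D \<in> L2_star \<nu>" by (rule L2_star_diff[OF P F])
  let ?Q = "\<lambda>m \<omega>. ?D m \<omega> / h - ?L m \<omega>"
  have Dh: "(\<lambda>m \<omega>. ?D m \<omega> / h) \<in> L2_star \<nu>" using L2_star_scale[OF D, of "1 / h"] by simp
  have Q: "?Q \<in> L2_star \<nu>" by (rule L2_star_diff[OF Dh L])
  have "corr ?F G (t + h) - corr ?F G t - h * corr (obs_of (plain.L f)) G t = corr ?D G t - h * corr ?L G t"
    using corr_markov[OF t less_imp_le[OF h] F G] corr_diff[OF t P F G]
      corr_cong[of ?L "obs_of (plain.L f)" G t] gen_L_obs_of[OF f] by simp
  also have "\<dots> = h * corr ?Q G t"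
  proof -
    have "corr (\<lambda>m \<omega>. ?D m \<omega> / h) G t = corr ?D G t / h"
      using corr_scale[of "1 / h" ?D G t] by simp
    then show ?thesis unfolding corr_diff[OF t Dh L G] using h by (simp add: right_diff_distrib)
  qed
  finally show ?thesis
    using corr_bound[OF t Q G] h by (simp add: gen_rate_def abs_mult mult_left_mono)
qed

lemma corr_deriv:
  assumes f: "f \<in> arrays C" and G: "G \<in> L2_star \<nu>"
  shows "t > 0 \<Longrightarrow> (corr (obs_of f) G has_real_derivative corr (obs_of (plain.L f)) G t) (at t)"
    and "continuous_on {0..T} (corr (obs_of f) G)"
proof -
  define s where "s h = h * (norm_star \<nu> (obs_of (plain.L (plain.L f))) * norm_star \<nu> G)
      + h * (gen_rate (plain.L f) h * norm_star \<nu> G)" for h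
  have Lf: "plain.L f \<in> arrays C" "plain.L (plain.L f) \<in> arrays C" using f by auto
  have vc: "\<bar>corr (obs_of (plain.L f)) G (t + h) - corr (obs_of (plain.L f)) G t\<bar> \<le> s h" if "t \<ge> 0" "h > 0" for t h
  proof -
    have "\<bar>h * corr (obs_of (plain.L (plain.L f))) G t\<bar> \<le> h * (norm_star \<nu> (obs_of (plain.L (plain.L f))) * norm_star \<nu> G)"
      using corr_bound[OF that(1) obs_of_L2(1)[OF Lf(2)] G] that by (simp add: abs_mult mult_left_mono)
    then show ?thesis using corr_increment[OF Lf(1) G that] by (simp add: s_def abs_le_iff)
  qed
  have "(s \<longlongrightarrow> 0 * (norm_star \<nu> (obs_of (plain.L (plain.L f))) * norm_star \<nu> G) + 0 * (0 * norm_star \<nu> G)) (at_right 0)"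
    unfolding s_def by (intro tendsto_intros obs_of_generator(2)[OF Lf(1)])
  then have s0: "(s \<longlongrightarrow> 0) (at_right 0)" by simp
  have r0: "((\<lambda>h. gen_rate f h * norm_star \<nu> G) \<longlongrightarrow> 0) (at_right 0)"
    by (rule tendsto_mult_left_zero[OF obs_of_generator(2)[OF f]])
  show "t > 0 \<Longrightarrow> (corr (obs_of f) G has_real_derivative corr (obs_of (plain.L f)) G t) (at t)"
    and "continuous_on {0..T} (corr (obs_of f) G)"
    by (rule one_sided_increments_imp_deriv[OF corr_increment[OF f G] vc r0 s0]; assumption)+
qed

text \<open>Taylor's formula at time \<open>0\<close>. In the induction the bound for \<open>plain.L f\<close> is integrated, by
comparing the remainder with the monomial \<open>t ^ Suc N / fact (Suc N)\<close>. As \<open>plain.L\<close> is bounded, the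
remainder vanishes as \<open>N\<close> grows.\<close>
lemma corr_Taylor:
  assumes "f \<in> arrays C" and G: "G \<in> L2_star \<nu>" and t: "t \<ge> 0"
  shows "\<bar>corr (obs_of f) G t - (\<Sum>n<N. t ^ n / fact n * corr (obs_of ((plain.L ^^ n) f)) G 0)\<bar>
    \<le> sqrt 2 * norm_star \<nu> G * plain.Lbd ^ N * plain.nm f * (t ^ N / fact N)"
  using assms(1) t
proof (induction N arbitrary: f t)
  case 0
  then show ?case using corr_bound[OF 0(2) obs_of_L2(1)[OF 0(1)] G] by (simp add: obs_of_L2(2)[OF 0(1)] mult_ac)
next
  case (Suc N)
  note f = Suc.prems(1)
  have Lf: "plain.L f \<in> arrays C" using f by auto
  let ?T = "\<lambda>N f t. \<Sum>n<N. t ^ n / fact n * corr (obs_of ((plain.L ^^ n) f)) G 0"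
  define B where "B = sqrt 2 * norm_star \<nu> G * plain.Lbd ^ Suc N * plain.nm f"
  have dT: "(?T (Suc N) f has_real_derivative ?T N (plain.L f) x) (at x)" for x
  proof -
    have "((\<lambda>t. \<Sum>n<N. t ^ Suc n / fact (Suc n) * corr (obs_of ((plain.L ^^ Suc n) f)) G 0) has_real_derivative
        (\<Sum>n<N. (real (Suc n) * x ^ n) / fact (Suc n) * corr (obs_of ((plain.L ^^ Suc n) f)) G 0)) (at x)"
      by (rule DERIV_sum, rule DERIV_cmult_right, rule DERIV_cdivide, rule DERIV_cong[OF DERIV_pow]) simp
    then have "((\<lambda>t. corr (obs_of f) G 0 + (\<Sum>n<N. t ^ Suc n / fact (Suc n) * corr (obs_of ((plain.L ^^ Suc n) f)) G 0)) has_real_derivative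
        0 + (\<Sum>n<N. (real (Suc n) * x ^ n) / fact (Suc n) * corr (obs_of ((plain.L ^^ Suc n) f)) G 0)) (at x)"
      by (intro DERIV_add DERIV_const)
    moreover have "?T (Suc N) f = (\<lambda>t. corr (obs_of f) G 0 + (\<Sum>n<N. t ^ Suc n / fact (Suc n) * corr (obs_of ((plain.L ^^ Suc n) f)) G 0))"
      by (rule ext, subst sum.lessThan_Suc_shift) simp
    moreover have "?T N (plain.L f) x = 0 + (\<Sum>n<N. (real (Suc n) * x ^ n) / fact (Suc n) * corr (obs_of ((plain.L ^^ Suc n) f)) G 0)"
      by (simp add: funpow_swap1 fact_Suc del: of_nat_Suc)
    ultimately show ?thesis by simp
  qed
  have bnd: "\<bar>corr (obs_of (plain.L f)) G x - ?T N (plain.L f) x\<bar> \<le> B * (x ^ N / fact N)" if "x \<ge> 0" for x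
  proof -
    have "\<bar>corr (obs_of (plain.L f)) G x - ?T N (plain.L f) x\<bar>
        \<le> sqrt 2 * norm_star \<nu> G * plain.Lbd ^ N * plain.nm (plain.L f) * (x ^ N / fact N)"
      by (rule Suc.IH[OF Lf that])
    also have "\<dots> \<le> sqrt 2 * norm_star \<nu> G * plain.Lbd ^ N * (plain.Lbd * plain.nm f) * (x ^ N / fact N)"
      using plain.nm_L_le[OF f] plain.Lbd_nonneg that
      by (intro mult_right_mono mult_left_mono) auto
    finally show ?thesis by (simp add: B_def mult_ac)
  qed
  have T0: "?T (Suc N) f 0 = corr (obs_of f) G 0" by (subst sum.lessThan_Suc_shift) simp
  have key: "\<sigma> * (corr (obs_of f) G t - ?T (Suc N) f t) \<le> B * (t ^ Suc N / fact (Suc N))" if \<sigma>: "\<sigma> = 1 \<or> \<sigma> = - 1" for \<sigma> :: real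
  proof (cases "t = 0")
    case True
    show ?thesis unfolding True T0 by simp
  next
    case False
    then have t: "0 < t" using Suc.prems by simp
    define e where "e x = B * (x ^ Suc N / fact (Suc N)) - \<sigma> * (corr (obs_of f) G x - ?T (Suc N) f x)" for x
    have de: "(e has_real_derivative B * (x ^ N / fact N) - \<sigma> * (corr (obs_of (plain.L f)) G x - ?T N (plain.L f) x)) (at x)"
      if "x > 0" for x
    proof -
      have "((\<lambda>x. x ^ Suc N / fact (Suc N)) has_real_derivative (real (Suc N) * x ^ N) / fact (Suc N)) (at x)"
        by (rule DERIV_cdivide, rule DERIV_cong[OF DERIV_pow]) simp
      moreover have "(real (Suc N) * x ^ N) / fact (Suc N) = x ^ N / fact N" by (simp add: fact_Suc del: of_nat_Suc)
      ultimately show ?thesis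
        unfolding e_def[abs_def]
        by (intro DERIV_diff DERIV_cmult corr_deriv(1)[OF f G that] dT) simp_all
    qed
    have "continuous_on {0..t} e"
      unfolding e_def[abs_def]
      by (intro continuous_on_diff continuous_on_mult continuous_on_const corr_deriv(2)[OF f G]
          continuous_on_divide continuous_on_power continuous_on_id DERIV_continuous_on[OF has_field_derivative_at_within[OF dT]])
        simp_all
    from MVT[OF t this] obtain l z where z: "0 < z" "z < t" "(e has_real_derivative l) (at z)" "e t - e 0 = (t - 0) * l"
      using de real_differentiable_def by blast
    have "l = B * (z ^ N / fact N) - \<sigma> * (corr (obs_of (plain.L f)) G z - ?T N (plain.L f) z)"
      by (rule DERIV_unique[OF z(3) de[OF z(1)]])
    also have "\<dots> \<ge> 0" using bnd[of z] z(1) \<sigma> by (auto simp: abs_le_iff)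
    finally have "0 \<le> (t - 0) * l" using t by simp
    then have "e t \<ge> e 0" using z(4) by linarith
    moreover have "e 0 = 0" unfolding e_def T0 by simp
    ultimately have "0 \<le> e t" by linarith
    then show ?thesis unfolding e_def by linarith
  qed
  show ?case using key[of 1] key[of "-1"] unfolding B_def by (simp add: abs_le_iff)
qed

lemma corr_sums:
  assumes f: "f \<in> arrays C" and G: "G \<in> L2_star \<nu>" and t: "t \<ge> 0"
  shows "(\<lambda>n. t ^ n / fact n * corr (obs_of ((plain.L ^^ n) f)) G 0) sums corr (obs_of f) G t"
  unfolding sums_def
proof (rule LIM_zero_cancel, rule Lim_null_comparison)
  have "(\<lambda>N. (plain.Lbd * t) ^ N / fact N) \<longlonglongrightarrow> 0"
    using summable_LIMSEQ_zero[OF summable_exp[of "plain.Lbd * t"]] by (simp add: field_simps)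
  then have "(\<lambda>N. sqrt 2 * norm_star \<nu> G * plain.nm f * ((plain.Lbd * t) ^ N / fact N)) \<longlonglongrightarrow> 0"
    by (rule tendsto_mult_right_zero)
  then show "(\<lambda>N. sqrt 2 * norm_star \<nu> G * plain.Lbd ^ N * plain.nm f * (t ^ N / fact N)) \<longlonglongrightarrow> 0"
    by (simp add: power_mult_distrib mult_ac)
  show "\<forall>\<^sub>F N in sequentially. norm ((\<Sum>n<N. t ^ n / fact n * corr (obs_of ((plain.L ^^ n) f)) G 0) - corr (obs_of f) G t)
      \<le> sqrt 2 * norm_star \<nu> G * plain.Lbd ^ N * plain.nm f * (t ^ N / fact N)"
    using corr_Taylor[OF f G t] by (simp add: abs_minus_commute)
qed

end

section \<open>The Green--Kubo formula\<close>

lemma abs_summable_on_finite_support: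
  fixes h :: "'b \<Rightarrow> real"
  assumes "finite A" "\<And>x. x \<notin> A \<Longrightarrow> h x = 0" "\<And>x. \<bar>h x\<bar> \<le> c"
  shows "(\<lambda>x. norm (h x)) summable_on UNIV" "(\<Sum>\<^sub>\<infinity>x. \<bar>h x\<bar>) \<le> real (card A) * c"
proof -
  show "(\<lambda>x. norm (h x)) summable_on UNIV"
    by (rule finite_nonzero_values_imp_summable_on, rule finite_subset[OF _ assms(1)]) (use assms(2) in auto)
  have "(\<Sum>\<^sub>\<infinity>x. \<bar>h x\<bar>) = (\<Sum>x\<in>A. \<bar>h x\<bar>)"
    unfolding infsum_finite[OF assms(1), symmetric] by (rule infsum_cong_neutral) (use assms(2) in auto)
  also have "\<dots> \<le> real (card A) * c" by (rule sum_bounded_above[OF assms(3)])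
  finally show "(\<Sum>\<^sub>\<infinity>x. \<bar>h x\<bar>) \<le> real (card A) * c" .
qed

context chain
begin

lemma L_pow_supp: "bounded_supp (1 + int n) ((plain.L ^^ n) current_arr m)"
proof (induction n arbitrary: m)
  case 0
  show ?case using current_arr_supp[of m] by simp
next
  case (Suc n)
  let ?f = "(plain.L ^^ n) current_arr"
  have A: "bounded_supp (1 + int n + 1) (arr_A (cond m) (?f m))" by (rule arr_A_supp[OF Suc])
  have N: "bounded_supp (1 + int n + 1) (arr_N lam \<gamma> (?f m))" by (rule arr_N_supp[OF Suc])
  have "bounded_supp (1 + int n + 1) (\<lambda>p. arr_A (cond m) (?f m) p - arr_N lam \<gamma> (?f m) p)"
    unfolding bounded_supp_iff using bounded_suppD[OF A] bounded_suppD[OF N] by auto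
  moreover have "(plain.L ^^ Suc n) current_arr m = (\<lambda>p. arr_A (cond m) (?f m) p - arr_N lam \<gamma> (?f m) p)"
    by (auto simp: plain.L_def op_A_def op_N_def fun_eq_iff)
  ultimately show ?case by (simp add: add.commute add.left_commute)
qed

text \<open>Each application of \<open>L\<close> enlarges the support by at most one site, so at order \<open>n\<close> the current
only meets its translates by \<open>O (n)\<close> sites.\<close>
lemma L_pow_far:
  assumes "\<bar>x\<bar> > 2 + int n" shows "ip0 ((plain.L ^^ n) current_arr) (op_T x current_arr) = 0"
proof -
  have "arr_ip ((plain.L ^^ n) current_arr m) (op_T x current_arr m) = 0" for m
    unfolding arr_ip_def
  proof (rule infsum_0)
    fix p
    show "(plain.L ^^ n) current_arr m p * op_T x current_arr m p = 0"
    proof (cases "p \<in> index_box (1 + int n)")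
      case True
      have "current_arr (shift_conf x m) (fst p - x, snd p - x) = 0"
        by (rule bounded_suppD[OF current_arr_supp]) (use True assms in auto)
      then show ?thesis by (simp add: op_T_def)
    next
      case False
      then show ?thesis by (simp add: bounded_suppD[OF L_pow_supp] del: index_box_iff)
    qed
  qed
  then show ?thesis by (simp add: arr_ip_mean_def)
qed

lemma L_pow_current_in: "(plain.L ^^ n) current_arr \<in> arrays C"
  by (rule plain.L_pow_closed[OF current_arr_in])

definition corr_term :: "real \<Rightarrow> nat \<Rightarrow> int \<Rightarrow> real" where
  "corr_term t n x = t ^ n / fact n * (2 * ip0 ((plain.L ^^ n) current_arr) (op_T x current_arr))"

lemma corr_term_bound:
  assumes "t \<ge> 0"
  shows "\<bar>corr_term t n x\<bar> \<le> (t * plain.Lbd) ^ n / fact n * (2 * (plain.nm current_arr)\<^sup>2)"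
proof -
  have nT: "plain.nm (op_T x current_arr) = plain.nm current_arr"
    unfolding plain.nm_def using T_isometry[OF current_arr_in current_arr_in] by simp
  have "\<bar>ip0 ((plain.L ^^ n) current_arr) (op_T x current_arr)\<bar>
      \<le> plain.Lbd ^ n * (plain.nm current_arr * plain.nm current_arr)"
    using plain.ip_L_pow_le[OF current_arr_in op_T_closed[OF current_arr_in], of n x] unfolding nT .
  then have "t ^ n / fact n * (2 * \<bar>ip0 ((plain.L ^^ n) current_arr) (op_T x current_arr)\<bar>)
      \<le> t ^ n / fact n * (2 * (plain.Lbd ^ n * (plain.nm current_arr * plain.nm current_arr)))"
    using assms by (intro mult_left_mono) auto
  then show ?thesis
    using assms by (simp add: corr_term_def abs_mult power_mult_distrib power2_eq_square mult_ac)
qed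

lemma corr_term_zero: "x \<notin> {- (2 + int n)..2 + int n} \<Longrightarrow> corr_term t n x = 0"
  using L_pow_far[of n x] by (auto simp: corr_term_def)

text \<open>At order \<open>n\<close> at most \<open>2 * n + 5 \<le> 5 * 2 ^ n\<close> translates contribute, each at most
\<open>(t * plain.Lbd) ^ n / fact n\<close> up to a constant, so the double series converges absolutely.\<close>
lemma corr_term_abs_summable:
  assumes t: "t \<ge> 0"
  shows "(\<lambda>p. norm (case p of (n, x) \<Rightarrow> corr_term t n x)) summable_on UNIV \<times> UNIV"
  unfolding Infinite_Sum.abs_summable_on_Sigma_iff
proof (intro conjI ballI)
  define c where "c n = (t * plain.Lbd) ^ n / fact n * (2 * (plain.nm current_arr)\<^sup>2)" for n :: nat
  have c0: "c n \<ge> 0" for n unfolding c_def using t plain.Lbd_nonneg by simp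
  have b: "(\<lambda>x. norm (corr_term t n x)) summable_on UNIV" "(\<Sum>\<^sub>\<infinity>x. \<bar>corr_term t n x\<bar>) \<le> real (card {- (2 + int n)..2 + int n}) * c n" for n
    using abs_summable_on_finite_support[where h = "corr_term t n" and A = "{- (2 + int n)..2 + int n}" and c = "c n"]
      corr_term_zero[of _ n t] corr_term_bound[OF t, of n] unfolding c_def by blast+
  show "(\<lambda>x. norm (case (n, x) of (n, x) \<Rightarrow> corr_term t n x)) summable_on UNIV" for n
    using b(1)[of n] by simp
  have le: "(\<Sum>\<^sub>\<infinity>x. \<bar>corr_term t n x\<bar>) \<le> (2 * (t * plain.Lbd)) ^ n / fact n * (10 * (plain.nm current_arr)\<^sup>2)" for n
  proof -
    have card: "real (card {- (2 + int n)..2 + int n}) \<le> 5 * 2 ^ n"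
    proof (induction n)
      case (Suc n)
      have "1 \<le> (2::real) ^ n" by simp
      then show ?case using Suc by simp
    qed simp
    have "(\<Sum>\<^sub>\<infinity>x. \<bar>corr_term t n x\<bar>) \<le> (5 * 2 ^ n) * c n"
      using b(2)[of n] mult_right_mono[OF card c0[of n]] by linarith
    also have "\<dots> = (2 * (t * plain.Lbd)) ^ n / fact n * (10 * (plain.nm current_arr)\<^sup>2)"
      by (simp add: c_def power_mult_distrib)
    finally show ?thesis .
  qed
  have "summable (\<lambda>n. norm (\<Sum>\<^sub>\<infinity>x. \<bar>corr_term t n x\<bar>))"
  proof (rule summable_comparison_test'[OF plain.exp_series_summable, of 0])
    fix n
    have "(\<Sum>\<^sub>\<infinity>x. \<bar>corr_term t n x\<bar>) \<ge> 0" by (rule infsum_nonneg) simp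
    then show "norm (norm (\<Sum>\<^sub>\<infinity>x. \<bar>corr_term t n x\<bar>)) \<le> (2 * (t * plain.Lbd)) ^ n / fact n * (10 * (plain.nm current_arr)\<^sup>2)"
      using le[of n] by simp
  qed
  then have "(\<lambda>n. norm (\<Sum>\<^sub>\<infinity>x. \<bar>corr_term t n x\<bar>)) summable_on UNIV"
    by (intro norm_summable_imp_summable_on) simp
  then show "(\<lambda>n. norm (\<Sum>\<^sub>\<infinity>x\<in>UNIV. norm (case (n, x) of (n, x) \<Rightarrow> corr_term t n x))) summable_on UNIV"
    by simp
qed

end

context chain_process
begin

lemma translate_current: "translate x current = obs_of (op_T x current_arr)"
  using translate_obs_of[of x current_arr] current_obs_of by (intro ext) (simp add: translate_def)

lemma current_eq: "current = obs_of current_arr"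
  by (intro ext) (rule current_obs_of)

lemma current_corr_eq: "current_corr M mm W t x = corr (obs_of current_arr) (obs_of (op_T x current_arr)) t"
  unfolding current_corr_def corr_def translate_current by (simp add: current_eq)

lemma current_corr_integrable:
  "t \<ge> 0 \<Longrightarrow> integrable M (\<lambda>\<xi>. current (mm \<xi>) (W t \<xi>) * translate x current (mm \<xi>) (W 0 \<xi>))"
  unfolding translate_current unfolding current_eq
  by (intro corr_integrable obs_of_L2 current_arr_in op_T_closed)

lemma current_corr_sums:
  assumes "t \<ge> 0" shows "(\<lambda>n. corr_term t n x) sums current_corr M mm W t x"
proof -
  have G: "obs_of (op_T x current_arr) \<in> L2_star \<nu>" by (rule obs_of_L2[OF op_T_closed[OF current_arr_in]])
  have "corr (obs_of ((plain.L ^^ n) current_arr)) (obs_of (op_T x current_arr)) 0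
      = 2 * ip0 ((plain.L ^^ n) current_arr) (op_T x current_arr)" for n
    using corr_0[OF obs_of_L2(1)[OF L_pow_current_in] G]
      obs_of_product(2)[OF zero_less_one L_pow_current_in op_T_closed[OF current_arr_in]] by simp
  then show ?thesis
    using corr_sums[OF current_arr_in G assms] by (simp add: current_corr_eq corr_term_def)
qed

lemma current_corr_summable:
  assumes t: "t \<ge> 0"
  shows "current_corr M mm W t summable_on UNIV"
    and "(\<Sum>\<^sub>\<infinity>x. current_corr M mm W t x) = 2 * star.evol current_arr current_arr t"
proof -
  have sw: "(\<lambda>(x, n). corr_term t n x) summable_on UNIV \<times> UNIV"
  proof -
    have "(\<lambda>(n, x). corr_term t n x) summable_on UNIV \<times> UNIV"
      by (rule Infinite_Sum.abs_summable_summable[OF corr_term_abs_summable[OF t]])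
    then show ?thesis
      by (subst summable_on_reindex_bij_witness[of _ prod.swap prod.swap _ "\<lambda>(n, x). corr_term t n x"]) auto
  qed
  have inner: "(\<Sum>\<^sub>\<infinity>n. corr_term t n x) = current_corr M mm W t x" for x
  proof -
    have "(\<lambda>n. corr_term t n x) summable_on UNIV"
      using summable_on_SigmaD1[OF sw, of x] by simp
    then have "(\<lambda>n. corr_term t n x) sums (\<Sum>\<^sub>\<infinity>n. corr_term t n x)"
      by (intro has_sum_imp_sums has_sum_infsum)
    then show ?thesis by (rule sums_unique2[OF _ current_corr_sums[OF t]])
  qed
  show "current_corr M mm W t summable_on UNIV"
    using summable_on_Sigma_banach[of "\<lambda>x n. corr_term t n x" UNIV "\<lambda>_. UNIV"] sw by (simp add: inner)
  have "(\<Sum>\<^sub>\<infinity>x. current_corr M mm W t x) = (\<Sum>\<^sub>\<infinity>x. \<Sum>\<^sub>\<infinity>n. corr_term t n x)"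
    by (simp only: inner)
  also have "\<dots> = (\<Sum>\<^sub>\<infinity>n. \<Sum>\<^sub>\<infinity>x. corr_term t n x)"
    by (rule infsum_swap_banach[OF sw])
  also have "\<dots> = (\<Sum>\<^sub>\<infinity>n. 2 * (sip ((plain.L ^^ n) current_arr) current_arr / fact n * t ^ n))"
    by (rule infsum_cong) (simp only: corr_term_def sip_def infsum_cmult_right', simp)
  also have "\<dots> = 2 * star.evol current_arr current_arr t"
  proof -
    have s: "summable (\<lambda>n. norm (sip ((plain.L ^^ n) current_arr) current_arr / fact n * t ^ n))"
      using star.evol_term_le[OF current_arr_in current_arr_in]
      by (intro summable_comparison_test'[OF star.exp_series_summable, of 0]) simp
    have "(\<Sum>\<^sub>\<infinity>n. sip ((plain.L ^^ n) current_arr) current_arr / fact n * t ^ n)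
        = (\<Sum>n. sip ((plain.L ^^ n) current_arr) current_arr / fact n * t ^ n)"
      by (rule infsumI[OF norm_summable_imp_has_sum[OF s summable_sums[OF summable_norm_cancel[OF s]]]])
    then show ?thesis unfolding infsum_cmult_right' star.evol_def by simp
  qed
  finally show "(\<Sum>\<^sub>\<infinity>x. current_corr M mm W t x) = 2 * star.evol current_arr current_arr t" .
qed

lemma Laplace_current_corr:
  assumes z: "z > 0"
  shows "set_integrable lborel {0..} (\<lambda>t. exp (- z * t) * (\<Sum>\<^sub>\<infinity>x. current_corr M mm W t x))"
    and "lam + 1 / 2 * (LBINT t:{0..}. exp (- z * t) * (\<Sum>\<^sub>\<infinity>x. current_corr M mm W t x))
      = lam + (LBINT t:{0..}. exp (- z * t) * star.evol current_arr current_arr t)"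
proof -
  let ?e = "star.evol current_arr current_arr"
  have e: "exp (- z * t) * (\<Sum>\<^sub>\<infinity>x. current_corr M mm W t x) = 2 * (exp (- z * t) * ?e t)" if "t \<in> {0..}" for t
    using current_corr_summable(2)[of t] that by simp
  have int: "set_integrable lborel {0..} (\<lambda>t. exp (- z * t) * ?e t)"
    by (rule star.Laplace_evol_integrable[OF current_arr_in current_arr_in z])
  then have "set_integrable lborel {0..} (\<lambda>t. 2 * (exp (- z * t) * ?e t))" by simp
  then show "set_integrable lborel {0..} (\<lambda>t. exp (- z * t) * (\<Sum>\<^sub>\<infinity>x. current_corr M mm W t x))"
    by (rule set_integrable_cong[THEN iffD1, rotated -1]) (simp_all only: e)
  have "(LBINT t:{0..}. exp (- z * t) * (\<Sum>\<^sub>\<infinity>x. current_corr M mm W t x)) = (LBINT t:{0..}. 2 * (exp (- z * t) * ?e t))"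
    by (rule set_lebesgue_integral_cong, simp, intro allI impI, rule e)
  then show "lam + 1 / 2 * (LBINT t:{0..}. exp (- z * t) * (\<Sum>\<^sub>\<infinity>x. current_corr M mm W t x))
      = lam + (LBINT t:{0..}. exp (- z * t) * ?e t)" by simp
qed

theorem Green_Kubo:
  assumes \<beta>: "\<beta> > 0"
  shows "((\<lambda>z. ereal (lam + 1 / 2 * (LBINT t:{0..}. exp (- z * t) * (\<Sum>\<^sub>\<infinity>x. current_corr M mm W t x))))
      \<longlongrightarrow> diffusion_coeff lam \<gamma> C \<nu> \<beta>) (at_right 0)"
proof -
  let ?l = "\<lambda>z. LBINT t:{0..}. exp (- z * t) * star.evol current_arr current_arr t"
  have "((\<lambda>z. ereal lam + ereal (?l z)) \<longlongrightarrow> diffusion_coeff lam \<gamma> C \<nu> \<beta>) (at_right 0)"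
    unfolding diffusion_coeff_eq[OF \<beta>]
    by (rule tendsto_add_ereal_general2[OF _ tendsto_const src.Laplace_tendsto_INF_SUP]) simp
  moreover have "\<forall>\<^sub>F z in at_right 0. ereal lam + ereal (?l z)
      = ereal (lam + 1 / 2 * (LBINT t:{0..}. exp (- z * t) * (\<Sum>\<^sub>\<infinity>x. current_corr M mm W t x)))"
    using eventually_at_right_less[of 0]
    by eventually_elim (simp only: Laplace_current_corr(2) plus_ereal.simps)
  ultimately show ?thesis by (rule Lim_transform_eventually)
qed

end

theorem theorem2p2:
  fixes lam \<gamma> C \<beta> :: real
    and \<nu> :: "real measure"
    and M :: "'a measure"
    and mm :: "'a \<Rightarrow> int \<Rightarrow> real"
    and W :: "real \<Rightarrow> 'a \<Rightarrow> int \<Rightarrow> real"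
  assumes "lam > 0" and "\<gamma> > 0" and "C > 1" and "\<beta> > 0"
    and "disorder_site_law C \<nu>"
    and "infinite_volume_process lam \<gamma> C \<nu> M mm W"
  shows "(\<forall>t\<ge>0. \<forall>x. integrable M
            (\<lambda>\<xi>. current (mm \<xi>) (W t \<xi>) * translate x current (mm \<xi>) (W 0 \<xi>)))
       \<and> (\<forall>t\<ge>0. current_corr M mm W t summable_on UNIV)
       \<and> (\<forall>z>0. set_integrable lborel {0..}
            (\<lambda>t. exp (- z * t) * (\<Sum>\<^sub>\<infinity>x\<in>UNIV. current_corr M mm W t x)))
       \<and> ((\<lambda>z. ereal (lam + 1 / 2 *
              (LBINT t:{0..}. exp (- z * t) * (\<Sum>\<^sub>\<infinity>x\<in>UNIV. current_corr M mm W t x))))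
            \<longlongrightarrow> diffusion_coeff lam \<gamma> C \<nu> \<beta>) (at_right 0)"
proof -
  obtain K where K: "generated_by_L lam \<gamma> C \<nu> K"
    and markov: "\<forall>s t B. 0 \<le> s \<longrightarrow> s \<le> t \<longrightarrow> B \<in> sets conf_space \<longrightarrow>
      (AE \<xi> in M. real_cond_exp M (past M \<nu> mm W s) (indicator {\<zeta> \<in> space M. W t \<zeta> \<in> B}) \<xi>
        = measure (K (mm \<xi>) (t - s) (W s \<xi>)) B)"
    using assms(6) unfolding infinite_volume_process_def by blast
  interpret chain_process lam \<gamma> C \<nu> M mm W K
    using assms K markov unfolding infinite_volume_process_def
    by (intro chain_process.intro chain.intro chain_process_axioms.intro) auto
  show ?thesis
    using current_corr_integrable current_corr_summable(1) Laplace_current_corr(1) Green_Kubo[OF assms(4)] by blast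
qed

end
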